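(* Let $\mathcal Z$ be an $m$-normal periodic orbit (of minimal period $\tau>0$, belonging to the one-parameter family $\mathcal P$) of the conservative limit $\dot x=f(x)$ of the system $\dot x=f(x)+\varepsilon g(x,t;T,\varepsilon)$, let $p\in\mathcal Z$, let $l,m\in\mathbb N^+$ be relatively prime, and let $$M^{m:l}(s)=\int_0^{m\tau}\big\langle DH(x_0(t+s;p)),\,g(x_0(t+s;p),t;\tau m/l,0)\big\rangle\,dt .$$ If $M^{m:l}$ has a simple zero at $s_0\in\mathbb R$, i.e. $M^{m:l}(s_0)=0$ and $DM^{m:l}(s_0)\neq 0$, then $\mathcal Z$ smoothly persists in the system $\dot x=f(x)+\varepsilon g(x,t;T,\varepsilon)$ for small $\varepsilon>0$. Moreover, in this case, there exists at least another topologically transverse zero of $M^{m:l}$ in the interval $(s_0,\,s_0+m\tau)$. If $M^{m:l}(s)$ remains bounded away from zero, then $\mathcal Z$ does not smoothly persist for small $\varepsilon>0$.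
   Context: **Mechanical system.** Let $N\ge1$, $n=2N$, $U\subset\mathbb R^N$ open, $q\in U$ generalised coordinates. The energy is $H(q,\dot q)=E(q,\dot q)+V(q)=\tfrac12\langle\dot q,\mathbf M(q)\dot q\rangle+V(q)$, with $\mathbf M(q)$ a symmetric positive definite mass matrix. The equations of motion are $\mathbf M(q)\ddot q+G(q,\dot q)+DV(q)=\varepsilon Q(q,\dot q,t;T,\varepsilon)$, where $\varepsilon\ge0$ is the perturbation parameter, $G(q,\dot q)=D_t(\mathbf M(q))\dot q-D_qE(q,\dot q)$, and $Q$ is $T$-periodic in $t$. With $x=(q,\dot q)\in\mathbb R^n$ this reads $\dot x=f(x)+\varepsilon g(x,t;T,\varepsilon)$, where $$f(x)=\begin{pmatrix}\dot q\\-\mathbf M^{-1}(q)(DV(q)+G(q,\dot q))\end{pmatrix},\qquad g(x,t;T,\varepsilon)=\begin{pmatrix}0\\ \mathbf M^{-1}(q)Q(q,\dot q,t;T,\varepsilon)\end{pmatrix}.$$ It is assumed that $f\in C^r$ with $r\ge2$, and $g$ is $C^{r-1}$ in $t$ and $C^r$ in the other arguments. $x(t;\xi,T,\varepsilon)$ is the trajectory starting from $\xi$ at $t=0$, and $x_0(t;\xi)=x(t;\xi,T,0)$; $H$ is conserved along $x_0$. **$m$-normality.** For a periodic orbit $\mathcal Z$ of $\dot x=f(x)$ of minimal period $\tau>0$ and $p\in\mathcal Z$, let $\Pi(p)=Y(\tau;p)$ be the monodromy matrix, where $\dot Y=Df(x_0(t;p))Y$, $Y(0)=I$. Let $\mu_{g,m}$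 be the geometric multiplicity of the eigenvalue $+1$ of $\Pi^m(p)$. $\mathcal Z$ is $m$-normal if either (a) $\mu_{g,m}=1$, or (b) $\mu_{g,m}=2$ and $f(p)\notin\mathrm{range}(\Pi^m(p)-I)$. An $m$-normal orbit belongs to a one-parameter family $\mathcal P$ of $m$-normal periodic orbits (a two-dimensional manifold), with family parameter $\lambda\in\mathbb R$. **Parametrisation $L$.** The family parameter is given by a $C^r$ scalar mapping $\lambda=L(\xi,\cdot)$ depending on the initial condition and on a period, invariant under translations of $\xi$ along the orbit. Near $\mathcal Z$ there are smooth maps $\lambda\mapsto\vartheta(\lambda)$ (initial condition on a Poincaré section) and $\lambda\mapsto\mathcal T(\lambda)$ (minimal period) parametrising the family, with $L(x_0(t;\vartheta(\lambda)),m\mathcal T(\lambda))=\lambda$ for all $t$. Any such $L$ is fixed; $M^{m:l}$ does not depend on it. **Smooth persistence.** $\mathcal Z$ smoothly persists for small $\varepsilon>0$ if there are $\varepsilon_0>0$ and $C^{r-1}$ maps $\varepsilon\mapsto\xi(\varepsilon)$, $\varepsilon\mapsto T(\varepsilon)$ on $[0,\varepsilon_0)$ with $\xi(\varepsilon)=x_0(s;p)+O(\varepsilon)$ for some $s\in\mathbb R$ and $T(\varepsilon)=\tau m/l+O(\varepsilon)$, such that for each $\varepsilon$ $$x(lT(\varepsilon);\xi(\varepsilon),T(\varepsilon),\varepsilon)=\xi(\varepsilon),\qquad L(\xi(\varepsilon),lT(\varepsilon))=L(p,m\tau),$$ i.e. the trajectory from $\xi(\varepsilon)$ is an $lT(\varepsilon)$-periodic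 orbit of the system with forcing period $T(\varepsilon)$. **Topologically transverse zero.** A zero at which the function changes sign.
   Formalization: A "topologically transverse zero" may lie in an interval of zeros across which the function changes sign, with each strict sign required only arbitrarily near its ends; a sign change at a single point can fail when zeros are not isolated. For isolated zeros the notions agree. *)

theory Defs
  imports "HOL-Analysis.Analysis" "HOL-Library.Landau_Symbols"
begin

section \<open>Differentiability classes\<close>

text \<open>
  \<open>Ck_along W k f S\<close>: all derivatives of \<open>f\<close> of order at most \<open>k\<close> in directions from the
  subspace \<open>W\<close> exist on \<open>S\<close> and are (jointly) continuous on \<open>S\<close>. Derivatives are taken relative
  to \<open>S\<close>, so that they are one-sided at boundary points (such as \<open>\<epsilon> = 0\<close>). The higher derivatives
  are encoded by iterating directional derivatives, which in finite dimension is the usual notion.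
  All sets \<open>S\<close> below are open sets, or products of these with half-open intervals, on which relative
  derivatives are unique.
\<close>

primrec Ck_along ::
  "'a::euclidean_space set \<Rightarrow> nat \<Rightarrow> ('a \<Rightarrow> 'b::real_normed_vector) \<Rightarrow> 'a set \<Rightarrow> bool" where
  "Ck_along W 0 f S \<longleftrightarrow> continuous_on S f"
| "Ck_along W (Suc k) f S \<longleftrightarrow> continuous_on S f \<and>
     (\<exists>f'. (\<forall>x\<in>S. (f has_derivative f' x) (at x within {y \<in> S. y - x \<in> W})) \<and>
           (\<forall>v\<in>W. Ck_along W k (\<lambda>x. f' x v) S))"

abbreviation Ck_on ::
  "nat \<Rightarrow> ('a::euclidean_space \<Rightarrow> 'b::real_normed_vector) \<Rightarrow> 'a set \<Rightarrow> bool" where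
  "Ck_on \<equiv> Ck_along UNIV"

definition grad :: "('a::real_inner \<Rightarrow> real) \<Rightarrow> 'a \<Rightarrow> 'a" where
  "grad h x = (THE D. GDERIV h x :> D)"


section \<open>Trajectories and periodic orbits\<close>

definition solves ::
  "(real \<Rightarrow> 'a::real_normed_vector \<Rightarrow> 'a) \<Rightarrow> 'a set \<Rightarrow> real set \<Rightarrow> (real \<Rightarrow> 'a) \<Rightarrow> bool" where
  "solves F S I X \<longleftrightarrow>
     (\<forall>t\<in>I. X t \<in> S \<and> (X has_vector_derivative F t (X t)) (at t within I))"

definition traj_exists ::
  "(real \<Rightarrow> 'a::real_normed_vector \<Rightarrow> 'a) \<Rightarrow> 'a set \<Rightarrow> 'a \<Rightarrow> real \<Rightarrow> bool" where
  "traj_exists F S \<xi> t \<longleftrightarrow> (\<exists>X. solves F S (closed_segment 0 t) X \<and> X 0 = \<xi>)"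

text \<open>\<open>traj F S \<xi> t\<close> is meaningful only if \<open>traj_exists F S \<xi> t\<close> holds.\<close>

definition traj ::
  "(real \<Rightarrow> 'a::real_normed_vector \<Rightarrow> 'a) \<Rightarrow> 'a set \<Rightarrow> 'a \<Rightarrow> real \<Rightarrow> 'a" where
  "traj F S \<xi> t = (THE y. \<exists>X. solves F S (closed_segment 0 t) X \<and> X 0 = \<xi> \<and> X t = y)"

abbreviation traj0 :: "('a::real_normed_vector \<Rightarrow> 'a) \<Rightarrow> 'a set \<Rightarrow> 'a \<Rightarrow> real \<Rightarrow> 'a" where
  "traj0 f \<equiv> traj (\<lambda>_. f)"

text \<open>\<open>Z\<close> is a periodic orbit of minimal period \<open>\<tau> > 0\<close>; this excludes equilibria.\<close>

definition periodic_orbit ::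
  "('a::real_normed_vector \<Rightarrow> 'a) \<Rightarrow> 'a set \<Rightarrow> real \<Rightarrow> 'a set \<Rightarrow> bool" where
  "periodic_orbit f S \<tau> Z \<longleftrightarrow>
     (\<exists>X. solves (\<lambda>_. f) S UNIV X \<and> Z = range X \<and>
          0 < \<tau> \<and> (\<forall>t. X (t + \<tau>) = X t) \<and>
          (\<forall>\<sigma>. 0 < \<sigma> \<and> \<sigma> < \<tau> \<longrightarrow> (\<exists>t. X (t + \<sigma>) \<noteq> X t)))"


section \<open>Normality\<close>

definition monodromy ::
  "('a::euclidean_space \<Rightarrow> 'a) \<Rightarrow> 'a set \<Rightarrow> real \<Rightarrow> 'a \<Rightarrow> 'a \<Rightarrow>\<^sub>L 'a" where
  "monodromy f S \<tau> p = (THE P. \<exists>Y. Y 0 = id_blinfun \<and>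
     (\<forall>t\<in>{0..\<tau>}. (Y has_vector_derivative
         (Blinfun (frechet_derivative f (at (traj0 f S p t))) o\<^sub>L Y t)) (at t within {0..\<tau>})) \<and>
     P = Y \<tau>)"

definition geometric_multiplicity :: "('a::euclidean_space \<Rightarrow> 'a) \<Rightarrow> real \<Rightarrow> nat" where
  "geometric_multiplicity A \<mu> = dim {v. A v = \<mu> *\<^sub>R v}"

text \<open>Normality of the periodic orbit through \<open>p\<close> of minimal period \<open>\<tau>\<close>; monodromy matrices at
  different points of the orbit are conjugate, so the choice of \<open>p\<close> does not matter.\<close>

definition m_normal ::
  "('a::euclidean_space \<Rightarrow> 'a) \<Rightarrow> 'a set \<Rightarrow> nat \<Rightarrow> real \<Rightarrow> 'a \<Rightarrow> bool" where
  "m_normal f S m \<tau> p \<longleftrightarrow>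
     (let A = blinfun_apply (monodromy f S \<tau> p) ^^ m in
        geometric_multiplicity A 1 = 1 \<or>
        geometric_multiplicity A 1 = 2 \<and> f p \<notin> range (\<lambda>v. A v - v))"


section \<open>Parametrisation of the family\<close>

definition poincare_section ::
  "('a::euclidean_space \<Rightarrow> 'a) \<Rightarrow> 'a set \<Rightarrow> 'a set \<Rightarrow> bool" where
  "poincare_section f S C \<longleftrightarrow>
     (\<exists>W \<sigma>. open W \<and> W \<subseteq> S \<and> Ck_on 1 (\<sigma> :: 'a \<Rightarrow> real) W \<and> C = {x \<in> W. \<sigma> x = 0} \<and>
        (\<forall>x\<in>C. frechet_derivative \<sigma> (at x) (f x) \<noteq> 0))"

text \<open>
  The local family around the orbit through \<open>p\<close> consists of the orbits through the points
  \<open>\<theta> c\<close>, with minimal period \<open>per c\<close>. The last condition also expresses that \<open>L\<close> is invariant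
  under translations along the orbits of the family. \<open>L\<close> needs to be defined only near the orbit.
\<close>

definition family_parametrisation ::
  "nat \<Rightarrow> ('a::euclidean_space \<Rightarrow> 'a) \<Rightarrow> 'a set \<Rightarrow> nat \<Rightarrow> real \<Rightarrow> 'a \<Rightarrow> ('a \<Rightarrow> real \<Rightarrow> real) \<Rightarrow> bool" where
  "family_parametrisation r f S m \<tau> p L \<longleftrightarrow>
     (\<exists>D. open D \<and> (\<forall>t. (traj0 f S p t, real m * \<tau>) \<in> D) \<and> Ck_on r (\<lambda>(\<xi>, P). L \<xi> P) D) \<and>
     (\<exists>\<delta> \<theta> per C. \<delta> > 0 \<and>
        (let l0 = L p (real m * \<tau>); J = {l0 - \<delta> <..< l0 + \<delta>} in
           Ck_on 1 \<theta> J \<and> Ck_on 1 per J \<and>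
           \<theta> l0 \<in> range (traj0 f S p) \<and> per l0 = \<tau> \<and>
           poincare_section f S C \<and>
           (\<forall>c\<in>J. \<theta> c \<in> C \<and>
              (\<exists>Z. periodic_orbit f S (per c) Z \<and> \<theta> c \<in> Z) \<and>
              m_normal f S m (per c) (\<theta> c) \<and>
              (\<forall>t. L (traj0 f S (\<theta> c) t) (real m * per c) = c))))"


section \<open>Persistence and the Melnikov function\<close>

definition perturbed_field ::
  "('a::real_normed_vector \<Rightarrow> 'a) \<Rightarrow> ('a \<Rightarrow> real \<Rightarrow> real \<Rightarrow> real \<Rightarrow> 'a) \<Rightarrow> real \<Rightarrow> real \<Rightarrow> real \<Rightarrow> 'a \<Rightarrow> 'a"
  where "perturbed_field f g T \<epsilon> t x = f x + \<epsilon> *\<^sub>R g x t T \<epsilon>"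

definition smoothly_persists ::
  "nat \<Rightarrow> ('a::euclidean_space \<Rightarrow> 'a) \<Rightarrow> ('a \<Rightarrow> real \<Rightarrow> real \<Rightarrow> real \<Rightarrow> 'a) \<Rightarrow> 'a set \<Rightarrow>
   ('a \<Rightarrow> real \<Rightarrow> real) \<Rightarrow> nat \<Rightarrow> nat \<Rightarrow> real \<Rightarrow> 'a \<Rightarrow> bool" where
  "smoothly_persists r f g S L l m \<tau> p \<longleftrightarrow>
     (\<exists>\<epsilon>0>0. \<exists>\<xi> T s.
        Ck_on (r - 1) \<xi> {0..<\<epsilon>0} \<and> Ck_on (r - 1) T {0..<\<epsilon>0} \<and>
        (\<lambda>\<epsilon>. norm (\<xi> \<epsilon> - traj0 f S p s)) \<in> O[at_right 0](\<lambda>\<epsilon>. \<epsilon>) \<and>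
        (\<lambda>\<epsilon>. T \<epsilon> - \<tau> * real m / real l) \<in> O[at_right 0](\<lambda>\<epsilon>. \<epsilon>) \<and>
        (\<forall>\<epsilon>\<in>{0..<\<epsilon>0}. 0 < T \<epsilon> \<and>
           traj_exists (perturbed_field f g (T \<epsilon>) \<epsilon>) S (\<xi> \<epsilon>) (real l * T \<epsilon>) \<and>
           traj (perturbed_field f g (T \<epsilon>) \<epsilon>) S (\<xi> \<epsilon>) (real l * T \<epsilon>) = \<xi> \<epsilon> \<and>
           L (\<xi> \<epsilon>) (real l * T \<epsilon>) = L p (real m * \<tau>)))"

definition melnikov ::
  "('a::euclidean_space \<Rightarrow> 'a) \<Rightarrow> ('a \<Rightarrow> real \<Rightarrow> real \<Rightarrow> real \<Rightarrow> 'a) \<Rightarrow> ('a \<Rightarrow> real) \<Rightarrow> 'a set \<Rightarrow>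
   nat \<Rightarrow> nat \<Rightarrow> real \<Rightarrow> 'a \<Rightarrow> real \<Rightarrow> real" where
  "melnikov f g H S l m \<tau> p s =
     integral {0..real m * \<tau>}
       (\<lambda>t. grad H (traj0 f S p (t + s)) \<bullet> g (traj0 f S p (t + s)) t (\<tau> * real m / real l) 0)"

definition simple_zero :: "(real \<Rightarrow> real) \<Rightarrow> real \<Rightarrow> bool" where
  "simple_zero h s \<longleftrightarrow> h s = 0 \<and> (\<exists>d. (h has_real_derivative d) (at s) \<and> d \<noteq> 0)"

text \<open>
  A zero at which \<open>h\<close> changes sign. For an isolated zero of a continuous \<open>h\<close> this says that \<open>h\<close> has
  opposite strict signs on the two sides. The interval \<open>[a, b]\<close> accounts for sign changes across a
  segment of zeros, and the frequently-quantifiers for zeros that accumulate: a function that is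
  only finitely differentiable may pass from positive to negative values through either of these,
  without having a zero with strict signs on both sides.
\<close>

definition topologically_transverse_zero :: "(real \<Rightarrow> real) \<Rightarrow> real \<Rightarrow> bool" where
  "topologically_transverse_zero h s \<longleftrightarrow>
     (\<exists>a b. a \<le> s \<and> s \<le> b \<and> (\<forall>u\<in>{a..b}. h u = 0) \<and>
        ((\<exists>\<^sub>F u in at_left a. h u < 0) \<and> (\<exists>\<^sub>F u in at_right b. 0 < h u) \<or>
         (\<exists>\<^sub>F u in at_left a. 0 < h u) \<and> (\<exists>\<^sub>F u in at_right b. h u < 0)))"


section \<open>Mechanical systems\<close>

text \<open>States are pairs \<open>(q, v)\<close> of generalised coordinates and velocities.\<close>

definition kinetic_energy :: "(real^'n \<Rightarrow> real^'n^'n) \<Rightarrow> real^'n \<Rightarrow> real^'n \<Rightarrow> real" where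
  "kinetic_energy Mass q v = (1 / 2) * (v \<bullet> (Mass q *v v))"

definition energy ::
  "(real^'n \<Rightarrow> real^'n^'n) \<Rightarrow> (real^'n \<Rightarrow> real) \<Rightarrow> (real^'n) \<times> (real^'n) \<Rightarrow> real" where
  "energy Mass V x = kinetic_energy Mass (fst x) (snd x) + V (fst x)"

text \<open>The time derivative of \<open>Mass q\<close> along a motion is the derivative of \<open>Mass\<close> at \<open>q\<close> in the
  direction \<open>v\<close>.\<close>

definition inertial_force :: "(real^'n \<Rightarrow> real^'n^'n) \<Rightarrow> real^'n \<Rightarrow> real^'n \<Rightarrow> real^'n" where
  "inertial_force Mass q v =
     frechet_derivative Mass (at q) v *v v - grad (\<lambda>q'. kinetic_energy Mass q' v) q"

definition mech_f ::
  "(real^'n \<Rightarrow> real^'n^'n) \<Rightarrow> (real^'n \<Rightarrow> real) \<Rightarrow> (real^'n) \<times> (real^'n) \<Rightarrow> (real^'n) \<times> (real^'n)" where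
  "mech_f Mass V = (\<lambda>(q, v). (v, - (matrix_inv (Mass q) *v (grad V q + inertial_force Mass q v))))"

definition mech_g ::
  "(real^'n \<Rightarrow> real^'n^'n) \<Rightarrow> (real^'n \<Rightarrow> real^'n \<Rightarrow> real \<Rightarrow> real \<Rightarrow> real \<Rightarrow> real^'n) \<Rightarrow>
   (real^'n) \<times> (real^'n) \<Rightarrow> real \<Rightarrow> real \<Rightarrow> real \<Rightarrow> (real^'n) \<times> (real^'n)" where
  "mech_g Mass Q = (\<lambda>(q, v) t T \<epsilon>. (0, matrix_inv (Mass q) *v Q q v t T \<epsilon>))"

text \<open>
  The class of the forcing term is \<open>r - 1\<close> in \<open>t\<close> and \<open>r\<close> in the other arguments: it is jointly of
  class \<open>r - 1\<close>, and its derivatives up to order \<open>r\<close> in directions without \<open>t\<close>-component exist and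
  are jointly continuous. Periods \<open>T\<close> are positive, and \<open>\<epsilon> \<ge> 0\<close>.
\<close>

definition mechanical_system ::
  "nat \<Rightarrow> (real^'n) set \<Rightarrow> (real^'n \<Rightarrow> real^'n^'n) \<Rightarrow> (real^'n \<Rightarrow> real) \<Rightarrow>
   (real^'n \<Rightarrow> real^'n \<Rightarrow> real \<Rightarrow> real \<Rightarrow> real \<Rightarrow> real^'n) \<Rightarrow> bool" where
  "mechanical_system r U Mass V Q \<longleftrightarrow>
     open U \<and>
     (\<forall>q\<in>U. transpose (Mass q) = Mass q \<and> (\<forall>v. v \<noteq> 0 \<longrightarrow> 0 < v \<bullet> (Mass q *v v))) \<and>
     Mass differentiable_on U \<and> V differentiable_on U \<and>
     Ck_on r (mech_f Mass V) (U \<times> UNIV) \<and>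
     (let g = (\<lambda>(x, t, T, \<epsilon>). mech_g Mass Q x t T \<epsilon>);
          dom = (U \<times> UNIV) \<times> UNIV \<times> {0<..} \<times> {0..}
      in Ck_on (r - 1) g dom \<and> Ck_along {(dx, dt, dT, d\<epsilon>). dt = 0} r g dom) \<and>
     (\<forall>q\<in>U. \<forall>v t T \<epsilon>. 0 < T \<longrightarrow> 0 \<le> \<epsilon> \<longrightarrow> Q q v (t + T) T \<epsilon> = Q q v t T \<epsilon>)"

end

theory Submission
  imports Defs
begin

text \<open>
A periodic orbit of the forced system is a zero of the displacement \<open>\<Delta> = x(1) - \<xi>\<close>, where \<open>x\<close> is the
trajectory from \<open>\<xi>\<close> with time rescaled by the total period \<open>P = l T\<close>. For \<open>\<epsilon> = 0\<close> the whole orbit consists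
of zeros, and the derivative of \<open>\<Delta>\<close> in \<open>(\<xi>, P)\<close> is not onto: conservation of \<open>H\<close> keeps its range orthogonal
to \<open>n = grad H\<close>. The missing component is recovered from the energy balance
\<open>H(x(1)) - H(\<xi>) = \<epsilon> P w(\<xi>, P, \<epsilon>)\<close>, in which \<open>w\<close> is the work of the forcing (\<open>energy_balance\<close>). Since \<open>w\<close> is an
explicit integral along the trajectory, it is as smooth as the flow; dividing \<open>\<Delta>\<close> itself by \<open>\<epsilon>\<close> would
cost a derivative. On the unperturbed orbit \<open>w = M(s) / P\<close> (\<open>work_orbit\<close>).

Persistence (\<open>persistent\<close>): replace the \<open>n\<close>-component of \<open>\<Delta>\<close> by \<open>w\<close> and adjoin the equation \<open>L = const\<close>. The
resulting system has as many equations as unknowns \<open>(\<xi>, P)\<close>. By normality the kernel of the derivative of \<open>\<Delta>\<close> at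
\<open>\<epsilon> = 0\<close> is spanned by the flow direction and the tangent of the family of periodic orbits
(\<open>flow_derivative_normal\<close>, \<open>transversal_kernel\<close>). The derivative of \<open>L\<close> vanishes on the former but not on the
latter, and the derivative of \<open>w\<close> on the flow direction is \<open>M'(s) / P\<close>. Hence a simple zero of \<open>M\<close> makes the
derivative invertible, and \<open>implicit_curve\<close> gives the curve of solutions for \<open>\<epsilon> \<ge> 0\<close>. A solution is a periodic
orbit: its displacement is parallel to \<open>n\<close>, the energy has not changed, and the energy is strictly monotone in
the direction \<open>n\<close>.

Conversely (\<open>not_persistent\<close>), \<open>w = 0\<close> on every periodic orbit with \<open>\<epsilon> > 0\<close>, so a persisting branch converges to a
zero of \<open>M\<close>. The second zero (\<open>transverse_zero_after_simple_zero\<close>) exists because \<open>M\<close> has period \<open>\<tau>\<close>: it crosses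
zero in the same direction at \<open>s0\<close> and at \<open>s0 + \<tau>\<close>, so it must cross in the opposite direction in between.

Two facts carry the smoothness. Solutions of differential equations depend smoothly on parameters
(\<open>Ck_solution_ode\<close>): the derivative in a parameter solves a linear equation on the same state space, which
allows an induction on the order. And the mass matrix, assumed to be differentiable only, is smooth because
its derivative can be expressed by itself and the vector field (\<open>DM_formula\<close>).
\<close>

section \<open>Calculus of functions with continuous directional derivatives\<close>

lemma Ck_along_continuous: "Ck_along W k f S \<Longrightarrow> continuous_on S f"
  by (cases k) auto

lemma Ck_along_Suc_D: "Ck_along W (Suc k) f S \<Longrightarrow> Ck_along W k f S"
proof (induction k arbitrary: f)
  case (Suc k)
  from Suc.prems obtain f' where c: "continuous_on S f"
    and d: "\<And>x. x \<in> S \<Longrightarrow> (f has_derivative f' x) (at x within {y \<in> S. y - x \<in> W})"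
    and k: "\<And>v. v \<in> W \<Longrightarrow> Ck_along W (Suc k) (\<lambda>x. f' x v) S"
    by auto
  show ?case
    using c d Suc.IH[OF k] by auto
qed auto

lemma Ck_along_le: "Ck_along W k f S \<Longrightarrow> j \<le> k \<Longrightarrow> Ck_along W j f S"
proof (induction k)
  case (Suc k)
  then show ?case
    by (metis Ck_along_Suc_D le_Suc_eq)
qed auto

lemma Ck_along_SucI:
  assumes "\<And>x. x \<in> S \<Longrightarrow> (f has_derivative f' x) (at x within {y \<in> S. y - x \<in> W})"
    and "\<And>v. v \<in> W \<Longrightarrow> Ck_along W k (\<lambda>x. f' x v) S"
    and "continuous_on S f"
  shows "Ck_along W (Suc k) f S"
  using assms by auto

lemma Ck_along_SucE:
  assumes "Ck_along W (Suc k) f S"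
  obtains f' where
    "\<And>x. x \<in> S \<Longrightarrow> (f has_derivative f' x) (at x within {y \<in> S. y - x \<in> W})"
    "\<And>v. v \<in> W \<Longrightarrow> Ck_along W k (\<lambda>x. f' x v) S"
    "continuous_on S f"
  using assms by auto

lemma has_derivative_transform_eq:
  assumes "(f has_derivative D) (at x within T)" "f x = g x" "\<And>y. y \<in> T \<Longrightarrow> f y = g y"
  shows "(g has_derivative D) (at x within T)"
proof -
  have eq: "at x within (insert x T) = at x within T"
    by (simp add: at_within_def)
  show ?thesis
    using has_derivative_transform[of x "insert x T" g f D] assms
    by (metis eq insert_iff)
qed

lemma Ck_along_cong:
  assumes "\<And>x. x \<in> S \<Longrightarrow> f x = g x"
  shows "Ck_along W k f S \<longleftrightarrow> Ck_along W k g S"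
proof (cases k)
  case 0
  then show ?thesis
    using assms by (auto cong: continuous_on_cong)
next
  case (Suc j)
  have d: "(f has_derivative D) (at x within {y \<in> S. y - x \<in> W}) \<longleftrightarrow>
      (g has_derivative D) (at x within {y \<in> S. y - x \<in> W})" if "x \<in> S" for D x
    using assms that by (intro iffI; elim has_derivative_transform_eq) auto
  show ?thesis
    unfolding Suc Ck_along.simps using assms d by (auto cong: continuous_on_cong)
qed

lemma Ck_along_subset: "Ck_along W k f S \<Longrightarrow> T \<subseteq> S \<Longrightarrow> Ck_along W k f T"
proof (induction k arbitrary: f)
  case 0
  then show ?case by (auto intro: continuous_on_subset)
next
  case (Suc k)
  from Suc.prems(1) obtain f' where f':
    "\<And>x. x \<in> S \<Longrightarrow> (f has_derivative f' x) (at x within {y \<in> S. y - x \<in> W})"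
    "\<And>v. v \<in> W \<Longrightarrow> Ck_along W k (\<lambda>x. f' x v) S" "continuous_on S f"
    by (rule Ck_along_SucE) blast
  show ?case
  proof (rule Ck_along_SucI)
    show "(f has_derivative f' x) (at x within {y \<in> T. y - x \<in> W})" if "x \<in> T" for x
      using f'(1)[of x] that Suc.prems(2) by (auto intro: has_derivative_subset)
  qed (use f' Suc in \<open>auto intro: continuous_on_subset\<close>)
qed

lemma Ck_along_mono: "Ck_along W k f S \<Longrightarrow> W' \<subseteq> W \<Longrightarrow> Ck_along W' k f S"
proof (induction k arbitrary: f)
  case (Suc k)
  from Suc.prems(1) obtain f' where f':
    "\<And>x. x \<in> S \<Longrightarrow> (f has_derivative f' x) (at x within {y \<in> S. y - x \<in> W})"
    "\<And>v. v \<in> W \<Longrightarrow> Ck_along W k (\<lambda>x. f' x v) S" "continuous_on S f"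
    by (rule Ck_along_SucE) blast
  show ?case
  proof (rule Ck_along_SucI)
    show "(f has_derivative f' x) (at x within {y \<in> S. y - x \<in> W'})" if "x \<in> S" for x
      by (rule has_derivative_subset[OF f'(1)]) (use that Suc.prems(2) in auto)
  qed (use f' Suc in auto)
qed auto

lemma Ck_along_const [simp]: "Ck_along W k (\<lambda>_. c) S"
proof (induction k arbitrary: c)
  case (Suc k)
  show ?case
    by (rule Ck_along_SucI[where f'="\<lambda>_ _. 0"]) (use Suc in auto)
qed auto

lemma Ck_along_linear: "bounded_linear f \<Longrightarrow> Ck_along W k f S"
proof (cases k)
  case (Suc j)
  assume "bounded_linear f"
  then show ?thesis unfolding Suc
    by (intro Ck_along_SucI[where f'="\<lambda>_. f"])
      (auto intro: bounded_linear_imp_has_derivative linear_continuous_on)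
qed (auto intro: linear_continuous_on)

lemma Ck_along_add:
  "Ck_along W k f S \<Longrightarrow> Ck_along W k g S \<Longrightarrow> Ck_along W k (\<lambda>x. f x + g x) S"
proof (induction k arbitrary: f g)
  case (Suc k)
  obtain f' where f':
    "\<And>x. x \<in> S \<Longrightarrow> (f has_derivative f' x) (at x within {y \<in> S. y - x \<in> W})"
    "\<And>v. v \<in> W \<Longrightarrow> Ck_along W k (\<lambda>x. f' x v) S" "continuous_on S f"
    using Suc.prems(1) by (rule Ck_along_SucE) blast
  obtain g' where g':
    "\<And>x. x \<in> S \<Longrightarrow> (g has_derivative g' x) (at x within {y \<in> S. y - x \<in> W})"
    "\<And>v. v \<in> W \<Longrightarrow> Ck_along W k (\<lambda>x. g' x v) S" "continuous_on S g"
    using Suc.prems(2) by (rule Ck_along_SucE) blast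
  show ?case
    by (rule Ck_along_SucI[where f'="\<lambda>x v. f' x v + g' x v"])
      (use f' g' Suc.IH in \<open>auto intro!: has_derivative_add continuous_on_add\<close>)
qed (auto intro: continuous_on_add)

lemma Ck_along_bilinear:
  assumes "bounded_bilinear B"
  shows "Ck_along W k f S \<Longrightarrow> Ck_along W k g S \<Longrightarrow> Ck_along W k (\<lambda>x. B (f x) (g x)) S"
proof (induction k arbitrary: f g)
  case 0
  then show ?case
    by (auto intro: bounded_bilinear.continuous_on[OF assms])
next
  case (Suc k)
  obtain f' where f':
    "\<And>x. x \<in> S \<Longrightarrow> (f has_derivative f' x) (at x within {y \<in> S. y - x \<in> W})"
    "\<And>v. v \<in> W \<Longrightarrow> Ck_along W k (\<lambda>x. f' x v) S" "continuous_on S f"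
    using Suc.prems(1) by (rule Ck_along_SucE) blast
  obtain g' where g':
    "\<And>x. x \<in> S \<Longrightarrow> (g has_derivative g' x) (at x within {y \<in> S. y - x \<in> W})"
    "\<And>v. v \<in> W \<Longrightarrow> Ck_along W k (\<lambda>x. g' x v) S" "continuous_on S g"
    using Suc.prems(2) by (rule Ck_along_SucE) blast
  show ?case
    by (rule Ck_along_SucI[where f'="\<lambda>x v. B (f x) (g' x v) + B (f' x v) (g x)"])
      (use f' g' Suc.IH Ck_along_Suc_D[OF Suc.prems(1)] Ck_along_Suc_D[OF Suc.prems(2)] in
       \<open>auto intro!: bounded_bilinear.FDERIV[OF assms] Ck_along_add
          bounded_bilinear.continuous_on[OF assms]\<close>)
qed

lemma Ck_along_bounded_linear:
  assumes "bounded_linear T" "Ck_along W k f S"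
  shows "Ck_along W k (\<lambda>x. T (f x)) S"
  using assms(2)
proof (induction k arbitrary: f)
  case 0
  then show ?case
    using assms(1) by (auto intro: bounded_linear.continuous_on)
next
  case (Suc k)
  obtain f' where f':
    "\<And>x. x \<in> S \<Longrightarrow> (f has_derivative f' x) (at x within {y \<in> S. y - x \<in> W})"
    "\<And>v. v \<in> W \<Longrightarrow> Ck_along W k (\<lambda>x. f' x v) S" "continuous_on S f"
    using Suc.prems(1) by (rule Ck_along_SucE) blast
  show ?case
    by (rule Ck_along_SucI[where f'="\<lambda>x v. T (f' x v)"])
      (use f' Suc.IH assms(1) in
        \<open>auto intro: bounded_linear.has_derivative bounded_linear.continuous_on\<close>)
qed

lemmas Ck_along_scaleR = Ck_along_bilinear[OF bounded_bilinear_scaleR]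
lemmas Ck_along_mult = Ck_along_bilinear[OF bounded_bilinear_mult]
lemmas Ck_along_inner = Ck_along_bilinear[OF bounded_bilinear_inner]
lemmas Ck_along_fst = Ck_along_bounded_linear[OF bounded_linear_fst]
lemmas Ck_along_snd = Ck_along_bounded_linear[OF bounded_linear_snd]
lemmas Ck_along_minus = Ck_along_bounded_linear[OF bounded_linear_minus[OF bounded_linear_ident]]

lemma Ck_along_diff:
  "Ck_along W k f S \<Longrightarrow> Ck_along W k g S \<Longrightarrow> Ck_along W k (\<lambda>x. f x - g x) S"
  using Ck_along_add[OF _ Ck_along_minus] by force

lemma Ck_along_sum:
  "(\<And>i. i \<in> I \<Longrightarrow> Ck_along W k (f i) S) \<Longrightarrow> Ck_along W k (\<lambda>x. \<Sum>i\<in>I. f i x) S"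
  by (induction I rule: infinite_finite_induct) (auto intro: Ck_along_add)

lemma Ck_along_Pair:
  assumes "Ck_along W k f S" "Ck_along W k g S"
  shows "Ck_along W k (\<lambda>x. (f x, g x)) S"
proof -
  have "Ck_along W k (\<lambda>x. (f x, 0) + (0, g x)) S"
    using assms by (intro Ck_along_add
      Ck_along_bounded_linear[where T="\<lambda>x. (x, 0)"] Ck_along_bounded_linear[where T="\<lambda>x. (0, x)"])
      (auto intro: bounded_linear_Pair bounded_linear_ident bounded_linear_zero)
  then show ?thesis by simp
qed

lemma Ck_along_id: "Ck_along W k (\<lambda>x. x) S"
  by (rule Ck_along_linear) (rule bounded_linear_ident)

text \<open>The chain rule is expanded in the basis vectors of \<open>W'\<close>, because smoothness of the derivative of \<open>f\<close> is
  known for fixed directions only, whereas \<open>h' x v\<close> varies with \<open>x\<close>.\<close>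

lemma Ck_along_compose:
  fixes h :: "'a::euclidean_space \<Rightarrow> 'b::euclidean_space"
    and f :: "'b \<Rightarrow> 'c::real_normed_vector"
  assumes W': "subspace W'" "\<And>w. w \<in> W' \<Longrightarrow> w = (\<Sum>b\<in>Basis \<inter> W'. (w \<bullet> b) *\<^sub>R b)"
    and sub: "h ` S \<subseteq> R" and slice: "\<And>x y. x \<in> S \<Longrightarrow> y \<in> S \<Longrightarrow> y - x \<in> W \<Longrightarrow> h y - h x \<in> W'"
  shows "Ck_along W' k f R \<Longrightarrow> Ck_along W k h S \<Longrightarrow> Ck_along W k (\<lambda>x. f (h x)) S"
proof (induction k arbitrary: f)
  case 0
  then show ?case
    using sub by (auto intro: continuous_on_compose2)
next
  case (Suc k)
  obtain f' where f':
    "\<And>x. x \<in> R \<Longrightarrow> (f has_derivative f' x) (at x within {y \<in> R. y - x \<in> W'})"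
    "\<And>v. v \<in> W' \<Longrightarrow> Ck_along W' k (\<lambda>x. f' x v) R" "continuous_on R f"
    using Suc.prems(1) by (rule Ck_along_SucE) blast
  obtain h' where h':
    "\<And>x. x \<in> S \<Longrightarrow> (h has_derivative h' x) (at x within {y \<in> S. y - x \<in> W})"
    "\<And>v. v \<in> W \<Longrightarrow> Ck_along W k (\<lambda>x. h' x v) S" "continuous_on S h"
    using Suc.prems(2) by (rule Ck_along_SucE) blast
  \<comment> \<open>The derivative of \<open>h\<close> need not map into \<open>W'\<close>, but its coordinate projection onto \<open>W'\<close> is
    a derivative of \<open>h\<close> as well.\<close>
  define pr where "pr w = (\<Sum>b\<in>Basis \<inter> W'. (w \<bullet> b) *\<^sub>R b)" for w :: 'b
  have pr_lin: "bounded_linear pr"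
    unfolding pr_def by (intro bounded_linear_sum bounded_linear_scaleR_left[THEN bounded_linear_compose]
        bounded_linear_inner_left)
  have pr_id: "pr w = w" if "w \<in> W'" for w
    using W'(2)[OF that] by (simp add: pr_def)
  have prh: "(h has_derivative (\<lambda>v. pr (h' x v))) (at x within {y \<in> S. y - x \<in> W})"
    if x: "x \<in> S" for x
  proof -
    have "((\<lambda>y. pr (h y) + (h x - pr (h x))) has_derivative (\<lambda>v. pr (h' x v)))
        (at x within {y \<in> S. y - x \<in> W})"
      by (rule has_derivative_add_const) (rule bounded_linear.has_derivative[OF pr_lin h'(1)[OF x]])
    moreover have "pr (h y) + (h x - pr (h x)) = h y" if "y \<in> S" "y - x \<in> W" for y
    proof -
      have "pr (h y - h x) = h y - h x"
        using slice[OF x that] pr_id by blast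
      then show ?thesis
        by (simp add: linear_diff[OF bounded_linear.linear[OF pr_lin]] algebra_simps)
    qed
    ultimately show ?thesis
      by (elim has_derivative_transform_eq) auto
  qed
  have hR: "h x \<in> R" if "x \<in> S" for x using sub that by auto
  have lin: "linear (f' z)" if "z \<in> R" for z
    using f'(1)[OF that] has_derivative_linear by blast
  show ?case
  proof (rule Ck_along_SucI[where f'="\<lambda>x v. \<Sum>b\<in>Basis \<inter> W'. (h' x v \<bullet> b) *\<^sub>R f' (h x) b"])
    fix x assume x: "x \<in> S"
    have "((\<lambda>x. f (h x)) has_derivative (\<lambda>v. f' (h x) (pr (h' x v))))
        (at x within {y \<in> S. y - x \<in> W})"
      by (rule has_derivative_in_compose[OF prh[OF x]])
        (rule has_derivative_subset[OF f'(1)[OF hR[OF x]]], use slice x hR in auto)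
    moreover have "f' (h x) (pr (h' x v)) = (\<Sum>b\<in>Basis \<inter> W'. (h' x v \<bullet> b) *\<^sub>R f' (h x) b)" for v
      by (simp add: pr_def linear_sum[OF lin[OF hR[OF x]]] linear_scale[OF lin[OF hR[OF x]]])
    ultimately show "((\<lambda>x. f (h x)) has_derivative
        (\<lambda>v. \<Sum>b\<in>Basis \<inter> W'. (h' x v \<bullet> b) *\<^sub>R f' (h x) b)) (at x within {y \<in> S. y - x \<in> W})"
      by simp
  next
    fix v assume v: "v \<in> W"
    show "Ck_along W k (\<lambda>x. \<Sum>b\<in>Basis \<inter> W'. (h' x v \<bullet> b) *\<^sub>R f' (h x) b) S"
      by (intro Ck_along_sum Ck_along_scaleR Ck_along_inner Ck_along_const h'(2) v
          Suc.IH f'(2) Ck_along_Suc_D[OF Suc.prems(2)]) auto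
  qed (use f'(3) h'(3) sub in \<open>auto intro: continuous_on_compose2\<close>)
qed

lemma Ck_on_compose:
  fixes h :: "'a::euclidean_space \<Rightarrow> 'b::euclidean_space"
    and f :: "'b \<Rightarrow> 'c::real_normed_vector"
  assumes "Ck_on k f R" "Ck_along W k h S" "h ` S \<subseteq> R"
  shows "Ck_along W k (\<lambda>x. f (h x)) S"
  by (rule Ck_along_compose[where W'=UNIV and R=R]) (use assms in \<open>auto simp: euclidean_representation\<close>)

text \<open>Directions without time component. \<open>Ck_along spatial\<close> describes functions of \<open>(t, w)\<close> that are smooth in \<open>w\<close>
  with all derivatives jointly continuous, which is the regularity of solutions of differential equations
  in their parameters when the right-hand side is merely continuous in time.\<close>

definition spatial :: "(real \<times> 'a::euclidean_space) set" where
  "spatial = {0} \<times> UNIV"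

lemma spatial_slice: "t \<in> I \<Longrightarrow> {y \<in> I \<times> E. y - (t, w) \<in> spatial} = {t} \<times> E"
  by (auto simp: spatial_def)

lemma spatial_derivativeD:
  assumes "(F has_derivative F') (at (t, w) within {y \<in> I \<times> E. y - (t, w) \<in> spatial})" "t \<in> I"
  shows "((\<lambda>w. F (t, w)) has_derivative (\<lambda>v. F' (0, v))) (at w within E)"
proof (rule has_derivative_in_compose[where f="\<lambda>w. (t, w)" and g=F, simplified])
  show "((\<lambda>w. (t, w)) has_derivative (\<lambda>v. (0, v))) (at w within E)"
    by (auto intro!: derivative_eq_intros)
  show "(F has_derivative F') (at (t, w) within Pair t ` E)"
    using assms by (auto simp: spatial_slice intro: has_derivative_subset)
qed

lemma spatial_derivativeI:
  assumes "((\<lambda>w. F (t, w)) has_derivative G) (at w within E)" "t \<in> I"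
  shows "(F has_derivative (\<lambda>v. G (snd v))) (at (t, w) within {y \<in> I \<times> E. y - (t, w) \<in> spatial})"
proof -
  have s: "snd ` ({t} \<times> E) = E" by force
  have "((\<lambda>y. F (t, snd y)) has_derivative (\<lambda>v. G (snd v))) (at (t, w) within {t} \<times> E)"
    by (rule has_derivative_in_compose[where f=snd]) 
       (auto simp: s assms intro!: derivative_eq_intros)
  then show ?thesis
    unfolding spatial_slice[OF assms(2)] by (rule has_derivative_transform_eq) auto
qed

text \<open>Within a product set the points reachable in spatial directions form a slice, so that the derivative is a
  partial derivative.\<close>

lemma Ck_spatial_SucE:
  assumes "Ck_along spatial (Suc k) F (I \<times> E)"
  obtains F' where
    "\<And>t w. t \<in> I \<Longrightarrow> w \<in> E \<Longrightarrow> ((\<lambda>w. F (t, w)) has_derivative F' t w) (at w within E)"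
    "\<And>v. Ck_along spatial k (\<lambda>z. F' (fst z) (snd z) v) (I \<times> E)"
proof -
  obtain F' where F':
    "\<And>x. x \<in> I \<times> E \<Longrightarrow> (F has_derivative F' x) (at x within {y \<in> I \<times> E. y - x \<in> spatial})"
    "\<And>v. v \<in> spatial \<Longrightarrow> Ck_along spatial k (\<lambda>x. F' x v) (I \<times> E)"
    using assms by (rule Ck_along_SucE) blast
  show ?thesis
  proof (rule that[of "\<lambda>t w v. F' (t, w) (0, v)"])
    show "((\<lambda>w. F (t, w)) has_derivative (\<lambda>v. F' (t, w) (0, v))) (at w within E)"
      if "t \<in> I" "w \<in> E" for t w
      by (rule spatial_derivativeD[OF F'(1)]) (use that in auto)
  qed (use F'(2) in \<open>auto simp: spatial_def\<close>)
qed

lemma Ck_spatial_SucI: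
  assumes "\<And>t w. t \<in> I \<Longrightarrow> w \<in> E \<Longrightarrow> ((\<lambda>w. F (t, w)) has_derivative F' t w) (at w within E)"
    and "\<And>v. Ck_along spatial k (\<lambda>z. F' (fst z) (snd z) v) (I \<times> E)"
    and "continuous_on (I \<times> E) F"
  shows "Ck_along spatial (Suc k) F (I \<times> E)"
proof (rule Ck_along_SucI[where f'="\<lambda>z v. F' (fst z) (snd z) (snd v)"])
  fix x assume "x \<in> I \<times> E"
  then show "(F has_derivative (\<lambda>v. F' (fst x) (snd x) (snd v)))
      (at x within {y \<in> I \<times> E. y - x \<in> spatial})"
    using spatial_derivativeI[OF assms(1)] by force
qed (use assms in auto)

text \<open>In finite dimension, continuity of all directional derivatives is continuity in the operator norm.\<close>

lemma blinfun_derivative: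
  fixes F :: "'t::t2_space \<times> 'a::euclidean_space \<Rightarrow> 'b::real_normed_vector"
  assumes F': "\<And>t w. t \<in> I \<Longrightarrow> w \<in> E \<Longrightarrow> ((\<lambda>w. F (t, w)) has_derivative F' t w) (at w within E)"
    and cont: "\<And>v. continuous_on (I \<times> E) (\<lambda>z. F' (fst z) (snd z) v)"
  obtains DF where "\<And>t w. t \<in> I \<Longrightarrow> w \<in> E \<Longrightarrow> blinfun_apply (DF (t, w)) = F' t w"
    "continuous_on (I \<times> E) DF"
proof -
  define DF where "DF z = Blinfun (F' (fst z) (snd z))" for z
  have DF: "blinfun_apply (DF (t, w)) = F' t w" if "t \<in> I" "w \<in> E" for t w
    using has_derivative_bounded_linear[OF F'[OF that]] by (simp add: DF_def bounded_linear_Blinfun_apply)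
  have "continuous_on (I \<times> E) DF"
  proof (rule continuous_on_blinfun_componentwise)
    fix v show "continuous_on (I \<times> E) (\<lambda>z. blinfun_apply (DF z) v)"
      by (rule continuous_on_eq[OF cont[of v]]) (auto simp: DF)
  qed
  with DF show ?thesis by (rule that)
qed

lemma spatial_representation:
  fixes w :: "real \<times> 'a::euclidean_space"
  assumes "w \<in> spatial"
  shows "w = (\<Sum>b\<in>Basis \<inter> spatial. (w \<bullet> b) *\<^sub>R b)"
proof -
  have B: "Basis \<inter> spatial = (\<lambda>u::'a. (0::real, u)) ` Basis"
    by (auto simp: Basis_prod_def spatial_def)
  have "(\<Sum>b\<in>Basis \<inter> spatial. (w \<bullet> b) *\<^sub>R b) = (\<Sum>u\<in>Basis. (0, (snd w \<bullet> u) *\<^sub>R u))"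
    unfolding B by (subst sum.reindex) (auto intro: inj_onI simp: inner_prod_def)
  also have "\<dots> = (0, snd w)"
    by (simp add: prod_eq_iff fst_sum snd_sum euclidean_representation)
  finally show ?thesis
    using assms by (auto simp: spatial_def)
qed

lemma subspace_spatial: "subspace spatial"
  by (auto simp: subspace_def spatial_def zero_prod_def)

lemma Ck_spatial_compose:
  fixes h :: "real \<times> 'a::euclidean_space \<Rightarrow> 'b::euclidean_space"
  assumes "Ck_along spatial k G (I \<times> R)" "Ck_along spatial k h (I \<times> E)" "h ` (I \<times> E) \<subseteq> R"
  shows "Ck_along spatial k (\<lambda>z. G (fst z, h z)) (I \<times> E)"
proof (rule Ck_along_compose[where W'=spatial and R="I \<times> R"])
  show "Ck_along spatial k (\<lambda>z. (fst z, h z)) (I \<times> E)"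
    by (intro Ck_along_Pair Ck_along_fst Ck_along_id assms)
qed (use assms spatial_representation subspace_spatial in \<open>auto simp: spatial_def\<close>)

text \<open>Differentiation under the integral sign produces an integral of the same kind, so it can be iterated.\<close>

lemma Ck_on_integral:
  fixes h :: "real \<times> 'a::euclidean_space \<Rightarrow> 'b::euclidean_space"
  assumes "Ck_along spatial k h ({0..1} \<times> E)" "convex E"
  shows "Ck_on k (\<lambda>w. integral {0..1} (\<lambda>t. h (t, w))) E"
  using assms(1)
proof (induction k arbitrary: h)
  case 0
  have "continuous_on (E \<times> cbox 0 (1::real)) (\<lambda>(w, t). h (t, w))"
    unfolding split_beta by (rule continuous_on_compose2[OF Ck_along_continuous[OF 0]])
      (auto intro!: continuous_intros)
  from integral_continuous_on_param[OF this] show ?case by simp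
next
  case (Suc k)
  obtain h' where h':
    "\<And>t w. t \<in> {0..1} \<Longrightarrow> w \<in> E \<Longrightarrow> ((\<lambda>w. h (t, w)) has_derivative h' t w) (at w within E)"
    "\<And>v. Ck_along spatial k (\<lambda>z. h' (fst z) (snd z) v) ({0..1} \<times> E)"
    using Suc.prems(1) by (rule Ck_spatial_SucE) blast
  obtain Dh where Dh: "\<And>t w. t \<in> {0..1} \<Longrightarrow> w \<in> E \<Longrightarrow> blinfun_apply (Dh (t, w)) = h' t w"
    and cDh: "continuous_on ({0..1} \<times> E) Dh"
    using blinfun_derivative[OF h'(1) Ck_along_continuous[OF h'(2)]] by blast
  have ch: "continuous_on ({0..1} \<times> E) h"
    using Suc.prems by (rule Ck_along_continuous)
  have cont: "continuous_on (E \<times> cbox 0 (1::real)) (\<lambda>(w, t). Dh (t, w))"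
    unfolding split_beta by (rule continuous_on_compose2[OF cDh]) (auto intro!: continuous_intros)
  have cw: "continuous_on {0..1} (\<lambda>t. h (t, w))" if "w \<in> E" for w
    using that by (intro continuous_on_compose2[OF ch]) (auto intro!: continuous_intros)
  have cb: "continuous_on {0..1} (\<lambda>t. Dh (t, w))" if "w \<in> E" for w
    using that by (intro continuous_on_compose2[OF cDh]) (auto intro!: continuous_intros)
  have der: "((\<lambda>w. integral {0..1} (\<lambda>t. h (t, w))) has_derivative
      (\<lambda>v. integral {0..1} (\<lambda>t. h' t w v))) (at w within E)" if w: "w \<in> E" for w
  proof -
    have "((\<lambda>w. integral (cbox 0 1) (\<lambda>t. h (t, w))) has_derivative
        blinfun_apply (integral (cbox 0 1) (\<lambda>t. Dh (t, w)))) (at w within E)"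
      by (rule leibniz_rule[OF _ _ cont w assms(2)])
        (simp_all add: Dh h'(1) integrable_continuous_interval cw)
    moreover have "blinfun_apply (integral (cbox 0 1) (\<lambda>t. Dh (t, w))) v
        = integral {0..1} (\<lambda>t. h' t w v)" for v
    proof -
      have "blinfun_apply (integral {0..1} (\<lambda>t. Dh (t, w))) v
          = integral {0..1} (\<lambda>t. blinfun_apply (Dh (t, w)) v)"
        by (rule blinfun_apply_integral) (rule integrable_continuous_interval[OF cb[OF w]])
      also have "\<dots> = integral {0..1} (\<lambda>t. h' t w v)"
        by (rule integral_cong) (auto simp: Dh w)
      finally show ?thesis by simp
    qed
    ultimately have "((\<lambda>w. integral (cbox 0 1) (\<lambda>t. h (t, w))) has_derivative
        (\<lambda>v. integral {0..1} (\<lambda>t. h' t w v))) (at w within E)"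
      by (rule has_derivative_eq_rhs[OF _ ext])
    then show ?thesis by simp
  qed
  have "continuous_on E (\<lambda>w. integral {0..1} (\<lambda>t. h (t, w)))"
    by (rule has_derivative_continuous_on[OF der])
  then show ?case
    using der Suc.IH[OF h'(2)]
    by (intro Ck_along_SucI[where f'="\<lambda>w v. integral {0..1} (\<lambda>t. h' t w v)"]) simp_all
qed

section \<open>Initial value problems with globally Lipschitz right-hand sides\<close>

text \<open>The proof works with the squared norm, which is differentiable also where \<open>u\<close> vanishes. Adding \<open>c\<^sup>2\<close> absorbs
  the mixed term \<open>2 c \<parallel>u\<parallel>\<close>.\<close>

lemma gronwall_bound:
  fixes u :: "real \<Rightarrow> 'b::real_inner"
  assumes u: "\<And>t. t \<in> {0..b} \<Longrightarrow> (u has_vector_derivative u' t) (at t within {0..b})"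
    and bd: "\<And>t. t \<in> {0..b} \<Longrightarrow> norm (u' t) \<le> K * norm (u t) + c"
    and K: "0 \<le> K" "0 \<le> c" and t: "t \<in> {0..b}"
  shows "(norm (u t))\<^sup>2 \<le> ((norm (u 0))\<^sup>2 + c\<^sup>2) * exp ((2 * K + 1) * t)"
proof -
  define \<phi> where "\<phi> s = (u s \<bullet> u s + c\<^sup>2) * exp (- (2 * K + 1) * s)" for s
  define \<phi>' where "\<phi>' s = (2 * (u s \<bullet> u' s) - (2 * K + 1) * (u s \<bullet> u s + c\<^sup>2)) * exp (- (2 * K + 1) * s)" for s
  have d: "(\<phi> has_derivative (\<lambda>h. h * \<phi>' s)) (at s within {0..b})" if "s \<in> {0..b}" for s
    using u[OF that] unfolding \<phi>_def \<phi>'_def has_vector_derivative_def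
    by (auto intro!: derivative_eq_intros simp: algebra_simps inner_commute)
  have neg: "\<phi>' s \<le> 0" if s: "s \<in> {0..b}" for s
  proof -
    have "u s \<bullet> u' s \<le> norm (u s) * (K * norm (u s) + c)"
      using norm_cauchy_schwarz[of "u s" "u' s"] bd[OF s] mult_left_mono[OF bd[OF s], of "norm (u s)"]
      by auto
    moreover have "0 \<le> (norm (u s) - c)\<^sup>2" by simp
    moreover have "0 \<le> K * c\<^sup>2" using K by simp
    ultimately have "2 * (u s \<bullet> u' s) - (2 * K + 1) * (u s \<bullet> u s + c\<^sup>2) \<le> 0"
      by (simp add: power2_eq_square algebra_simps dot_square_norm)
    then show ?thesis
      unfolding \<phi>'_def by (simp add: mult_nonpos_nonneg)
  qed
  have "\<phi> t \<le> \<phi> 0"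
  proof (cases "t = 0")
    case False
    then have "0 < t" using t by auto
    from mvt_simple[OF this, of \<phi> "\<lambda>s h. h * \<phi>' s"] obtain x where
      "x \<in> {0<..<t}" "\<phi> t - \<phi> 0 = (t - 0) * \<phi>' x"
      using has_derivative_subset[OF d] t by (metis atLeastAtMost_iff atLeastatMost_subset_iff order.trans order_refl)
    then show ?thesis
      using neg[of x] t \<open>0 < t\<close> by (auto simp: mult_nonneg_nonpos algebra_simps)
  qed simp
  moreover have "\<phi> t * exp ((2 * K + 1) * t) = (norm (u t))\<^sup>2 + c\<^sup>2"
    by (simp add: \<phi>_def dot_square_norm mult.assoc flip: exp_add) (simp add: algebra_simps)
  moreover have "\<phi> t * exp ((2 * K + 1) * t) \<le> \<phi> 0 * exp ((2 * K + 1) * t)"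
    using calculation(1) by simp
  moreover have "\<phi> 0 = (norm (u 0))\<^sup>2 + c\<^sup>2"
    by (simp add: \<phi>_def dot_square_norm)
  ultimately show ?thesis
    by (smt (verit) zero_le_power2)
qed

lemma gronwall_zero:
  fixes u :: "real \<Rightarrow> 'b::real_inner"
  assumes "\<And>t. t \<in> {0..b} \<Longrightarrow> (u has_vector_derivative u' t) (at t within {0..b})"
    and "\<And>t. t \<in> {0..b} \<Longrightarrow> norm (u' t) \<le> K * norm (u t)"
    and "0 \<le> K" "u 0 = 0" "t \<in> {0..b}"
  shows "u t = 0"
  using gronwall_bound[of b u u' K 0 t] assms by auto

lemma integral_exp_bound:
  fixes \<kappa> c :: real
  assumes "\<kappa> > 0" "c \<ge> 0"
  shows "((\<lambda>s. exp (\<kappa> * s)) has_integral (exp (\<kappa> * c) - 1) / \<kappa>) {0..c}"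
proof -
  have "((\<lambda>s. exp (\<kappa> * s)) has_integral (exp (\<kappa> * c) / \<kappa> - exp (\<kappa> * 0) / \<kappa>)) {0..c}"
    by (rule fundamental_theorem_of_calculus)
      (use assms in \<open>auto intro!: derivative_eq_intros simp flip: has_real_derivative_iff_has_vector_derivative\<close>)
  then show ?thesis by (simp add: diff_divide_distrib)
qed

text \<open>The weight \<open>exp (- \<kappa> t)\<close> makes the integral operator a contraction on the whole interval at once. Composition
  with \<open>clamp\<close> turns functions on \<open>{0..b}\<close> into bounded continuous functions on the line, which form a complete
  space.\<close>

lemma picard_global:
  fixes F :: "real \<Rightarrow> 'b::banach \<Rightarrow> 'b"
  assumes cont: "continuous_on ({0..b} \<times> UNIV) (\<lambda>(t, x). F t x)"
    and lip: "\<And>t x y. t \<in> {0..b} \<Longrightarrow> norm (F t x - F t y) \<le> K * norm (x - y)"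
    and b: "0 \<le> b"
  obtains x where "x 0 = \<xi>"
    "\<And>t. t \<in> {0..b} \<Longrightarrow> (x has_vector_derivative F t (x t)) (at t within {0..b})"
proof -
  \<comment> \<open>The contraction constant will be \<open>\<bar>K\<bar> / \<kappa>\<close>.\<close>
  define \<kappa> where "\<kappa> = 2 * \<bar>K\<bar> + 1"
  have \<kappa>: "\<kappa> > 0" "\<bar>K\<bar> / \<kappa> \<le> 1/2" by (auto simp: \<kappa>_def field_simps)
  define f where "f w s = F s (exp (\<kappa> * s) *\<^sub>R apply_bcontfun w s)" for w :: "real \<Rightarrow>\<^sub>C 'b" and s
  define G where "G w t = exp (- \<kappa> * t) *\<^sub>R (\<xi> + integral {0..t} (f w))" for w t
  have cf: "continuous_on {0..b} (f w)" for w
    unfolding f_def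
    by (rule continuous_on_compose2[OF cont, of _ "\<lambda>s. (s, exp (\<kappa> * s) *\<^sub>R apply_bcontfun w s)", simplified])
      (auto intro!: continuous_intros)
  have fi: "f w integrable_on {0..t}" if "t \<in> {0..b}" for w t
    using that by (auto intro!: integrable_continuous_interval continuous_on_subset[OF cf])
  have cG: "continuous_on {0..b} (G w)" for w
    unfolding G_def by (intro continuous_intros indefinite_integral_continuous_1 fi) (use b in auto)
  have "\<exists>g :: real \<Rightarrow>\<^sub>C 'b. \<forall>t. g t = G w (clamp 0 b t)" for w
    using continuous_on_cbox_bcontfunE[of 0 b "G w"] cG[of w] by (metis cbox_interval)
  then obtain \<Phi> :: "(real \<Rightarrow>\<^sub>C 'b) \<Rightarrow> real \<Rightarrow>\<^sub>C 'b" where \<Phi>: "\<And>w t. \<Phi> w t = G w (clamp 0 b t)"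
    by metis
  have cl: "clamp 0 b t \<in> {0..b}" for t
    using clamp_in_interval[of 0 b t] b by (auto simp: cbox_interval)
  have "dist (\<Phi> w1) (\<Phi> w2) \<le> 1/2 * dist w1 w2" for w1 w2
  proof (rule dist_bound)
    fix t'
    define t where "t = clamp 0 b t'"
    have t: "t \<in> {0..b}" using cl by (simp add: t_def)
    have "norm (integral {0..t} (\<lambda>s. f w1 s - f w2 s)) \<le> integral {0..t} (\<lambda>s. \<bar>K\<bar> * dist w1 w2 * exp (\<kappa> * s))"
    proof (rule integral_norm_bound_integral)
      show "(\<lambda>s. f w1 s - f w2 s) integrable_on {0..t}"
        by (intro integrable_diff fi t)
      show "(\<lambda>s. \<bar>K\<bar> * dist w1 w2 * exp (\<kappa> * s)) integrable_on {0..t}"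
        by (auto intro!: integrable_continuous_interval continuous_intros)
      fix s assume s: "s \<in> {0..t}"
      have "norm (f w1 s - f w2 s) \<le> K * norm (exp (\<kappa> * s) *\<^sub>R (apply_bcontfun w1 s - apply_bcontfun w2 s))"
        using lip[of s] s t unfolding f_def by (auto simp: scaleR_diff_right)
      also have "\<dots> \<le> \<bar>K\<bar> * (exp (\<kappa> * s) * dist w1 w2)"
        using dist_bounded[of w1 s w2] by (intro mult_mono) (auto simp: dist_norm)
      finally show "norm (f w1 s - f w2 s) \<le> \<bar>K\<bar> * dist w1 w2 * exp (\<kappa> * s)"
        by (simp add: ac_simps)
    qed
    also have "\<dots> = \<bar>K\<bar> * dist w1 w2 * ((exp (\<kappa> * t) - 1) / \<kappa>)"
      using integral_exp_bound[OF \<kappa>(1), of t] t by (simp add: integral_unique)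
    finally have I: "norm (integral {0..t} (\<lambda>s. f w1 s - f w2 s)) \<le> \<bar>K\<bar> * dist w1 w2 * ((exp (\<kappa> * t) - 1) / \<kappa>)" .
    have "dist (\<Phi> w1 t') (\<Phi> w2 t') = exp (- \<kappa> * t) * norm (integral {0..t} (\<lambda>s. f w1 s - f w2 s))"
      unfolding \<Phi> t_def[symmetric] G_def dist_norm
      by (simp add: integral_diff[OF fi[OF t] fi[OF t]] flip: scaleR_diff_right)
    also have "\<dots> \<le> exp (- \<kappa> * t) * (\<bar>K\<bar> * dist w1 w2 * ((exp (\<kappa> * t) - 1) / \<kappa>))"
      by (intro mult_left_mono I) auto
    also have "\<dots> = (\<bar>K\<bar> / \<kappa>) * dist w1 w2 * (exp (- \<kappa> * t) * (exp (\<kappa> * t) - 1))"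
      by simp
    also have "\<dots> = (\<bar>K\<bar> / \<kappa>) * dist w1 w2 * (1 - exp (- \<kappa> * t))"
      by (simp add: right_diff_distrib flip: exp_add)
    also have "\<dots> \<le> (\<bar>K\<bar> / \<kappa>) * dist w1 w2 * 1"
      using \<kappa> by (intro mult_left_mono) auto
    also have "\<dots> \<le> 1/2 * dist w1 w2"
      using mult_right_mono[OF \<kappa>(2), of "dist w1 w2"] by simp
    finally show "dist (\<Phi> w1 t') (\<Phi> w2 t') \<le> 1/2 * dist w1 w2" .
  qed
  then obtain w where w: "\<Phi> w = w"
    using banach_fix_type[of "1/2" \<Phi>] by auto
  define x where "x t = \<xi> + integral {0..t} (f w)" for t
  have wx: "exp (\<kappa> * t) *\<^sub>R apply_bcontfun w t = x t" if t: "t \<in> {0..b}" for t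
  proof -
    have "apply_bcontfun w t = G w t"
      using \<Phi>[of w t] w t by (simp add: cbox_interval)
    then show ?thesis
      by (simp add: G_def x_def flip: exp_add)
  qed
  show ?thesis
  proof (rule that[of x])
    show "x 0 = \<xi>" by (simp add: x_def)
    fix t assume t: "t \<in> {0..b}"
    have "((\<lambda>t. \<xi> + integral {0..t} (f w)) has_vector_derivative 0 + f w t) (at t within {0..b})"
      by (intro has_vector_derivative_add has_vector_derivative_const integral_has_vector_derivative cf t)
    moreover have "f w t = F t (x t)"
      using wx[OF t] by (simp add: f_def)
    ultimately show "(x has_vector_derivative F t (x t)) (at t within {0..b})"
      by (simp add: x_def[abs_def])
  qed
qed

text \<open>The Heine-Cantor argument, with only one of the two points confined to the compact set. It gives
  estimates that are uniform along a trajectory and valid in a full neighbourhood of it.\<close>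

lemma continuous_on_uniform_near_compact:
  fixes g :: "'a::metric_space \<Rightarrow> 'b::metric_space"
  assumes g: "continuous_on T g" and K: "compact K" "K \<subseteq> T" and e: "0 < e"
  obtains d where "0 < d" "\<And>x y. x \<in> K \<Longrightarrow> y \<in> T \<Longrightarrow> dist y x < d \<Longrightarrow> dist (g y) (g x) < e"
proof -
  have "\<forall>x\<in>K. \<exists>d>0. \<forall>y\<in>T. dist y x < d \<longrightarrow> dist (g y) (g x) < e / 2"
    using g K(2) e unfolding continuous_on_iff by (meson half_gt_zero subsetD)
  then obtain r where r: "\<And>x. x \<in> K \<Longrightarrow> 0 < r x"
    "\<And>x y. x \<in> K \<Longrightarrow> y \<in> T \<Longrightarrow> dist y x < r x \<Longrightarrow> dist (g y) (g x) < e / 2"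
    by metis
  have cover: "K \<subseteq> \<Union> ((\<lambda>x. ball x (r x)) ` K)" using r(1) by force
  obtain d where d: "0 < d" "\<And>x. x \<in> K \<Longrightarrow> \<exists>B\<in>(\<lambda>x. ball x (r x)) ` K. ball x d \<subseteq> B"
    using Heine_Borel_lemma[OF K(1) cover] by auto
  show ?thesis
  proof (rule that[OF d(1)])
    fix x y assume xy: "x \<in> K" "y \<in> T" "dist y x < d"
    obtain z where z: "z \<in> K" "ball x d \<subseteq> ball z (r z)" using d(2)[OF xy(1)] by auto
    have "x \<in> ball z (r z)" "y \<in> ball z (r z)"
      using z(2) xy(3) d(1) by (auto simp: dist_commute subset_iff)
    then have "dist (g y) (g z) < e / 2" "dist (g x) (g z) < e / 2"
      using r(2)[OF z(1), of y] r(2)[OF z(1), of x] xy K(2) by (auto simp: dist_commute)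
    then show "dist (g y) (g x) < e"
      using dist_triangle2[of "g y" "g x" "g z"] by (simp add: dist_commute)
  qed
qed

text \<open>A bound that is proportional to the common size \<open>c\<close> of the initial value and of the inhomogeneity.\<close>

lemma gronwall_linear:
  fixes u :: "real \<Rightarrow> 'b::real_inner"
  assumes "\<And>t. t \<in> {0..1} \<Longrightarrow> (u has_vector_derivative u' t) (at t within {0..1})"
    and "\<And>t. t \<in> {0..1} \<Longrightarrow> norm (u' t) \<le> K * norm (u t) + c"
    and "0 \<le> K" "norm (u 0) \<le> c" "t \<in> {0..1}"
  shows "norm (u t) \<le> 2 * c * exp (2 * K + 1)"
proof -
  define E where "E = exp (2 * K + 1)"
  have E: "1 \<le> E" using assms(3) by (simp add: E_def)
  have c: "0 \<le> c" by (rule order_trans[OF norm_ge_zero assms(4)])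
  have "(norm (u t))\<^sup>2 \<le> ((norm (u 0))\<^sup>2 + c\<^sup>2) * exp ((2 * K + 1) * t)"
    by (rule gronwall_bound) (use assms c in auto)
  also have "\<dots> \<le> (c\<^sup>2 + c\<^sup>2) * E"
    unfolding E_def using assms c mult_left_le[of t "2 * K + 1"]
    by (intro mult_mono add_mono power_mono) auto
  also have "\<dots> \<le> (4 * c\<^sup>2) * (E * E)"
    using E by (intro mult_mono) (auto simp: mult_le_cancel_left1)
  also have "\<dots> = (2 * c * E)\<^sup>2"
    by (simp add: power2_eq_square)
  finally show ?thesis
    unfolding E_def[symmetric] using c E by (auto intro: power2_le_imp_le)
qed

lemma compact_graph:
  fixes x :: "real \<Rightarrow> 'b::t2_space"
  assumes "continuous_on {0..1} x"
  shows "compact ((\<lambda>t. (t, x t, l)) ` {0..1::real})"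
  by (intro compact_continuous_image continuous_intros assms compact_Icc)

text \<open>The Lipschitz estimate is demanded only along the given solutions and locally in the parameter. This covers
  solutions in a tube around a reference solution as well as linear equations on the whole space.\<close>

lemma ode_param_continuity:
  fixes X :: "real \<times> 'c::metric_space \<Rightarrow> 'b::euclidean_space"
  assumes sol: "\<And>t l. t \<in> {0..1} \<Longrightarrow> l \<in> \<Lambda> \<Longrightarrow>
      ((\<lambda>t. X (t, l)) has_vector_derivative F (t, X (t, l), l)) (at t within {0..1})"
    and XR: "\<And>t l. t \<in> {0..1} \<Longrightarrow> l \<in> \<Lambda> \<Longrightarrow> X (t, l) \<in> R"
    and contF: "continuous_on ({0..1} \<times> R \<times> \<Lambda>) F"
    and init: "continuous_on \<Lambda> (\<lambda>l. X (0, l))"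
    and lip: "\<And>l1. l1 \<in> \<Lambda> \<Longrightarrow> \<exists>K\<ge>0. \<exists>d>0. \<forall>l\<in>\<Lambda>. dist l l1 < d \<longrightarrow> (\<forall>t\<in>{0..1}.
        norm (F (t, X (t, l), l) - F (t, X (t, l1), l)) \<le> K * norm (X (t, l) - X (t, l1)))"
  shows "continuous_on ({0..1} \<times> \<Lambda>) X"
proof -
  have cX: "continuous_on {0..1} (\<lambda>t. X (t, l))" if "l \<in> \<Lambda>" for l
    using sol[OF _ that] by (intro continuous_on_vector_derivative) auto
  have unif: "\<exists>d>0. \<forall>l\<in>\<Lambda>. dist l l1 < d \<longrightarrow> (\<forall>t\<in>{0..1}. norm (X (t, l) - X (t, l1)) < e)"
    if l1: "l1 \<in> \<Lambda>" and e: "0 < e" for l1 e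
  proof -
    obtain K d1 where K: "0 \<le> K" "0 < d1" and lp: "\<And>l t. l \<in> \<Lambda> \<Longrightarrow> dist l l1 < d1 \<Longrightarrow> t \<in> {0..1} \<Longrightarrow>
        norm (F (t, X (t, l), l) - F (t, X (t, l1), l)) \<le> K * norm (X (t, l) - X (t, l1))"
      using lip[OF l1] by blast
    define c where "c = e / (4 * exp (2 * K + 1))"
    have c: "0 < c" "2 * c * exp (2 * K + 1) < e" using e by (auto simp: c_def)
    obtain d2 where d2: "0 < d2" "\<And>x y. x \<in> (\<lambda>t. (t, X (t, l1), l1)) ` {0..1} \<Longrightarrow>
        y \<in> {0..1} \<times> R \<times> \<Lambda> \<Longrightarrow> dist y x < d2 \<Longrightarrow> dist (F y) (F x) < c"
      using continuous_on_uniform_near_compact[OF contF compact_graph[OF cX[OF l1]] _ c(1)] XR l1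
      by blast
    obtain d3 where d3: "0 < d3" "\<And>l. l \<in> \<Lambda> \<Longrightarrow> dist l l1 < d3 \<Longrightarrow> dist (X (0, l)) (X (0, l1)) < c"
      using init l1 c(1) unfolding continuous_on_iff by blast
    have "norm (X (t, l) - X (t, l1)) < e"
      if l: "l \<in> \<Lambda>" "dist l l1 < min d1 (min d2 d3)" and t: "t \<in> {0..1}" for l t
    proof -
      have "norm (X (t, l) - X (t, l1)) \<le> 2 * c * exp (2 * K + 1)"
      proof (rule gronwall_linear[of "\<lambda>t. X (t, l) - X (t, l1)"
            "\<lambda>t. F (t, X (t, l), l) - F (t, X (t, l1), l1)"])
        fix t :: real assume t: "t \<in> {0..1}"
        show "((\<lambda>t. X (t, l) - X (t, l1)) has_vector_derivative
            F (t, X (t, l), l) - F (t, X (t, l1), l1)) (at t within {0..1})"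
          by (intro has_vector_derivative_diff sol t l l1)
        have "dist (F (t, X (t, l1), l)) (F (t, X (t, l1), l1)) < c"
          by (rule d2(2)) (use l t XR[OF t l1] in \<open>auto simp: dist_Pair_Pair\<close>)
        then show "norm (F (t, X (t, l), l) - F (t, X (t, l1), l1)) \<le> K * norm (X (t, l) - X (t, l1)) + c"
          using lp[OF l(1) _ t] l(2) norm_triangle_le_diff
          norm_diff_triangle_le[of "F (t, X (t, l), l)" "F (t, X (t, l1), l)" "K * norm (X (t, l) - X (t, l1))"
             "F (t, X (t, l1), l1)" c]
          by (auto simp: dist_norm)
      qed (use K d3(2)[OF l(1)] l(2) t in \<open>auto simp: dist_norm\<close>)
      then show ?thesis using c by linarith
    qed
    then show ?thesis
      using K d2 d3 by (intro exI[of _ "min d1 (min d2 d3)"]) auto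
  qed
  show ?thesis
    unfolding continuous_on_iff
  proof (intro ballI allI impI)
    fix z :: "real \<times> 'c" and e assume z: "z \<in> {0..1} \<times> \<Lambda>" and e: "(0::real) < e"
    obtain t1 l1 where z1: "z = (t1, l1)" "t1 \<in> {0..1}" "l1 \<in> \<Lambda>" using z by auto
    obtain d1 where d1: "0 < d1" "\<And>l t. l \<in> \<Lambda> \<Longrightarrow> dist l l1 < d1 \<Longrightarrow> t \<in> {0..1} \<Longrightarrow>
        norm (X (t, l) - X (t, l1)) < e / 2"
      using unif[OF z1(3), of "e/2"] e by auto
    obtain d2 where d2: "0 < d2" "\<And>t::real. t \<in> {0..1} \<Longrightarrow> dist t t1 < d2 \<Longrightarrow> dist (X (t, l1)) (X (t1, l1)) < e / 2"
      using cX[OF z1(3)] z1(2) e unfolding continuous_on_iff by (meson half_gt_zero)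
    show "\<exists>d>0. \<forall>x'\<in>{0..1} \<times> \<Lambda>. dist x' z < d \<longrightarrow> dist (X x') (X z) < e"
    proof (intro exI[of _ "min d1 d2"] conjI ballI impI)
      fix x' assume x': "x' \<in> {0..1} \<times> \<Lambda>" "dist x' z < min d1 d2"
      obtain t l where x: "x' = (t, l)" "t \<in> {0..1}" "l \<in> \<Lambda>" using x'(1) by auto
      have "dist t t1 < min d1 d2" "dist l l1 < min d1 d2"
        using x'(2) dist_fst_le[of x' z] dist_snd_le[of x' z] by (auto simp: x z1)
      then have "dist (X (t, l)) (X (t, l1)) < e / 2" "dist (X (t, l1)) (X (t1, l1)) < e / 2"
        using d1 d2 x by (auto simp: dist_norm)
      then show "dist (X x') (X z) < e"
        unfolding x z1 using dist_triangle_half_l dist_commute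
        by (metis dist_triangle_half_r)
    qed (use d1 d2 in auto)
  qed
qed

section \<open>Differentiation with respect to parameters\<close>

lemma linear_ode_exists:
  fixes A :: "real \<Rightarrow> 'b::banach \<Rightarrow>\<^sub>L 'b"
  assumes A: "continuous_on {0..b} A" and \<beta>: "continuous_on {0..b} \<beta>" and b: "0 \<le> b"
  obtains y where "y 0 = \<xi>"
    "\<And>t. t \<in> {0..b} \<Longrightarrow> (y has_vector_derivative (A t (y t) + \<beta> t)) (at t within {0..b})"
proof -
  have "bounded (A ` {0..b})"
    by (rule compact_imp_bounded[OF compact_continuous_image[OF A compact_Icc]])
  then obtain K where K: "\<And>t. t \<in> {0..b} \<Longrightarrow> norm (A t) \<le> K"
    unfolding bounded_iff by blast
  show ?thesis
  proof (rule picard_global[of b "\<lambda>t x. A t x + \<beta> t" K \<xi>])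
    show "continuous_on ({0..b} \<times> UNIV) (\<lambda>(t, x). A t x + \<beta> t)"
      unfolding split_beta
      by (intro continuous_intros continuous_on_compose2[OF A] continuous_on_compose2[OF \<beta>]) auto
    show "norm (A t x + \<beta> t - (A t y + \<beta> t)) \<le> K * norm (x - y)" if "t \<in> {0..b}" for t x y
      using norm_blinfun[of "A t" "x - y"] mult_right_mono[OF K[OF that], of "norm (x - y)"]
      by (simp add: blinfun.diff_right)
  qed (use b that in auto)
qed

lemma linear_ode_unique:
  fixes A :: "real \<Rightarrow> 'b::real_inner \<Rightarrow>\<^sub>L 'b"
  assumes A: "continuous_on {0..b} A"
    and y: "\<And>t. t \<in> {0..b} \<Longrightarrow> (y has_vector_derivative (A t (y t) + \<beta> t)) (at t within {0..b})"
    and z: "\<And>t. t \<in> {0..b} \<Longrightarrow> (z has_vector_derivative (A t (z t) + \<beta> t)) (at t within {0..b})"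
    and "y 0 = z 0" "t \<in> {0..b}"
  shows "y t = z t"
proof -
  have "bounded (A ` {0..b})"
    by (rule compact_imp_bounded[OF compact_continuous_image[OF A compact_Icc]])
  then obtain K where K: "\<And>t. t \<in> {0..b} \<Longrightarrow> norm (A t) \<le> K"
    unfolding bounded_iff by blast
  have "y t - z t = 0"
  proof (rule gronwall_zero[of b "\<lambda>t. y t - z t" "\<lambda>t. A t (y t - z t)" "\<bar>K\<bar>" t])
    show "((\<lambda>t. y t - z t) has_vector_derivative A t (y t - z t)) (at t within {0..b})"
      if "t \<in> {0..b}" for t
      using has_vector_derivative_diff[OF y[OF that] z[OF that]] by (simp add: blinfun.diff_right)
    show "norm (A t (y t - z t)) \<le> \<bar>K\<bar> * norm (y t - z t)" if "t \<in> {0..b}" for t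
      using norm_blinfun[of "A t" "y t - z t"]
        mult_right_mono[OF order_trans[OF K[OF that] abs_ge_self], of "norm (y t - z t)"] by simp
  qed (use assms in auto)
  then show ?thesis by simp
qed

text \<open>The remainder of the first-order expansion satisfies the linearised equation up to an error that is small
  compared with \<open>\<parallel>l - l0\<parallel>\<close>, uniformly in time. Gronwall's inequality then bounds the remainder itself.\<close>

lemma ode_derivative_parameter:
  fixes F :: "real \<times> 'b::euclidean_space \<times> 'c::euclidean_space \<Rightarrow> 'b"
  assumes R: "open R" and \<Lambda>: "convex \<Lambda>"
    and F': "\<And>t w. t \<in> {0..1} \<Longrightarrow> w \<in> R \<times> \<Lambda> \<Longrightarrow>
        ((\<lambda>w. F (t, w)) has_derivative F' t w) (at w within R \<times> \<Lambda>)"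
    and cF': "\<And>v. continuous_on ({0..1} \<times> R \<times> \<Lambda>) (\<lambda>z. F' (fst z) (snd z) v)"
    and sol: "\<And>t l. t \<in> {0..1} \<Longrightarrow> l \<in> \<Lambda> \<Longrightarrow>
        ((\<lambda>t. X (t, l)) has_vector_derivative F (t, X (t, l), l)) (at t within {0..1})"
    and XR: "\<And>t l. t \<in> {0..1} \<Longrightarrow> l \<in> \<Lambda> \<Longrightarrow> X (t, l) \<in> R"
    and cX: "continuous_on ({0..1} \<times> \<Lambda>) X"
    and init: "\<And>l. l \<in> \<Lambda> \<Longrightarrow> ((\<lambda>l. X (0, l)) has_derivative \<iota>' l) (at l within \<Lambda>)"
    and Y: "\<And>v t l. t \<in> {0..1} \<Longrightarrow> l \<in> \<Lambda> \<Longrightarrow>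
        ((\<lambda>t. Y v (t, l)) has_vector_derivative F' t (X (t, l), l) (Y v (t, l), v)) (at t within {0..1})"
    and Y0: "\<And>v l. l \<in> \<Lambda> \<Longrightarrow> Y v (0, l) = \<iota>' l v"
    and t0: "t0 \<in> {0..1}" and l0: "l0 \<in> \<Lambda>"
  shows "((\<lambda>l. X (t0, l)) has_derivative (\<lambda>v. Y v (t0, l0))) (at l0 within \<Lambda>)"
proof -
  obtain DF where DF: "\<And>t w. t \<in> {0..1} \<Longrightarrow> w \<in> R \<times> \<Lambda> \<Longrightarrow> blinfun_apply (DF (t, w)) = F' t w"
    and cDF: "continuous_on ({0..1} \<times> R \<times> \<Lambda>) DF"
    using blinfun_derivative[OF F' cF'] by blast
  define z where "z t = (t, X (t, l0), l0)" for t
  have z: "z t \<in> {0..1} \<times> R \<times> \<Lambda>" if "t \<in> {0..1}" for t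
    using XR that l0 by (auto simp: z_def)
  have cX0: "continuous_on {0..1} (\<lambda>t. X (t, l0))"
    by (intro continuous_on_compose2[OF cX]) (use l0 in \<open>auto intro!: continuous_intros\<close>)
  have cz: "compact (z ` {0..1})"
    unfolding z_def by (rule compact_graph[OF cX0])
  define D where "D t = DF (z t)" for t
  have D: "blinfun_apply (D t) = F' t (X (t, l0), l0)" if "t \<in> {0..1}" for t
    using DF z that by (auto simp: D_def z_def)
  have cD: "continuous_on {0..1} D"
    unfolding D_def by (rule continuous_on_compose2[OF cDF])
      (use z cX0 in \<open>auto simp: z_def intro!: continuous_intros\<close>)
  have Yl: "((\<lambda>t. Y v (t, l0)) has_vector_derivative D t (Y v (t, l0), v)) (at t within {0..1})"
    if "t \<in> {0..1}" for v t
    using Y[OF that l0] D[OF that] by simp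
  have lin: "linear (\<lambda>v. Y v (t, l0))" if t: "t \<in> {0..1}" for t
  proof -
    define A where "A t = D t o\<^sub>L Blinfun (\<lambda>x. (x, 0))" for t
    define B where "B v t = D t (0, v)" for v t
    have "bounded_linear (\<lambda>x::'b. (x, 0::'c))"
      by (auto intro: bounded_linear_Pair bounded_linear_ident bounded_linear_zero)
    then have split: "D t (x, v) = A t x + B v t" for t x v
      by (simp add: A_def B_def bounded_linear_Blinfun_apply flip: blinfun.add_right)
    have cA: "continuous_on {0..1} A"
      unfolding A_def by (intro continuous_intros cD)
    have il: "linear (\<iota>' l0)" using init[OF l0] has_derivative_linear by blast
    have Bl: "B (u + v) t = B u t + B v t" "B (c *\<^sub>R v) t = c *\<^sub>R B v t" for u v c t
      by (simp_all add: B_def flip: blinfun.add_right blinfun.scaleR_right)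
    have Yd: "((\<lambda>t. Y v (t, l0)) has_vector_derivative A t (Y v (t, l0)) + B v t) (at t within {0..1})"
      if "t \<in> {0..1}" for v t
      using Yl[OF that] by (simp add: split)
    show ?thesis
    proof (rule linearI)
      fix u v
      show "Y (u + v) (t, l0) = Y u (t, l0) + Y v (t, l0)"
      proof (rule linear_ode_unique[OF cA Yd _ _ t])
        show "((\<lambda>t. Y u (t, l0) + Y v (t, l0)) has_vector_derivative
            A t (Y u (t, l0) + Y v (t, l0)) + B (u + v) t) (at t within {0..1})" if "t \<in> {0..1}" for t
          using has_vector_derivative_add[OF Yd[OF that] Yd[OF that], of u v]
          by (simp add: blinfun.add_right Bl algebra_simps)
      qed (auto simp: Y0 l0 linear_add[OF il])
    next
      fix c v
      show "Y (c *\<^sub>R v) (t, l0) = c *\<^sub>R Y v (t, l0)"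
      proof (rule linear_ode_unique[OF cA Yd _ _ t])
        show "((\<lambda>t. c *\<^sub>R Y v (t, l0)) has_vector_derivative
            A t (c *\<^sub>R Y v (t, l0)) + B (c *\<^sub>R v) t) (at t within {0..1})" if "t \<in> {0..1}" for t
          using bounded_linear.has_vector_derivative[OF bounded_linear_scaleR_right Yd[OF that], of c v]
          by (simp add: blinfun.scaleR_right Bl scaleR_add_right)
      qed (auto simp: Y0 l0 linear_scale[OF il])
    qed
  qed
  have cY: "continuous_on {0..1} (\<lambda>t. Y v (t, l0))" for v
    by (rule continuous_on_vector_derivative[OF Yl])
  obtain C where C: "0 \<le> C" "\<And>t v. t \<in> {0..1} \<Longrightarrow> norm (Y v (t, l0)) \<le> C * norm v"
  proof -
    have "\<exists>c. \<forall>t\<in>{0..1}. norm (Y i (t, l0)) \<le> c" for i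
      using compact_imp_bounded[OF compact_continuous_image[OF cY[of i] compact_Icc]]
      unfolding bounded_iff by auto
    then obtain c where c: "\<And>i t. t \<in> {0..1} \<Longrightarrow> norm (Y i (t, l0)) \<le> c i" by metis
    show ?thesis
    proof (rule that[of "\<Sum>i\<in>Basis. c i"])
      show "0 \<le> (\<Sum>i\<in>Basis. c i)"
        using order_trans[OF norm_ge_zero c[of 0]] by (intro sum_nonneg) auto
      fix t :: real and v :: 'c assume t: "t \<in> {0..1}"
      have "Y v (t, l0) = (\<Sum>i\<in>Basis. (v \<bullet> i) *\<^sub>R Y i (t, l0))"
        by (subst euclidean_representation[of v, symmetric])
          (simp add: linear_sum[OF lin[OF t]] linear_scale[OF lin[OF t]])
      also have "norm \<dots> \<le> (\<Sum>i\<in>Basis. norm v * c i)"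
        using c[OF t] Basis_le_norm
        by (intro sum_norm_le) (auto intro!: mult_mono)
      finally show "norm (Y v (t, l0)) \<le> (\<Sum>i\<in>Basis. c i) * norm v"
        by (simp add: sum_distrib_left mult.commute)
    qed
  qed
  obtain K where K: "\<And>t. t \<in> {0..1} \<Longrightarrow> norm (D t) \<le> K"
    using compact_imp_bounded[OF compact_continuous_image[OF cD compact_Icc]]
    unfolding bounded_iff by blast
  have K0: "0 \<le> K" using order_trans[OF norm_ge_zero K[of 0]] by simp
  obtain \<rho> where \<rho>: "0 < \<rho>" "(\<Union>x\<in>(\<lambda>t. X (t, l0)) ` {0..1}. ball x \<rho>) \<subseteq> R"
    by (rule compact_subset_open_imp_ball_epsilon_subset[OF
          compact_continuous_image[OF cX0 compact_Icc] R])
      (use XR l0 in auto)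
  show ?thesis
    unfolding has_derivative_within_alt
  proof (intro conjI allI impI)
    show "bounded_linear (\<lambda>v. Y v (t0, l0))"
      using lin[OF t0] linear_conv_bounded_linear by blast
    fix e :: real assume e: "0 < e"
    \<comment> \<open>With this \<open>\<eta>\<close> the bound of \<open>gronwall_linear\<close> becomes \<open>e * norm (l - l0)\<close>.\<close>
    define \<eta> where "\<eta> = min 1 (e / (2 * (C + 1) * exp (2 * (K + 1) + 1)))"
    have \<eta>: "0 < \<eta>" "\<eta> \<le> 1" "2 * (\<eta> * (C + 1)) * exp (2 * (K + 1) + 1) \<le> e"
    proof -
      have p: "0 < 2 * (C + 1) * exp (2 * (K + 1) + 1)" using C by simp
      then show "0 < \<eta>" "\<eta> \<le> 1" using e by (auto simp: \<eta>_def)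
      have "\<eta> \<le> e / (2 * (C + 1) * exp (2 * (K + 1) + 1))" by (simp add: \<eta>_def)
      then show "2 * (\<eta> * (C + 1)) * exp (2 * (K + 1) + 1) \<le> e"
        using p by (simp add: pos_le_divide_eq algebra_simps)
    qed
    obtain d1 where d1: "0 < d1" "\<And>x y. x \<in> z ` {0..1} \<Longrightarrow>
        y \<in> {0..1} \<times> R \<times> \<Lambda> \<Longrightarrow> dist y x < d1 \<Longrightarrow> dist (DF y) (DF x) < \<eta>"
      using continuous_on_uniform_near_compact[OF cDF cz _ \<eta>(1)] z by blast
    define d where "d = min \<rho> (d1 / 2)"
    have d: "0 < d" "d \<le> \<rho>" "2 * d \<le> d1" using \<rho> d1 by (auto simp: d_def)
    obtain d2 where d2: "0 < d2" "\<And>x y. x \<in> (\<lambda>t. (t, l0)) ` {0..1} \<Longrightarrow>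
        y \<in> {0..1} \<times> \<Lambda> \<Longrightarrow> dist y x < d2 \<Longrightarrow> dist (X y) (X x) < d"
      by (rule continuous_on_uniform_near_compact[OF cX _ _ d(1), of "(\<lambda>t. (t, l0)) ` {0..1}"])
        (use l0 in \<open>auto intro!: compact_continuous_image continuous_intros\<close>)
    obtain d3 where d3: "0 < d3" "\<And>l. l \<in> \<Lambda> \<Longrightarrow> norm (l - l0) < d3 \<Longrightarrow>
        norm (X (0, l) - X (0, l0) - \<iota>' l0 (l - l0)) \<le> \<eta> * norm (l - l0)"
      using init[OF l0] \<eta>(1) unfolding has_derivative_within_alt by blast
    show "\<exists>d>0. \<forall>l\<in>\<Lambda>. norm (l - l0) < d \<longrightarrow>
        norm (X (t0, l) - X (t0, l0) - Y (l - l0) (t0, l0)) \<le> e * norm (l - l0)"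
    proof (intro exI[of _ "min d (min d2 d3)"] conjI ballI impI)
      fix l assume l: "l \<in> \<Lambda>" and near: "norm (l - l0) < min d (min d2 d3)"
      define h where "h = l - l0"
      define Rm where "Rm t = X (t, l) - X (t, l0) - Y h (t, l0)" for t
      define Rm' where "Rm' t = F (t, X (t, l), l) - F (t, X (t, l0), l0) - D t (Y h (t, l0), h)" for t
      have hn: "norm h < d" "norm h < d2" "norm h < d3" using near by (auto simp: h_def)
      have "norm (Rm t0) \<le> 2 * (\<eta> * (C + 1) * norm h) * exp (2 * (K + 1) + 1)"
      proof (rule gronwall_linear[of Rm Rm'])
        fix t :: real assume t: "t \<in> {0..1}"
        show "(Rm has_vector_derivative Rm' t) (at t within {0..1})"
          unfolding Rm_def Rm'_def
          by (intro has_vector_derivative_diff sol t l l0 Yl)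
        have close: "dist (X (t, l)) (X (t, l0)) < d"
          by (rule d2(2)) (use t l hn in \<open>auto simp: dist_Pair_Pair dist_norm h_def\<close>)
        define S where "S = ball (X (t, l0)) d \<times> (\<Lambda> \<inter> ball l0 d)"
        have SR: "S \<subseteq> R \<times> \<Lambda>"
          using \<rho>(2) t d(2) unfolding S_def by fastforce
        have Sin: "(X (t, l), l) \<in> S" "(X (t, l0), l0) \<in> S"
          using close l l0 hn d by (auto simp: S_def dist_commute h_def dist_norm norm_minus_commute)
        have cS: "convex S"
          unfolding S_def by (intro convex_Times convex_Int \<Lambda> convex_ball)
        have "norm (F (t, X (t, l), l) - F (t, X (t, l0), l0) - F' t (X (t, l0), l0) ((X (t, l), l) - (X (t, l0), l0)))
            \<le> norm ((X (t, l), l) - (X (t, l0), l0)) * \<eta>"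
        proof (rule differentiable_bound_linearization[where S=S and f="\<lambda>w. F (t, w)" and f'="F' t"])
          show "(X (t, l0), l0) + s *\<^sub>R ((X (t, l), l) - (X (t, l0), l0)) \<in> S" if "s \<in> {0..1}" for s
            using convexD_alt[OF cS Sin(2) Sin(1), of s] that by (simp add: algebra_simps)
          show "((\<lambda>w. F (t, w)) has_derivative F' t w) (at w within S)" if "w \<in> S" for w
            using F'[OF t, of w] that SR by (auto intro: has_derivative_subset)
          show "onorm (F' t w - F' t (X (t, l0), l0)) \<le> \<eta>" if w: "w \<in> S" for w
          proof -
            have "dist (t, w) (z t) < d1"
            proof -
              have "dist (fst w) (X (t, l0)) < d" "dist (snd w) l0 < d"
                using w by (auto simp: S_def dist_commute)
              then have "dist w (X (t, l0), l0) < d + d"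
                using sqrt_sum_squares_le_sum[of "dist (fst w) (X (t, l0))" "dist (snd w) l0"]
                by (auto simp: dist_prod_def)
              then show ?thesis using d by (simp add: z_def dist_Pair_Pair)
            qed
            then have "norm (DF (t, w) - DF (z t)) < \<eta>"
              using d1(2)[of "z t" "(t, w)"] t w SR by (auto simp: dist_norm)
            moreover have "blinfun_apply (DF (t, w) - DF (z t)) = F' t w - F' t (X (t, l0), l0)"
              using DF[OF t, of w] w SR D[OF t] by (auto simp: fun_eq_iff blinfun.diff_left D_def)
            ultimately show ?thesis
              by (simp add: norm_blinfun.rep_eq)
          qed
        qed (rule Sin)
        then have rem: "norm (F (t, X (t, l), l) - F (t, X (t, l0), l0) - D t (X (t, l) - X (t, l0), h))
            \<le> norm (X (t, l) - X (t, l0), h) * \<eta>"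
          by (simp add: D[OF t] h_def)
        have "norm (X (t, l) - X (t, l0), h) \<le> norm (X (t, l) - X (t, l0)) + norm h"
          by (rule norm_Pair_le)
        also have "norm (X (t, l) - X (t, l0)) \<le> norm (Rm t) + C * norm h"
          using norm_triangle_ineq[of "Rm t" "Y h (t, l0)"] C(2)[OF t, of h] by (simp add: Rm_def)
        finally have n1: "norm (X (t, l) - X (t, l0), h) \<le> norm (Rm t) + (C + 1) * norm h"
          by (simp add: algebra_simps)
        have "D t (X (t, l) - X (t, l0), h) = D t (Y h (t, l0), h) + D t (Rm t, 0)"
          by (simp add: Rm_def flip: blinfun.add_right)
        then have "Rm' t = (F (t, X (t, l), l) - F (t, X (t, l0), l0) - D t (X (t, l) - X (t, l0), h))
            + D t (Rm t, 0)"
          by (simp add: Rm'_def)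
        then have "norm (Rm' t) \<le> norm (X (t, l) - X (t, l0), h) * \<eta> + norm (D t (Rm t, 0))"
          by (simp only:) (rule order_trans[OF norm_triangle_ineq add_right_mono[OF rem]])
        also have "norm (D t (Rm t, 0)) \<le> K * norm (Rm t)"
          using norm_blinfun[of "D t" "(Rm t, 0)"] mult_right_mono[OF K[OF t], of "norm (Rm t)"]
          by (simp add: norm_Pair)
        also have "norm (X (t, l) - X (t, l0), h) * \<eta> \<le> (norm (Rm t) + (C + 1) * norm h) * \<eta>"
          using n1 \<eta> by (intro mult_right_mono) auto
        also have "\<dots> \<le> norm (Rm t) + \<eta> * (C + 1) * norm h"
          using mult_left_le[OF \<eta>(2), of "norm (Rm t)"] by (simp add: algebra_simps)
        finally show "norm (Rm' t) \<le> (K + 1) * norm (Rm t) + \<eta> * (C + 1) * norm h"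
          by (simp add: algebra_simps)
      next
        have "norm (Rm 0) \<le> \<eta> * norm h"
          using d3(2)[OF l] hn(3) by (simp add: Rm_def h_def Y0[OF l0])
        also have "\<dots> \<le> \<eta> * (C + 1) * norm h"
          using C \<eta> by (simp add: mult_right_mono)
        finally show "norm (Rm 0) \<le> \<eta> * (C + 1) * norm h" .
      qed (use K0 t0 in auto)
      also have "\<dots> = (2 * (\<eta> * (C + 1)) * exp (2 * (K + 1) + 1)) * norm h" by simp
      also have "\<dots> \<le> e * norm h"
        by (rule mult_right_mono[OF \<eta>(3)]) simp
      finally show "norm (X (t0, l) - X (t0, l0) - Y (l - l0) (t0, l0)) \<le> e * norm (l - l0)"
        by (simp add: Rm_def h_def)
    qed (use d d2 d3 in auto)
  qed
qed

section \<open>Smooth dependence on parameters\<close>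

text \<open>The coefficient matrix is given by its columns \<open>a i\<close>, so that its smoothness is that of vector-valued
  functions.\<close>

lemma linear_ode_family_exists:
  fixes a :: "'b::euclidean_space \<Rightarrow> real \<times> 'c::euclidean_space \<Rightarrow> 'b"
  assumes ca: "\<And>i. i \<in> Basis \<Longrightarrow> continuous_on ({0..1} \<times> \<Lambda>) (a i)"
    and c\<beta>: "continuous_on ({0..1} \<times> \<Lambda>) \<beta>"
  shows "\<exists>Y. \<forall>l\<in>\<Lambda>. Y (0, l) = y0 l \<and> (\<forall>t\<in>{0..1}. ((\<lambda>t. Y (t, l)) has_vector_derivative
      (\<Sum>i\<in>Basis. (Y (t, l) \<bullet> i) *\<^sub>R a i (t, l)) + \<beta> (t, l)) (at t within {0..1}))"
proof -
  have "\<forall>l\<in>\<Lambda>. \<exists>Y. Y 0 = y0 l \<and> (\<forall>t\<in>{0..1}. (Y has_vector_derivative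
      (\<Sum>i\<in>Basis. (Y t \<bullet> i) *\<^sub>R a i (t, l)) + \<beta> (t, l)) (at t within {0..1}))"
  proof
    fix l assume l: "l \<in> \<Lambda>"
    define A where "A t = Blinfun (\<lambda>x. \<Sum>i\<in>Basis. (x \<bullet> i) *\<^sub>R a i (t, l))" for t
    have A: "blinfun_apply (A t) = (\<lambda>x. \<Sum>i\<in>Basis. (x \<bullet> i) *\<^sub>R a i (t, l))" for t
      unfolding A_def by (intro bounded_linear_Blinfun_apply bounded_linear_sum
        bounded_linear_scaleR_left[THEN bounded_linear_compose] bounded_linear_inner_left)
    have cA: "continuous_on {0..1} A"
      by (intro continuous_on_blinfun_componentwise)
        (use l in \<open>auto simp: A intro!: continuous_intros continuous_on_compose2[OF ca]\<close>)
    have cb: "continuous_on {0..1} (\<lambda>t. \<beta> (t, l))"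
      using l by (intro continuous_on_compose2[OF c\<beta>]) (auto intro!: continuous_intros)
    obtain Y where "Y 0 = y0 l" "\<And>t. t \<in> {0..1} \<Longrightarrow>
        (Y has_vector_derivative A t (Y t) + \<beta> (t, l)) (at t within {0..1})"
      using linear_ode_exists[OF cA cb zero_le_one] by blast
    then show "\<exists>Y. Y 0 = y0 l \<and> (\<forall>t\<in>{0..1}. (Y has_vector_derivative
      (\<Sum>i\<in>Basis. (Y t \<bullet> i) *\<^sub>R a i (t, l)) + \<beta> (t, l)) (at t within {0..1}))"
      unfolding A by blast
  qed
  from bchoice[OF this] obtain Y where Y: "\<forall>l\<in>\<Lambda>. Y l 0 = y0 l \<and> (\<forall>t\<in>{0..1}. (Y l has_vector_derivative
      (\<Sum>i\<in>Basis. (Y l t \<bullet> i) *\<^sub>R a i (t, l)) + \<beta> (t, l)) (at t within {0..1}))" ..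
  then show ?thesis
    by (intro exI[of _ "\<lambda>z. Y (snd z) (fst z)"]) auto
qed

text \<open>The variational equation is linear, hence has global solutions; these are the derivatives.\<close>

lemma ode_variational_equation:
  fixes F :: "real \<times> 'b::euclidean_space \<times> 'c::euclidean_space \<Rightarrow> 'b"
  assumes R: "open R" and \<Lambda>: "convex \<Lambda>"
    and F': "\<And>t w. t \<in> {0..1} \<Longrightarrow> w \<in> R \<times> \<Lambda> \<Longrightarrow>
        ((\<lambda>w. F (t, w)) has_derivative F' t w) (at w within R \<times> \<Lambda>)"
    and cF': "\<And>v. continuous_on ({0..1} \<times> R \<times> \<Lambda>) (\<lambda>z. F' (fst z) (snd z) v)"
    and sol: "\<And>t l. t \<in> {0..1} \<Longrightarrow> l \<in> \<Lambda> \<Longrightarrow>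
        ((\<lambda>t. X (t, l)) has_vector_derivative F (t, X (t, l), l)) (at t within {0..1})"
    and XR: "\<And>t l. t \<in> {0..1} \<Longrightarrow> l \<in> \<Lambda> \<Longrightarrow> X (t, l) \<in> R"
    and cX: "continuous_on ({0..1} \<times> \<Lambda>) X"
    and init: "\<And>l. l \<in> \<Lambda> \<Longrightarrow> ((\<lambda>l. X (0, l)) has_derivative \<iota>' l) (at l within \<Lambda>)"
  obtains Y where
    "\<And>v l. l \<in> \<Lambda> \<Longrightarrow> Y v (0, l) = \<iota>' l v"
    "\<And>v t l. t \<in> {0..1} \<Longrightarrow> l \<in> \<Lambda> \<Longrightarrow>
      ((\<lambda>t. Y v (t, l)) has_vector_derivative F' t (X (t, l), l) (Y v (t, l), v)) (at t within {0..1})"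
    "\<And>t l. t \<in> {0..1} \<Longrightarrow> l \<in> \<Lambda> \<Longrightarrow>
      ((\<lambda>l. X (t, l)) has_derivative (\<lambda>v. Y v (t, l))) (at l within \<Lambda>)"
proof -
  have comp: "continuous_on ({0..1} \<times> \<Lambda>) (\<lambda>z. F' (fst z) (X z, snd z) v)" for v
    using continuous_on_compose2[OF cF'[of v], of "{0..1} \<times> \<Lambda>" "\<lambda>z. (fst z, X z, snd z)"] XR
    by (force intro!: continuous_intros cX)
  define a where "a i z = F' (fst z) (X z, snd z) (i, 0)" for i z
  have ca: "continuous_on ({0..1} \<times> \<Lambda>) (a i)" for i
    unfolding a_def by (rule comp)
  have lin: "linear (F' t w)" if "t \<in> {0..1}" "w \<in> R \<times> \<Lambda>" for t w
    using F'[OF that] has_derivative_linear by blast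
  have split: "F' t (X (t, l), l) (x, v) = (\<Sum>i\<in>Basis. (x \<bullet> i) *\<^sub>R a i (t, l)) + F' t (X (t, l), l) (0, v)"
    if "t \<in> {0..1}" "l \<in> \<Lambda>" for t l x v
  proof -
    have l: "linear (F' t (X (t, l), l))" using lin XR that by auto
    have "(x, v) = (\<Sum>i\<in>Basis. (x \<bullet> i) *\<^sub>R (i, 0)) + (0, v)"
      by (simp add: prod_eq_iff fst_sum snd_sum euclidean_representation)
    then show ?thesis
      by (simp add: a_def linear_add[OF l] linear_sum[OF l] linear_scale[OF l] del: scaleR_Pair)
  qed
  have "\<forall>v. \<exists>Y. \<forall>l\<in>\<Lambda>. Y (0, l) = \<iota>' l v \<and> (\<forall>t\<in>{0..1}. ((\<lambda>t. Y (t, l)) has_vector_derivative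
      (\<Sum>i\<in>Basis. (Y (t, l) \<bullet> i) *\<^sub>R a i (t, l)) + F' t (X (t, l), l) (0, v)) (at t within {0..1}))"
    using linear_ode_family_exists[OF ca comp] by simp
  from choice[OF this] obtain Y where
    "\<forall>v. \<forall>l\<in>\<Lambda>. Y v (0, l) = \<iota>' l v \<and> (\<forall>t\<in>{0..1}. ((\<lambda>t. Y v (t, l)) has_vector_derivative
      (\<Sum>i\<in>Basis. (Y v (t, l) \<bullet> i) *\<^sub>R a i (t, l)) + F' t (X (t, l), l) (0, v)) (at t within {0..1}))" ..
  then have Y: "\<And>l v. l \<in> \<Lambda> \<Longrightarrow> Y v (0, l) = \<iota>' l v"
    "\<And>l v t. l \<in> \<Lambda> \<Longrightarrow> t \<in> {0..1} \<Longrightarrow> ((\<lambda>t. Y v (t, l)) has_vector_derivative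
      (\<Sum>i\<in>Basis. (Y v (t, l) \<bullet> i) *\<^sub>R a i (t, l)) + F' t (X (t, l), l) (0, v)) (at t within {0..1})"
    by blast+
  have Y2: "((\<lambda>t. Y v (t, l)) has_vector_derivative F' t (X (t, l), l) (Y v (t, l), v)) (at t within {0..1})"
    if "t \<in> {0..1}" "l \<in> \<Lambda>" for v t l
    using Y(2)[OF that(2,1), of v] unfolding split[OF that, of "Y v (t, l)" v] .
  show ?thesis
    by (rule that[of Y, OF Y(1) Y2 ode_derivative_parameter[where F'=F' and \<iota>'=\<iota>', OF R \<Lambda> F'
        cF' sol XR cX init Y2 Y(1)]])
qed

text \<open>The derivative of the solution in a parameter solves a linear equation with the same matrix and a new
  inhomogeneity. The induction therefore never leaves the state space \<open>'b\<close>.\<close>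

lemma Ck_solution_linear_ode:
  fixes a :: "'b::euclidean_space \<Rightarrow> real \<times> 'c::euclidean_space \<Rightarrow> 'b"
  assumes \<Lambda>: "convex \<Lambda>"
  shows "(\<And>i. i \<in> Basis \<Longrightarrow> Ck_along spatial k (a i) ({0..1} \<times> \<Lambda>)) \<Longrightarrow>
    Ck_along spatial k \<beta> ({0..1} \<times> \<Lambda>) \<Longrightarrow> Ck_on k (\<lambda>l. y (0, l)) \<Lambda> \<Longrightarrow>
    (\<And>t l. t \<in> {0..1} \<Longrightarrow> l \<in> \<Lambda> \<Longrightarrow> ((\<lambda>t. y (t, l)) has_vector_derivative
        (\<Sum>i\<in>Basis. (y (t, l) \<bullet> i) *\<^sub>R a i (t, l)) + \<beta> (t, l)) (at t within {0..1})) \<Longrightarrow>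
    Ck_along spatial k y ({0..1} \<times> \<Lambda>)"
proof (induction k arbitrary: \<beta> y)
  case 0
  have ca: "continuous_on ({0..1} \<times> \<Lambda>) (a i)" if "i \<in> Basis" for i
    using 0(1)[OF that] by simp
  have c\<beta>: "continuous_on ({0..1} \<times> \<Lambda>) \<beta>" using 0(2) by simp
  define F where "F = (\<lambda>(t, x, l). (\<Sum>i\<in>Basis. (x \<bullet> i) *\<^sub>R a i (t, l)) + \<beta> (t, l))"
  have "continuous_on ({0..1} \<times> \<Lambda>) y"
  proof (rule ode_param_continuity[where F=F and R=UNIV])
    show "continuous_on ({0..1} \<times> UNIV \<times> \<Lambda>) F"
      unfolding F_def split_beta
      by (intro continuous_intros continuous_on_compose2[OF ca] continuous_on_compose2[OF c\<beta>]) auto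
    fix l1 assume l1: "l1 \<in> \<Lambda>"
    have "\<exists>K\<ge>0. \<exists>d>0. \<forall>l\<in>\<Lambda>. dist l l1 < d \<longrightarrow> (\<forall>t\<in>{0..1}. norm (a i (t, l)) \<le> K)"
      if i: "i \<in> Basis" for i
    proof -
      have cp: "compact ((\<lambda>t. (t, l1)) ` {0..1::real})"
        by (intro compact_continuous_image continuous_intros compact_Icc)
      obtain d where d: "0 < d" "\<And>x y. x \<in> (\<lambda>t. (t, l1)) ` {0..1} \<Longrightarrow>
          y \<in> {0..1} \<times> \<Lambda> \<Longrightarrow> dist y x < d \<Longrightarrow> dist (a i y) (a i x) < 1"
        using continuous_on_uniform_near_compact[OF ca[OF i] cp _ zero_less_one] l1 by blast
      have "continuous_on ((\<lambda>t. (t, l1)) ` {0..1::real}) (a i)"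
        by (rule continuous_on_subset[OF ca[OF i]]) (use l1 in auto)
      from compact_imp_bounded[OF compact_continuous_image[OF this cp]]
      obtain B where B: "\<And>t. t \<in> {0..1} \<Longrightarrow> norm (a i (t, l1)) \<le> B"
        unfolding bounded_iff by blast
      have "norm (a i (t, l)) \<le> B + 1" if "l \<in> \<Lambda>" "dist l l1 < d" "t \<in> {0..1}" for t l
      proof -
        have "norm (a i (t, l) - a i (t, l1)) < 1"
          using d(2)[of "(t, l1)" "(t, l)"] that by (auto simp: dist_norm dist_Pair_Pair)
        then show ?thesis
          using B[OF that(3)] norm_triangle_sub[of "a i (t, l)" "a i (t, l1)"] by linarith
      qed
      then show ?thesis
        using d(1) order_trans[OF norm_ge_zero B[of 0]] by (intro exI[of _ "B + 1"] conjI exI[of _ d]) auto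
    qed
    then obtain K d where K: "\<And>i. i \<in> Basis \<Longrightarrow> 0 \<le> K i" "\<And>i. i \<in> Basis \<Longrightarrow> 0 < d i"
      "\<And>i l t. i \<in> Basis \<Longrightarrow> l \<in> \<Lambda> \<Longrightarrow> dist l l1 < d i \<Longrightarrow> t \<in> {0..1} \<Longrightarrow> norm (a i (t, l)) \<le> K i"
      by metis
    define d0 where "d0 = Min (d ` Basis)"
    have d0: "0 < d0" "\<And>i. i \<in> Basis \<Longrightarrow> d0 \<le> d i"
      using K(2) by (auto simp: d0_def)
    show "\<exists>K\<ge>0. \<exists>d>0. \<forall>l\<in>\<Lambda>. dist l l1 < d \<longrightarrow> (\<forall>t\<in>{0..1}.
        norm (F (t, y (t, l), l) - F (t, y (t, l1), l)) \<le> K * norm (y (t, l) - y (t, l1)))"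
    proof (rule exI[of _ "\<Sum>i\<in>Basis. K i"], intro conjI, goal_cases)
      case 2
      show ?case
      proof (intro exI[of _ d0] conjI ballI impI)
      fix l and t :: real assume l: "l \<in> \<Lambda>" "dist l l1 < d0" and t: "t \<in> {0..1}"
      have "F (t, y (t, l), l) - F (t, y (t, l1), l)
          = (\<Sum>i\<in>Basis. ((y (t, l) - y (t, l1)) \<bullet> i) *\<^sub>R a i (t, l))"
        by (simp add: F_def inner_diff_left scaleR_diff_left sum_subtractf)
      also have "norm \<dots> \<le> (\<Sum>i\<in>Basis. norm (y (t, l) - y (t, l1)) * K i)"
        using K l t d0 Basis_le_norm
        by (intro sum_norm_le) (force intro!: mult_mono)
      finally show "norm (F (t, y (t, l), l) - F (t, y (t, l1), l))
          \<le> (\<Sum>i\<in>Basis. K i) * norm (y (t, l) - y (t, l1))"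
        by (simp add: sum_distrib_right mult.commute)
      qed (rule d0)
    qed (use K in \<open>auto intro: sum_nonneg\<close>)
  qed (use 0 in \<open>auto simp: F_def\<close>)
  then show ?case by simp
next
  case (Suc k)
  have y: "Ck_along spatial k y ({0..1} \<times> \<Lambda>)"
    by (rule Suc.IH[where \<beta>=\<beta>, OF Ck_along_Suc_D[OF Suc.prems(1)]
        Ck_along_Suc_D[OF Suc.prems(2)] Ck_along_Suc_D[OF Suc.prems(3)] Suc.prems(4)])
  have cy: "continuous_on ({0..1} \<times> \<Lambda>) y" by (rule Ck_along_continuous[OF y])
  have "\<forall>i\<in>Basis. \<exists>a'. (\<forall>t\<in>{0..1}. \<forall>l\<in>\<Lambda>. ((\<lambda>l. a i (t, l)) has_derivative a' t l) (at l within \<Lambda>)) \<and>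
      (\<forall>v. Ck_along spatial k (\<lambda>z. a' (fst z) (snd z) v) ({0..1} \<times> \<Lambda>))"
  proof
    fix i :: 'b assume i: "i \<in> Basis"
    show "\<exists>a'. (\<forall>t\<in>{0..1}. \<forall>l\<in>\<Lambda>. ((\<lambda>l. a i (t, l)) has_derivative a' t l) (at l within \<Lambda>)) \<and>
      (\<forall>v. Ck_along spatial k (\<lambda>z. a' (fst z) (snd z) v) ({0..1} \<times> \<Lambda>))"
      by (rule Ck_spatial_SucE[OF Suc.prems(1)[OF i]]) blast
  qed
  from bchoice[OF this] obtain a' where
    "\<forall>i\<in>Basis. (\<forall>t\<in>{0..1}. \<forall>l\<in>\<Lambda>. ((\<lambda>l. a i (t, l)) has_derivative a' i t l) (at l within \<Lambda>)) \<and>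
      (\<forall>v. Ck_along spatial k (\<lambda>z. a' i (fst z) (snd z) v) ({0..1} \<times> \<Lambda>))" ..
  then have a': "\<And>i t l. i \<in> Basis \<Longrightarrow> t \<in> {0..1} \<Longrightarrow> l \<in> \<Lambda> \<Longrightarrow>
        ((\<lambda>l. a i (t, l)) has_derivative a' i t l) (at l within \<Lambda>)"
    "\<And>i v. i \<in> Basis \<Longrightarrow> Ck_along spatial k (\<lambda>z. a' i (fst z) (snd z) v) ({0..1} \<times> \<Lambda>)"
    by blast+
  obtain \<beta>' where \<beta>': "\<And>t l. t \<in> {0..1} \<Longrightarrow> l \<in> \<Lambda> \<Longrightarrow>
        ((\<lambda>l. \<beta> (t, l)) has_derivative \<beta>' t l) (at l within \<Lambda>)"
    "\<And>v. Ck_along spatial k (\<lambda>z. \<beta>' (fst z) (snd z) v) ({0..1} \<times> \<Lambda>)"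
    using Suc.prems(2) by (rule Ck_spatial_SucE) blast
  obtain y0' where y0': "\<And>l. l \<in> \<Lambda> \<Longrightarrow> ((\<lambda>l. y (0, l)) has_derivative y0' l) (at l within \<Lambda>)"
    "\<And>v. Ck_on k (\<lambda>l. y0' l v) \<Lambda>"
    using Suc.prems(3) by (auto elim!: Ck_along_SucE)
  define F where "F = (\<lambda>(t, x, l). (\<Sum>i\<in>Basis. (x \<bullet> i) *\<^sub>R a i (t, l)) + \<beta> (t, l))"
  define F' where "F' t w = (\<lambda>v. (\<Sum>i\<in>Basis. (fst w \<bullet> i) *\<^sub>R a' i t (snd w) (snd v)
      + (fst v \<bullet> i) *\<^sub>R a i (t, snd w)) + \<beta>' t (snd w) (snd v))" for t w
  have Fder: "((\<lambda>w. F (t, w)) has_derivative F' t w) (at w within UNIV \<times> \<Lambda>)"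
    if t: "t \<in> {0..1}" and w: "w \<in> UNIV \<times> \<Lambda>" for t w
  proof -
    have s: "snd ` (UNIV \<times> \<Lambda>) = \<Lambda>" by force
    have d1: "((\<lambda>w. a i (t, snd w)) has_derivative (\<lambda>v. a' i t (snd w) (snd v))) (at w within UNIV \<times> \<Lambda>)"
      if "i \<in> Basis" for i
      by (rule has_derivative_in_compose[where f=snd and g="\<lambda>l. a i (t, l)"])
        (use a'(1)[OF that t] w in \<open>auto simp: s intro!: derivative_eq_intros\<close>)
    have d2: "((\<lambda>w. \<beta> (t, snd w)) has_derivative (\<lambda>v. \<beta>' t (snd w) (snd v))) (at w within UNIV \<times> \<Lambda>)"
      by (rule has_derivative_in_compose[where f=snd and g="\<lambda>l. \<beta> (t, l)"])
        (use \<beta>'(1)[OF t] w in \<open>auto simp: s intro!: derivative_eq_intros\<close>)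
    have "((\<lambda>w. (\<Sum>i\<in>Basis. (fst w \<bullet> i) *\<^sub>R a i (t, snd w)) + \<beta> (t, snd w)) has_derivative
        (\<lambda>v. (\<Sum>i\<in>Basis. (fst w \<bullet> i) *\<^sub>R a' i t (snd w) (snd v) + (fst v \<bullet> i) *\<^sub>R a i (t, snd w))
          + \<beta>' t (snd w) (snd v))) (at w within UNIV \<times> \<Lambda>)"
      by (intro has_derivative_add has_derivative_sum has_derivative_scaleR d1 d2)
        (auto intro!: derivative_eq_intros)
    then show ?thesis by (simp add: F_def F'_def split_beta)
  qed
  have \<beta>v: "Ck_along spatial k (\<lambda>z. (\<Sum>i\<in>Basis. (y z \<bullet> i) *\<^sub>R a' i (fst z) (snd z) v)
      + \<beta>' (fst z) (snd z) v) ({0..1} \<times> \<Lambda>)" for v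
    by (intro Ck_along_add Ck_along_sum Ck_along_scaleR Ck_along_inner Ck_along_const y a' \<beta>')
  have ca: "continuous_on ({0..1} \<times> \<Lambda>) (a i)" if "i \<in> Basis" for i
    using Suc.prems(1)[OF that] by simp
  obtain Y where Y: "\<And>v l. l \<in> \<Lambda> \<Longrightarrow> Y v (0, l) = y0' l v"
    "\<And>v t l. t \<in> {0..1} \<Longrightarrow> l \<in> \<Lambda> \<Longrightarrow>
      ((\<lambda>t. Y v (t, l)) has_vector_derivative F' t (y (t, l), l) (Y v (t, l), v)) (at t within {0..1})"
    and der: "\<And>t l. t \<in> {0..1} \<Longrightarrow> l \<in> \<Lambda> \<Longrightarrow>
      ((\<lambda>l. y (t, l)) has_derivative (\<lambda>v. Y v (t, l))) (at l within \<Lambda>)"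
  proof (rule ode_variational_equation[where R=UNIV and F=F and F'=F' and \<iota>'=y0' and X=y, OF _ \<Lambda>], goal_cases)
    case (3 v)
    show ?case
      unfolding F'_def split_beta
      by (intro continuous_intros continuous_on_compose2[OF ca]
        continuous_on_compose2[OF Ck_along_continuous[OF a'(2)], of _ _ "\<lambda>z. (fst z, snd (snd z))", simplified]
        continuous_on_compose2[OF Ck_along_continuous[OF \<beta>'(2)], of _ "\<lambda>z. (fst z, snd (snd z))", simplified]) auto
  next
    case (8 Y)
    then show ?case by (intro 8(1)[of Y])
  qed (use Fder Suc.prems(4) cy y0'(1) in \<open>auto simp: F_def\<close>)
  have YC: "Ck_along spatial k (Y v) ({0..1} \<times> \<Lambda>)" for v
  proof (rule Suc.IH[OF Ck_along_Suc_D[OF Suc.prems(1)] \<beta>v[of v]])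
    show "Ck_on k (\<lambda>l. Y v (0, l)) \<Lambda>"
      using y0'(2)[of v] by (rule Ck_along_cong[THEN iffD2, rotated]) (rule Y(1))
    show "((\<lambda>t. Y v (t, l)) has_vector_derivative (\<Sum>i\<in>Basis. (Y v (t, l) \<bullet> i) *\<^sub>R a i (t, l)) +
        ((\<Sum>i\<in>Basis. (y (t, l) \<bullet> i) *\<^sub>R a' i (fst (t, l)) (snd (t, l)) v)
          + \<beta>' (fst (t, l)) (snd (t, l)) v)) (at t within {0..1})"
      if "t \<in> {0..1}" "l \<in> \<Lambda>" for t l
      using Y(2)[OF that, of v] by (simp add: F'_def sum.distrib algebra_simps)
  qed
  show ?case
    by (rule Ck_spatial_SucI[where F'="\<lambda>t l v. Y v (t, l)"]) (use der YC cy in auto)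
qed

text \<open>If the solution is \<open>k\<close> times differentiable, then so are the coefficients of its variational equation, hence
  also the solutions of the latter, which are the first derivatives.\<close>

theorem Ck_solution_ode:
  fixes F :: "real \<times> 'b::euclidean_space \<times> 'c::euclidean_space \<Rightarrow> 'b"
  assumes R: "open R" and \<Lambda>: "convex \<Lambda>"
    and sol: "\<And>t l. t \<in> {0..1} \<Longrightarrow> l \<in> \<Lambda> \<Longrightarrow>
        ((\<lambda>t. X (t, l)) has_vector_derivative F (t, X (t, l), l)) (at t within {0..1})"
    and XR: "\<And>t l. t \<in> {0..1} \<Longrightarrow> l \<in> \<Lambda> \<Longrightarrow> X (t, l) \<in> R"
    and cX: "continuous_on ({0..1} \<times> \<Lambda>) X"
  shows "Ck_along spatial k F ({0..1} \<times> R \<times> \<Lambda>) \<Longrightarrow> Ck_on k (\<lambda>l. X (0, l)) \<Lambda> \<Longrightarrow>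
    Ck_along spatial k X ({0..1} \<times> \<Lambda>)"
proof (induction k)
  case 0
  then show ?case using cX by simp
next
  case (Suc k)
  have X: "Ck_along spatial k X ({0..1} \<times> \<Lambda>)"
    by (rule Suc.IH[OF Ck_along_Suc_D[OF Suc.prems(1)] Ck_along_Suc_D[OF Suc.prems(2)]])
  obtain F' where F': "\<And>t w. t \<in> {0..1} \<Longrightarrow> w \<in> R \<times> \<Lambda> \<Longrightarrow>
        ((\<lambda>w. F (t, w)) has_derivative F' t w) (at w within R \<times> \<Lambda>)"
    "\<And>v. Ck_along spatial k (\<lambda>z. F' (fst z) (snd z) v) ({0..1} \<times> R \<times> \<Lambda>)"
    using Suc.prems(1) by (rule Ck_spatial_SucE) blast
  obtain x0' where x0': "\<And>l. l \<in> \<Lambda> \<Longrightarrow> ((\<lambda>l. X (0, l)) has_derivative x0' l) (at l within \<Lambda>)"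
    "\<And>v. Ck_on k (\<lambda>l. x0' l v) \<Lambda>"
    using Suc.prems(2) by (auto elim!: Ck_along_SucE)
  have "Ck_along spatial k (\<lambda>z. (\<lambda>z. F' (fst z) (snd z) v) (fst z, (X z, snd z))) ({0..1} \<times> \<Lambda>)" for v
    by (rule Ck_spatial_compose[OF F'(2)])
      (auto intro!: Ck_along_Pair X Ck_along_snd Ck_along_id XR)
  then have comp: "Ck_along spatial k (\<lambda>z. F' (fst z) (X z, snd z) v) ({0..1} \<times> \<Lambda>)" for v
    by simp
  define a where "a i z = F' (fst z) (X z, snd z) (i, 0)" for i z
  have aC: "Ck_along spatial k (a i) ({0..1} \<times> \<Lambda>)" for i
    unfolding a_def by (rule comp)
  have ca: "continuous_on ({0..1} \<times> \<Lambda>) (a i)" for i by (rule Ck_along_continuous[OF aC])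
  have lin: "linear (F' t w)" if "t \<in> {0..1}" "w \<in> R \<times> \<Lambda>" for t w
    using F'(1)[OF that] has_derivative_linear by blast
  have split: "F' t (X (t, l), l) (x, v) = (\<Sum>i\<in>Basis. (x \<bullet> i) *\<^sub>R a i (t, l)) + F' t (X (t, l), l) (0, v)"
    if "t \<in> {0..1}" "l \<in> \<Lambda>" for t l x v
  proof -
    have l: "linear (F' t (X (t, l), l))" using lin XR that by auto
    have "(x, v) = (\<Sum>i\<in>Basis. (x \<bullet> i) *\<^sub>R (i, 0)) + (0, v)"
      by (simp add: prod_eq_iff fst_sum snd_sum euclidean_representation)
    then show ?thesis
      by (simp add: a_def linear_add[OF l] linear_sum[OF l] linear_scale[OF l] del: scaleR_Pair)
  qed
  obtain Y where Y: "\<And>v l. l \<in> \<Lambda> \<Longrightarrow> Y v (0, l) = x0' l v"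
    "\<And>v t l. t \<in> {0..1} \<Longrightarrow> l \<in> \<Lambda> \<Longrightarrow>
      ((\<lambda>t. Y v (t, l)) has_vector_derivative F' t (X (t, l), l) (Y v (t, l), v)) (at t within {0..1})"
    and der: "\<And>t l. t \<in> {0..1} \<Longrightarrow> l \<in> \<Lambda> \<Longrightarrow>
      ((\<lambda>l. X (t, l)) has_derivative (\<lambda>v. Y v (t, l))) (at l within \<Lambda>)"
    by (rule ode_variational_equation[where F'=F' and \<iota>'=x0', OF R \<Lambda> F'(1)
        Ck_along_continuous[OF F'(2)] sol XR cX x0'(1)]) (assumption | rule that)+
  have YC: "Ck_along spatial k (Y v) ({0..1} \<times> \<Lambda>)" for v
  proof (rule Ck_solution_linear_ode[where a=a, OF \<Lambda> aC comp[of "(0, v)"]])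
    show "Ck_on k (\<lambda>l. Y v (0, l)) \<Lambda>"
      using x0'(2)[of v] by (rule Ck_along_cong[THEN iffD2, rotated]) (rule Y(1))
    show "((\<lambda>t. Y v (t, l)) has_vector_derivative (\<Sum>i\<in>Basis. (Y v (t, l) \<bullet> i) *\<^sub>R a i (t, l)) +
        F' (fst (t, l)) (X (t, l), snd (t, l)) (0, v)) (at t within {0..1})"
      if "t \<in> {0..1}" "l \<in> \<Lambda>" for t l
      using Y(2)[OF that, of v] unfolding split[OF that, of "Y v (t, l)" v] by simp
  qed
  show ?case
    by (rule Ck_spatial_SucI[where F'="\<lambda>t l v. Y v (t, l)"]) (use der YC cX in auto)
qed

section \<open>Solutions near a reference solution\<close>

text \<open>The right-hand side is defined and Lipschitz only near the reference solution. Projecting the deviation from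
  \<open>x0\<close> onto a small ball gives a globally Lipschitz equation. For parameters near \<open>l0\<close> the deviation stays
  inside that ball, where the projection does nothing.\<close>

theorem ode_local_flow:
  fixes F :: "real \<times> 'b::euclidean_space \<times> 'c::euclidean_space \<Rightarrow> 'b"
  assumes R: "open R" and F: "Ck_along spatial 1 F ({0..1} \<times> R \<times> \<Lambda>)"
    and x0: "\<And>t. t \<in> {0..1} \<Longrightarrow> (x0 has_vector_derivative F (t, x0 t, l0)) (at t within {0..1})"
    and x0R: "\<And>t. t \<in> {0..1} \<Longrightarrow> x0 t \<in> R" and l0: "l0 \<in> \<Lambda>"
    and \<iota>: "continuous_on \<Lambda> \<iota>" "\<iota> l0 = x0 0"
  obtains \<rho> X where "0 < \<rho>"
    "\<And>t l. t \<in> {0..1} \<Longrightarrow> l \<in> \<Lambda> \<inter> ball l0 \<rho> \<Longrightarrow>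
      ((\<lambda>t. X (t, l)) has_vector_derivative F (t, X (t, l), l)) (at t within {0..1})"
    "\<And>t l. t \<in> {0..1} \<Longrightarrow> l \<in> \<Lambda> \<inter> ball l0 \<rho> \<Longrightarrow> X (t, l) \<in> R"
    "\<And>l. l \<in> \<Lambda> \<inter> ball l0 \<rho> \<Longrightarrow> X (0, l) = \<iota> l"
    "continuous_on ({0..1} \<times> (\<Lambda> \<inter> ball l0 \<rho>)) X"
    "\<And>t. t \<in> {0..1} \<Longrightarrow> X (t, l0) = x0 t"
proof -
  have cF: "continuous_on ({0..1} \<times> R \<times> \<Lambda>) F" by (rule Ck_along_continuous[OF F])
  obtain F' where F': "\<And>t w. t \<in> {0..1} \<Longrightarrow> w \<in> R \<times> \<Lambda> \<Longrightarrow>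
        ((\<lambda>w. F (t, w)) has_derivative F' t w) (at w within R \<times> \<Lambda>)"
    "\<And>v. Ck_along spatial 0 (\<lambda>z. F' (fst z) (snd z) v) ({0..1} \<times> R \<times> \<Lambda>)"
    using F unfolding One_nat_def by (rule Ck_spatial_SucE) blast
  obtain DF where DF: "\<And>t w. t \<in> {0..1} \<Longrightarrow> w \<in> R \<times> \<Lambda> \<Longrightarrow> blinfun_apply (DF (t, w)) = F' t w"
    and cDF: "continuous_on ({0..1} \<times> R \<times> \<Lambda>) DF"
    using blinfun_derivative[OF F'(1) Ck_along_continuous[OF F'(2)]] by blast
  have cx: "continuous_on {0..1} x0" by (rule continuous_on_vector_derivative[OF x0])
  define z where "z t = (t, x0 t, l0)" for t
  have z: "z t \<in> {0..1} \<times> R \<times> \<Lambda>" if "t \<in> {0..1}" for t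
    using x0R that l0 by (auto simp: z_def)
  have cz: "compact (z ` {0..1})"
    unfolding z_def by (rule compact_graph[OF cx])
  have zs: "z ` {0..1} \<subseteq> {0..1} \<times> R \<times> \<Lambda>" by (rule image_subsetI) (rule z)
  have "bounded (DF ` z ` {0..1})"
    by (rule compact_imp_bounded[OF compact_continuous_image[OF continuous_on_subset[OF cDF zs] cz]])
  then obtain K1 where K1: "\<And>t. t \<in> {0..1} \<Longrightarrow> norm (DF (z t)) \<le> K1"
    unfolding bounded_iff by blast
  define K where "K = K1 + 1"
  have K: "0 \<le> K" using order_trans[OF norm_ge_zero K1[of 0]] by (simp add: K_def)
  obtain d1 where d1: "0 < d1" "\<And>x y. x \<in> z ` {0..1} \<Longrightarrow>
      y \<in> {0..1} \<times> R \<times> \<Lambda> \<Longrightarrow> dist y x < d1 \<Longrightarrow> dist (DF y) (DF x) < 1"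
    using continuous_on_uniform_near_compact[OF cDF cz zs zero_less_one] by blast
  obtain r0 where r0: "0 < r0" "(\<Union>x\<in>x0 ` {0..1}. ball x r0) \<subseteq> R"
    by (rule compact_subset_open_imp_ball_epsilon_subset[OF
          compact_continuous_image[OF cx compact_Icc] R]) (use x0R in auto)
  define \<delta> where "\<delta> = min (r0 / 2) (d1 / 3)"
  have \<delta>: "0 < \<delta>" "\<delta> < r0" "2 * \<delta> < d1" using r0 d1 by (auto simp: \<delta>_def)
  have tube: "cball (x0 t) \<delta> \<subseteq> R" if "t \<in> {0..1}" for t
    using r0(2) \<delta>(2) that by fastforce
  have lip: "norm (F (t, x, l) - F (t, y, l)) \<le> K * norm (x - y)"
    if t: "t \<in> {0..1}" and l: "l \<in> \<Lambda>" "dist l l0 < \<delta>" and xy: "x \<in> cball (x0 t) \<delta>" "y \<in> cball (x0 t) \<delta>"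
    for t l x y
  proof -
    define S where "S = cball (x0 t) \<delta> \<times> {l}"
    have SR: "S \<subseteq> R \<times> \<Lambda>" using tube[OF t] l by (auto simp: S_def)
    have "norm (F (t, (x, l)) - F (t, (y, l))) \<le> K * norm ((x, l) - (y, l))"
    proof (rule differentiable_bound[where S=S and f="\<lambda>w. F (t, w)" and f'="F' t"])
      show "convex S" unfolding S_def by (intro convex_Times convex_cball convex_singleton)
      show "((\<lambda>w. F (t, w)) has_derivative F' t w) (at w within S)" if "w \<in> S" for w
        using F'(1)[OF t, of w] that SR by (auto intro: has_derivative_subset)
      show "onorm (F' t w) \<le> K" if w: "w \<in> S" for w
      proof -
        have "dist (fst w) (x0 t) \<le> \<delta>" "dist (snd w) l0 < \<delta>"
          using w l by (auto simp: S_def dist_commute)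
        then have "dist w (x0 t, l0) < d1"
          using sqrt_sum_squares_le_sum[of "dist (fst w) (x0 t)" "dist (snd w) l0"] \<delta>
          by (auto simp: dist_prod_def)
        then have "dist (DF (t, w)) (DF (z t)) < 1"
          using d1(2)[of "z t" "(t, w)"] t w SR by (auto simp: z_def dist_Pair_Pair)
        then have "norm (DF (t, w)) \<le> K"
          using K1[OF t] norm_triangle_sub[of "DF (t, w)" "DF (z t)"] by (auto simp: K_def dist_norm)
        then show ?thesis
          using DF[OF t, of w] w SR by (auto simp: norm_blinfun.rep_eq)
      qed
    qed (use xy in \<open>auto simp: S_def\<close>)
    then show ?thesis by (simp add: norm_Pair)
  qed
  \<comment> \<open>A defect of size \<open>c\<close> leads to a deviation below \<open>\<delta>\<close> by \<open>gronwall_linear\<close>.\<close>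
  define c where "c = \<delta> / (4 * exp (2 * K + 1))"
  have c: "0 < c" "2 * c * exp (2 * K + 1) < \<delta>" using \<delta> by (auto simp: c_def)
  obtain d2 where d2: "0 < d2" "\<And>x y. x \<in> z ` {0..1} \<Longrightarrow>
      y \<in> {0..1} \<times> R \<times> \<Lambda> \<Longrightarrow> dist y x < d2 \<Longrightarrow> dist (F y) (F x) < c"
    using continuous_on_uniform_near_compact[OF cF cz zs c(1)] by blast
  obtain d3 where d3: "0 < d3" "\<And>l. l \<in> \<Lambda> \<Longrightarrow> dist l l0 < d3 \<Longrightarrow> dist (\<iota> l) (\<iota> l0) < c"
    using \<iota>(1) l0 c(1) unfolding continuous_on_iff by blast
  define \<rho> where "\<rho> = min \<delta> (min d2 d3)"
  have \<rho>: "0 < \<rho>" "\<rho> \<le> \<delta>" "\<rho> \<le> d2" "\<rho> \<le> d3" using \<delta> d2 d3 by (auto simp: \<rho>_def)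
  define \<Lambda>' where "\<Lambda>' = \<Lambda> \<inter> ball l0 \<rho>"
  have \<Lambda>': "l \<in> \<Lambda>" "dist l l0 < \<rho>" if "l \<in> \<Lambda>'" for l
    using that by (auto simp: \<Lambda>'_def dist_commute)
  define pj where "pj = closest_point (cball (0::'b) \<delta>)"
  have pj: "dist (pj x) (pj y) \<le> dist x y" for x y
    unfolding pj_def by (rule closest_point_lipschitz) (use \<delta> in auto)
  have pj_in: "pj x \<in> cball 0 \<delta>" for x
    unfolding pj_def by (rule closest_point_in_set) (use \<delta> in auto)
  have pj_id: "pj x = x" if "norm x \<le> \<delta>" for x
    unfolding pj_def by (rule closest_point_self) (use that in auto)
  have pjn: "norm (pj x) \<le> norm x" for x
    using pj[of x 0] pj_id[of 0] \<delta> by (simp add: dist_norm)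
  define H where "H l t x = F (t, x0 t + pj x, l) - F (t, x0 t, l0)" for l t x
  have inball: "x0 t + pj x \<in> cball (x0 t) \<delta>" for t x
    using pj_in[of x] by (simp add: dist_norm)
  have small: "norm (F (t, x0 t, l) - F (t, x0 t, l0)) \<le> (if l = l0 then 0 else c)"
    if "l \<in> \<Lambda>'" "t \<in> {0..1}" for l t
    using d2(2)[of "z t" "(t, x0 t, l)"] \<Lambda>'[OF that(1)] that(2) \<rho> x0R[OF that(2)]
    by (auto simp: dist_norm z_def dist_Pair_Pair)
  have Hb: "norm (H l t x) \<le> K * norm x + (if l = l0 then 0 else c)" if "l \<in> \<Lambda>'" "t \<in> {0..1}" for l t x
  proof -
    have "norm (F (t, x0 t + pj x, l) - F (t, x0 t, l)) \<le> K * norm (x0 t + pj x - x0 t)"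
      using \<Lambda>'[OF that(1)] \<rho> \<delta> by (intro lip[OF that(2)] inball) auto
    also have "\<dots> \<le> K * norm x" using K pjn by (simp add: mult_left_mono)
    finally show ?thesis
      using norm_triangle_mono[OF _ small[OF that]] unfolding H_def by fastforce
  qed
  have "\<exists>y. y 0 = \<iota> l - x0 0 \<and> (\<forall>t\<in>{0..1}. (y has_vector_derivative H l t (y t)) (at t within {0..1}))"
    if l: "l \<in> \<Lambda>'" for l
  proof (rule picard_global[of 1 "H l" K "\<iota> l - x0 0"])
    have cp: "continuous_on A pj" for A
      unfolding pj_def by (rule continuous_on_closest_point) (use \<delta> in auto)
    show "continuous_on ({0..1} \<times> UNIV) (\<lambda>(t, x). H l t x)"
      unfolding H_def split_beta
      using subsetD[OF tube inball] \<Lambda>'[OF l] l0 x0R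
      by (intro continuous_intros continuous_on_compose2[OF cF] continuous_on_compose2[OF cx]
         continuous_on_compose2[OF cp[of UNIV]]) auto
    show "norm (H l t x - H l t y) \<le> K * norm (x - y)" if "t \<in> {0..1}" for t x y
    proof -
      have "norm (H l t x - H l t y) \<le> K * norm ((x0 t + pj x) - (x0 t + pj y))"
        unfolding H_def using lip[OF that _ _ inball inball, of l x y] \<Lambda>'[OF l] \<rho> by simp
      also have "\<dots> \<le> K * norm (x - y)"
        using pj[of x y] K by (simp add: dist_norm mult_left_mono)
      finally show ?thesis .
    qed
  qed auto
  then have "\<forall>l\<in>\<Lambda>'. \<exists>y. y 0 = \<iota> l - x0 0 \<and>
      (\<forall>t\<in>{0..1}. (y has_vector_derivative H l t (y t)) (at t within {0..1}))" by blast
  from bchoice[OF this] obtain Y where "\<forall>l\<in>\<Lambda>'. Y l 0 = \<iota> l - x0 0 \<and>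
      (\<forall>t\<in>{0..1}. (Y l has_vector_derivative H l t (Y l t)) (at t within {0..1}))" ..
  then have Y: "\<And>l. l \<in> \<Lambda>' \<Longrightarrow> Y l 0 = \<iota> l - x0 0"
    "\<And>l t. l \<in> \<Lambda>' \<Longrightarrow> t \<in> {0..1} \<Longrightarrow> (Y l has_vector_derivative H l t (Y l t)) (at t within {0..1})"
    by blast+
  have Ysmall: "norm (Y l t) < \<delta>" if l: "l \<in> \<Lambda>'" and t: "t \<in> {0..1}" for l t
  proof -
    have "norm (Y l t) \<le> 2 * c * exp (2 * K + 1)"
    proof (rule gronwall_linear[OF Y(2)[OF l] _ K _ t])
      show "norm (H l t (Y l t)) \<le> K * norm (Y l t) + c" if "t \<in> {0..1}" for t
        using Hb[OF l that, of "Y l t"] c(1) by (auto split: if_splits)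
      show "norm (Y l 0) \<le> c"
        using d3(2)[of l] \<Lambda>'[OF l] \<rho> by (simp add: Y(1)[OF l] \<iota>(2) dist_norm)
    qed
    then show ?thesis using c by linarith
  qed
  define X where "X z = x0 (fst z) + Y (snd z) (fst z)" for z
  have sol: "((\<lambda>t. X (t, l)) has_vector_derivative F (t, X (t, l), l)) (at t within {0..1})"
    if l: "l \<in> \<Lambda>'" and t: "t \<in> {0..1}" for l t
  proof -
    have "((\<lambda>t. x0 t + Y l t) has_vector_derivative F (t, x0 t, l0) + H l t (Y l t)) (at t within {0..1})"
      by (intro has_vector_derivative_add x0 Y(2) l t)
    moreover have "pj (Y l t) = Y l t" using Ysmall[OF l t] by (intro pj_id) simp
    ultimately show ?thesis by (simp add: X_def H_def)
  qed
  have Xball: "X (t, l) \<in> cball (x0 t) \<delta>" if "l \<in> \<Lambda>'" "t \<in> {0..1}" for l t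
    using Ysmall[OF that] by (simp add: X_def dist_norm)
  have X0: "X (0, l) = \<iota> l" if "l \<in> \<Lambda>'" for l
    using Y(1)[OF that] by (simp add: X_def)
  have l0': "l0 \<in> \<Lambda>'" using l0 \<rho> by (simp add: \<Lambda>'_def)
  have cX: "continuous_on ({0..1} \<times> \<Lambda>') X"
  proof (rule ode_param_continuity[where F=F and R=R])
    show "continuous_on ({0..1} \<times> R \<times> \<Lambda>') F"
      by (rule continuous_on_subset[OF cF]) (auto simp: \<Lambda>'_def)
    show "continuous_on \<Lambda>' (\<lambda>l. X (0, l))"
      using continuous_on_subset[OF \<iota>(1), of \<Lambda>'] X0 \<Lambda>'(1)
      by (subst continuous_on_cong[OF refl X0]) auto
    fix l1 assume l1: "l1 \<in> \<Lambda>'"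
    have "norm (F (t, X (t, l), l) - F (t, X (t, l1), l)) \<le> K * norm (X (t, l) - X (t, l1))"
      if "l \<in> \<Lambda>'" "t \<in> {0..1}" for l t
      using \<Lambda>'[OF that(1)] \<rho> by (intro lip that Xball l1) auto
    then show "\<exists>K\<ge>0. \<exists>d>0. \<forall>l\<in>\<Lambda>'. dist l l1 < d \<longrightarrow> (\<forall>t\<in>{0..1}.
        norm (F (t, X (t, l), l) - F (t, X (t, l1), l)) \<le> K * norm (X (t, l) - X (t, l1)))"
      using K zero_less_one by blast
  qed (use sol Xball tube in blast)+
  have "Y l0 t = 0" if "t \<in> {0..1}" for t
  proof (rule gronwall_zero[OF Y(2)[OF l0'] _ K _ that])
    show "norm (H l0 t (Y l0 t)) \<le> K * norm (Y l0 t)" if "t \<in> {0..1}" for t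
      using Hb[OF l0' that, of "Y l0 t"] by simp
  qed (use Y(1)[OF l0'] \<iota>(2) in auto)
  then have "X (t, l0) = x0 t" if "t \<in> {0..1}" for t
    using that by (simp add: X_def)
  then show ?thesis
    using that[of \<rho> X, folded \<Lambda>'_def] sol Xball tube X0 cX \<rho>(1) by blast
qed

section \<open>Implicit curves with a one-sided parameter\<close>

lemma has_vector_derivative_quotient:
  "(f has_vector_derivative D) (at x within S) \<longleftrightarrow>
    ((\<lambda>y. (f y - f x) /\<^sub>R (y - x)) \<longlongrightarrow> D) (at x within S)"
proof -
  have eq: "norm ((f y - f x) - (y - x) *\<^sub>R D) / norm (y - x) = norm ((f y - f x) /\<^sub>R (y - x) - D)"
    if "y \<noteq> x" for y
  proof -
    have "(f y - f x) /\<^sub>R (y - x) - D = ((f y - f x) - (y - x) *\<^sub>R D) /\<^sub>R (y - x)"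
      using that by (simp add: scaleR_diff_right)
    then show ?thesis by (simp add: divide_inverse_commute)
  qed
  have "(f has_vector_derivative D) (at x within S) \<longleftrightarrow>
      ((\<lambda>y. norm ((f y - f x) - (y - x) *\<^sub>R D) / norm (y - x)) \<longlongrightarrow> 0) (at x within S)"
    by (simp add: has_vector_derivative_def has_derivative_iff_norm bounded_linear_scaleR_left)
  also have "\<dots> \<longleftrightarrow> ((\<lambda>y. norm ((f y - f x) /\<^sub>R (y - x) - D)) \<longlongrightarrow> 0) (at x within S)"
    by (intro filterlim_cong refl) (unfold eventually_at_filter, intro always_eventually allI impI eq)
  also have "\<dots> \<longleftrightarrow> ((\<lambda>y. (f y - f x) /\<^sub>R (y - x)) \<longlongrightarrow> D) (at x within S)"
    by (simp add: tendsto_norm_zero_iff LIM_zero_iff)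
  finally show ?thesis .
qed

lemma Ck_on_real_SucE:
  fixes f :: "real \<Rightarrow> 'b::real_normed_vector"
  assumes "Ck_on (Suc k) f S"
  obtains f' where "\<And>s. s \<in> S \<Longrightarrow> (f has_vector_derivative f' s) (at s within S)"
    "Ck_on k f' S"
proof -
  obtain f' where f': "\<And>x. x \<in> S \<Longrightarrow> (f has_derivative f' x) (at x within S)"
    "\<And>v. Ck_on k (\<lambda>x. f' x v) S"
    using assms by (auto elim!: Ck_along_SucE)
  have "(f has_vector_derivative f' s 1) (at s within S)" if "s \<in> S" for s
  proof -
    have "f' s v = v *\<^sub>R f' s 1" for v
      using linear_scale[OF has_derivative_linear[OF f'(1)[OF that]], of v 1] by simp
    then have "f' s = (\<lambda>v. v *\<^sub>R f' s 1)" by blast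
    then show ?thesis
      using f'(1)[OF that] by (simp add: has_vector_derivative_def)
  qed
  then show ?thesis using that[OF _ f'(2)[of 1]] by blast
qed

lemma Ck_on_real_SucI:
  fixes f :: "real \<Rightarrow> 'b::real_normed_vector"
  assumes "\<And>s. s \<in> S \<Longrightarrow> (f has_vector_derivative f' s) (at s within S)" "Ck_on k f' S"
  shows "Ck_on (Suc k) f S"
proof (rule Ck_along_SucI[where f'="\<lambda>s v. v *\<^sub>R f' s"])
  show "continuous_on S f" by (rule continuous_on_vector_derivative[OF assms(1)])
qed (use assms in \<open>auto simp: has_vector_derivative_def intro: Ck_along_scaleR\<close>)

text \<open>Differentiating \<open>A w = b\<close> gives \<open>A w' = b' - A' w\<close>, an equation with the same matrix. Induction on the order
  thus replaces an argument about the smoothness of matrix inversion.\<close>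

lemma Ck_on_linear_equation:
  fixes a :: "'y::euclidean_space \<Rightarrow> real \<Rightarrow> 'y"
  assumes inj: "\<And>s v. s \<in> S \<Longrightarrow> (\<Sum>i\<in>Basis. (v \<bullet> i) *\<^sub>R a i s) = 0 \<Longrightarrow> v = 0"
  shows "(\<And>i. i \<in> Basis \<Longrightarrow> Ck_on k (a i) S) \<Longrightarrow> Ck_on k b S \<Longrightarrow>
    (\<And>s. s \<in> S \<Longrightarrow> (\<Sum>i\<in>Basis. (w s \<bullet> i) *\<^sub>R a i s) = b s) \<Longrightarrow> Ck_on k w S"
proof (induction k arbitrary: b w)
  case (0 b w)
  define A where "A s v = (\<Sum>i\<in>Basis. (v \<bullet> i) *\<^sub>R a i s)" for s v
  have lin: "linear (A s)" for s
    unfolding A_def by (intro linearI)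
      (simp_all add: inner_add_left scaleR_add_left sum.distrib scaleR_sum_right)
  have "(w \<longlongrightarrow> w s) (at s within S)" if s: "s \<in> S" for s
  proof -
    have "inj (A s)"
      using inj[OF s] linear_injective_0[OF lin] by (auto simp: A_def)
    then obtain R where R: "linear R" "R \<circ> A s = id"
      using linear_injective_left_inverse[OF lin] by auto
    obtain C where C: "0 < C" "\<And>x. norm (R x) \<le> C * norm x"
      using linear_bounded_pos[OF R(1)] by (metis mult.commute)
    define \<alpha> where "\<alpha> s' = (\<Sum>i\<in>Basis. norm (a i s' - a i s))" for s'
    have "(\<alpha> \<longlongrightarrow> (\<Sum>i\<in>Basis. norm (a i s - a i s))) (at s within S)"
      unfolding \<alpha>_def using 0(1) s by (intro tendsto_intros) (auto simp: continuous_on_def)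
    then have \<alpha>0: "(\<alpha> \<longlongrightarrow> 0) (at s within S)" by simp
    have b0: "((\<lambda>s'. norm (b s' - b s)) \<longlongrightarrow> 0) (at s within S)"
      using 0(2) s by (intro tendsto_norm_zero LIM_zero) (auto simp: continuous_on_def)
    have est: "norm (w s' - w s) \<le> 2 * C * (norm (b s' - b s) + \<alpha> s' * norm (w s))"
      if s': "s' \<in> S" and small: "\<alpha> s' < 1 / (2 * C)" for s'
    proof -
      have "A s (w s' - w s) = b s' - b s - (\<Sum>i\<in>Basis. (w s' \<bullet> i) *\<^sub>R (a i s' - a i s))"
        using 0(3)[OF s] 0(3)[OF s'] linear_diff[OF lin, of s "w s'" "w s"]
        by (simp add: A_def scaleR_diff_right sum_subtractf)
      then have "w s' - w s = R (b s' - b s - (\<Sum>i\<in>Basis. (w s' \<bullet> i) *\<^sub>R (a i s' - a i s)))"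
        using R(2) by (metis comp_apply id_apply)
      then have "norm (w s' - w s) \<le> C * norm (b s' - b s - (\<Sum>i\<in>Basis. (w s' \<bullet> i) *\<^sub>R (a i s' - a i s)))"
        using C(2) by metis
      also have "\<dots> \<le> C * (norm (b s' - b s) + norm (w s') * \<alpha> s')"
      proof (intro mult_left_mono order_trans[OF norm_triangle_ineq4] add_left_mono)
        show "norm (\<Sum>i\<in>Basis. (w s' \<bullet> i) *\<^sub>R (a i s' - a i s)) \<le> norm (w s') * \<alpha> s'"
          unfolding \<alpha>_def sum_distrib_left
          by (intro sum_norm_le) (auto intro!: mult_right_mono simp: Basis_le_norm)
      qed (use C in auto)
      also have "\<dots> \<le> C * (norm (b s' - b s) + (norm (w s) + norm (w s' - w s)) * \<alpha> s')"
        using C(1) norm_triangle_sub[of "w s'" "w s"]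
        by (intro mult_left_mono add_left_mono mult_right_mono) (auto simp: \<alpha>_def intro: sum_nonneg)
      also have "\<dots> = C * (norm (b s' - b s) + \<alpha> s' * norm (w s)) + (C * \<alpha> s') * norm (w s' - w s)"
        by (simp add: algebra_simps)
      also have "(C * \<alpha> s') * norm (w s' - w s) \<le> 1/2 * norm (w s' - w s)"
        using small C(1) by (intro mult_right_mono) (auto simp: field_simps)
      finally show ?thesis by simp
    qed
    have "\<forall>\<^sub>F s' in at s within S. \<alpha> s' < 1 / (2 * C)"
      using \<alpha>0 C(1) by (auto intro: order_tendstoD)
    then have ev: "\<forall>\<^sub>F s' in at s within S. norm (w s' - w s) \<le> 2 * C * (norm (b s' - b s) + \<alpha> s' * norm (w s))"
      using est by (auto simp: eventually_at_filter elim: eventually_mono)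
    have "((\<lambda>s'. 2 * C * (norm (b s' - b s) + \<alpha> s' * norm (w s))) \<longlongrightarrow> 2 * C * (0 + 0 * norm (w s))) (at s within S)"
      by (intro tendsto_intros b0 \<alpha>0)
    then have "((\<lambda>s'. w s' - w s) \<longlongrightarrow> 0) (at s within S)"
      using Lim_null_comparison[OF ev] by simp
    then show ?thesis by (rule LIM_zero_cancel)
  qed
  then show ?case by (simp add: continuous_on_def)
next
  case (Suc k b w)
  define A where "A s v = (\<Sum>i\<in>Basis. (v \<bullet> i) *\<^sub>R a i s)" for s v
  have lin: "linear (A s)" for s
    unfolding A_def by (intro linearI)
      (simp_all add: inner_add_left scaleR_add_left sum.distrib scaleR_sum_right)
  have w: "Ck_on k w S"
    by (rule Suc.IH[OF Ck_along_Suc_D[OF Suc.prems(1)] Ck_along_Suc_D[OF Suc.prems(2)] Suc.prems(3)])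
  have cw: "(w \<longlongrightarrow> w s) (at s within S)" if "s \<in> S" for s
    using Ck_along_continuous[OF w] that by (simp add: continuous_on_def)
  have "\<forall>i\<in>Basis. \<exists>a'. (\<forall>s\<in>S. (a i has_vector_derivative a' s) (at s within S)) \<and> Ck_on k a' S"
    using Ck_on_real_SucE[OF Suc.prems(1)] by metis
  from bchoice[OF this] obtain a' where a': "\<And>i s. i \<in> Basis \<Longrightarrow> s \<in> S \<Longrightarrow>
      (a i has_vector_derivative a' i s) (at s within S)" "\<And>i. i \<in> Basis \<Longrightarrow> Ck_on k (a' i) S"
    by auto
  obtain b' where b': "\<And>s. s \<in> S \<Longrightarrow> (b has_vector_derivative b' s) (at s within S)" "Ck_on k b' S"
    using Suc.prems(2) by (rule Ck_on_real_SucE) blast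
  define b1 where "b1 s = b' s - (\<Sum>i\<in>Basis. (w s \<bullet> i) *\<^sub>R a' i s)" for s
  have b1: "Ck_on k b1 S"
    unfolding b1_def by (intro Ck_along_diff Ck_along_sum Ck_along_scaleR Ck_along_inner Ck_along_const w a' b')
  have "\<forall>s\<in>S. \<exists>w'. A s w' = b1 s \<and> (w has_vector_derivative w') (at s within S)"
  proof
    fix s assume s: "s \<in> S"
    have i: "inj (A s)"
      using inj[OF s] linear_injective_0[OF lin] by (auto simp: A_def)
    then obtain R where R: "linear R" "R \<circ> A s = id"
      using linear_injective_left_inverse[OF lin] by auto
    have AR: "A s (R x) = x" for x
      using linear_injective_imp_surjective[OF lin i] R(2) by (metis comp_apply id_apply surjD)
    have quot: "(w s' - w s) /\<^sub>R (s' - s) = R ((b s' - b s) /\<^sub>R (s' - s)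
        - (\<Sum>i\<in>Basis. (w s' \<bullet> i) *\<^sub>R ((a i s' - a i s) /\<^sub>R (s' - s))))" if s': "s' \<in> S" for s'
    proof -
      have eq: "A s (w s' - w s) = b s' - b s - (\<Sum>i\<in>Basis. (w s' \<bullet> i) *\<^sub>R (a i s' - a i s))"
        using Suc.prems(3)[OF s] Suc.prems(3)[OF s'] linear_diff[OF lin, of s "w s'" "w s"]
        by (simp add: A_def scaleR_diff_right sum_subtractf)
      have "A s ((w s' - w s) /\<^sub>R (s' - s)) = (b s' - b s) /\<^sub>R (s' - s)
        - (\<Sum>i\<in>Basis. (w s' \<bullet> i) *\<^sub>R ((a i s' - a i s) /\<^sub>R (s' - s)))"
        by (simp only: linear_scale[OF lin] eq scaleR_diff_right[of _ "b s' - b s"] scaleR_sum_right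
            scaleR_left_commute[of "inverse _"])
      then show ?thesis
        using R(2) by (metis comp_apply id_apply)
    qed
    have "((\<lambda>s'. R ((b s' - b s) /\<^sub>R (s' - s)
        - (\<Sum>i\<in>Basis. (w s' \<bullet> i) *\<^sub>R ((a i s' - a i s) /\<^sub>R (s' - s))))) \<longlongrightarrow> R (b1 s)) (at s within S)"
      unfolding b1_def
      by (intro bounded_linear.tendsto[OF linear_conv_bounded_linear[THEN iffD1, OF R(1)]] tendsto_intros cw s
          has_vector_derivative_quotient[THEN iffD1] a' b')
    then have "((\<lambda>s'. (w s' - w s) /\<^sub>R (s' - s)) \<longlongrightarrow> R (b1 s)) (at s within S)"
      by (rule Lim_transform_eventually) (auto simp: eventually_at_filter quot)
    then have "(w has_vector_derivative R (b1 s)) (at s within S)"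
      by (simp add: has_vector_derivative_quotient)
    then show "\<exists>w'. A s w' = b1 s \<and> (w has_vector_derivative w') (at s within S)"
      using AR by blast
  qed
  from bchoice[OF this] obtain w' where w': "\<And>s. s \<in> S \<Longrightarrow> A s (w' s) = b1 s"
    "\<And>s. s \<in> S \<Longrightarrow> (w has_vector_derivative w' s) (at s within S)" by auto
  show ?case
  proof (rule Ck_on_real_SucI[OF w'(2)])
    show "Ck_on k w' S"
      by (rule Suc.IH[OF Ck_along_Suc_D[OF Suc.prems(1)] b1]) (use w'(1) in \<open>auto simp: A_def\<close>)
  qed
qed

lemma has_derivative_within_Un:
  assumes "(f has_derivative D) (at x within S)" "(f has_derivative D) (at x within T)"
  shows "(f has_derivative D) (at x within S \<union> T)"
  using assms by (simp add: has_derivative_iff_norm Lim_within_Un)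

lemma blinfun_left_inverse:
  fixes A :: "'a::euclidean_space \<Rightarrow>\<^sub>L 'a"
  assumes "\<And>v. A v = 0 \<Longrightarrow> v = 0"
  obtains B where "B o\<^sub>L A = id_blinfun"
proof -
  have lin: "linear (blinfun_apply A)"
    by (rule bounded_linear.linear[OF blinfun.bounded_linear_right])
  obtain g where g: "linear g" "g \<circ> blinfun_apply A = id"
    using linear_injective_left_inverse[OF lin] linear_injective_0[OF lin] assms by blast
  have "Blinfun g o\<^sub>L A = id_blinfun"
    using g by (intro blinfun_eqI)
      (simp add: bounded_linear_Blinfun_apply linear_conv_bounded_linear[THEN iffD1] fun_eq_iff)
  then show ?thesis by (rule that)
qed

text \<open>The parameter \<open>s\<close> is restricted to \<open>s \<ge> 0\<close>. A continuously differentiable extension to negative \<open>s\<close> makes the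
  inverse function theorem applicable; the order of smoothness on \<open>{0..<d}\<close> is then raised step by step by means
  of the linear equation that \<open>y'\<close> satisfies there.\<close>

theorem implicit_curve:
  fixes F :: "'y::euclidean_space \<times> real \<Rightarrow> 'y"
  assumes F: "Ck_on (Suc k) F (W \<times> {0..<e})" and W: "open W" and e: "0 < e"
    and y0: "y0 \<in> W" "F (y0, 0) = 0"
    and J: "((\<lambda>y. F (y, 0)) has_derivative J) (at y0)" "\<And>v. J v = 0 \<Longrightarrow> v = 0"
  obtains d y where "0 < d" "d \<le> e" "Ck_on (Suc k) y {0..<d}" "y 0 = y0"
    "\<And>s. s \<in> {0..<d} \<Longrightarrow> y s \<in> W \<and> F (y s, s) = 0"
proof -
  obtain F' where F': "\<And>x. x \<in> W \<times> {0..<e} \<Longrightarrow> (F has_derivative F' x) (at x within W \<times> {0..<e})"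
    "\<And>v. Ck_on k (\<lambda>x. F' x v) (W \<times> {0..<e})"
    using F by (auto elim!: Ck_along_SucE)
  have lin: "linear (F' x)" if "x \<in> W \<times> {0..<e}" for x
    using has_derivative_linear[OF F'(1)[OF that]] .
  have cF': "continuous_on (W \<times> {0..<e}) (\<lambda>x. F' x v)" for v
    by (rule Ck_along_continuous[OF F'(2)])
  \<comment> \<open>Reflecting \<open>F\<close> in its value at \<open>s = 0\<close> gives a continuously differentiable extension to negative \<open>s\<close>.\<close>
  define G where "G z = (if 0 \<le> snd z then F z else 2 *\<^sub>R F (fst z, 0) - F (fst z, - snd z))" for z
  define G' where "G' z v = (if 0 \<le> snd z then F' z v
      else 2 *\<^sub>R F' (fst z, 0) (fst v, 0) - F' (fst z, - snd z) (fst v, - snd v))" for z v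
  define U where "U = W \<times> {-e<..<e}"
  have U: "open U" unfolding U_def by (intro open_Times W open_greaterThanLessThan)
  have dp: "(G has_derivative G' z) (at z within W \<times> {0..<e})" if z: "z \<in> W \<times> {0..<e}" for z
    by (rule has_derivative_transform_eq[where f=F])
      (use z F'(1)[OF z] in \<open>auto simp: G_def G'_def[abs_def]\<close>)
  have dn: "(G has_derivative (\<lambda>v. 2 *\<^sub>R F' (fst z, 0) (fst v, 0) - F' (fst z, - snd z) (fst v, - snd v)))
      (at z within W \<times> {-e<..0})" if z: "z \<in> W \<times> {-e<..0}" for z
  proof (rule has_derivative_transform_eq[where f="\<lambda>z. 2 *\<^sub>R F (fst z, 0) - F (fst z, - snd z)"])
    have "((\<lambda>z. F (fst z, 0)) has_derivative (\<lambda>v. F' (fst z, 0) (fst v, 0))) (at z within W \<times> {-e<..0})"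
      by (rule has_derivative_in_compose[where f="\<lambda>z. (fst z, 0)" and g=F])
        (use z e in \<open>auto intro!: derivative_eq_intros has_derivative_subset[OF F'(1)]\<close>)
    moreover have "((\<lambda>z. F (fst z, - snd z)) has_derivative (\<lambda>v. F' (fst z, - snd z) (fst v, - snd v)))
        (at z within W \<times> {-e<..0})"
      by (rule has_derivative_in_compose[where f="\<lambda>z. (fst z, - snd z)" and g=F])
        (use z e in \<open>auto intro!: derivative_eq_intros has_derivative_subset[OF F'(1)]\<close>)
    ultimately show "((\<lambda>z. 2 *\<^sub>R F (fst z, 0) - F (fst z, - snd z)) has_derivative
        (\<lambda>v. 2 *\<^sub>R F' (fst z, 0) (fst v, 0) - F' (fst z, - snd z) (fst v, - snd v))) (at z within W \<times> {-e<..0})"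
      by (intro has_derivative_diff has_derivative_scaleR_right)
  qed (use z in \<open>auto simp: G_def scaleR_2\<close>)
  have agree: "2 *\<^sub>R F' (fst z, 0) (fst v, 0) - F' (fst z, - snd z) (fst v, - snd v) = F' z v"
    if z: "z \<in> U" "snd z = 0" for z v
  proof -
    have zz: "z = (fst z, 0)" "z \<in> W \<times> {0..<e}" using z e by (auto simp: U_def prod_eq_iff)
    have l: "linear (F' z)" by (rule lin[OF zz(2)])
    have "2 *\<^sub>R F' z (fst v, 0) - F' z (fst v, - snd v) = F' z (2 *\<^sub>R (fst v, 0) - (fst v, - snd v))"
      by (simp only: linear_diff[OF l] linear_scale[OF l])
    also have "2 *\<^sub>R (fst v, 0) - (fst v, - snd v) = v"
      by (simp add: prod_eq_iff scaleR_2)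
    finally show ?thesis using z(2) zz(1) by simp
  qed
  have dG: "(G has_derivative G' z) (at z)" if z: "z \<in> U" for z
  proof -
    consider "0 < snd z" | "snd z < 0" | "snd z = 0" by linarith
    then show ?thesis
    proof cases
      case 1
      have "open (W \<times> {0<..<e})" by (intro open_Times W open_greaterThanLessThan)
      then have "at z within W \<times> {0..<e} = at z"
        using z 1 by (intro at_within_interior interiorI[of "W \<times> {0<..<e}"]) (auto simp: U_def)
      then show ?thesis using dp[of z] z 1 by (auto simp: U_def)
    next
      case 2
      have "open (W \<times> {-e<..<0})" by (intro open_Times W open_greaterThanLessThan)
      then have "at z within W \<times> {-e<..0} = at z"
        using z 2 by (intro at_within_interior interiorI[of "W \<times> {-e<..<0}"]) (auto simp: U_def)
      then show ?thesis using dn[of z] z 2 by (auto simp: U_def G'_def[abs_def])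
    next
      case 3
      have zz: "z = (fst z, 0)" "z \<in> W \<times> {0..<e}" using z 3 e by (auto simp: U_def prod_eq_iff)
      have "2 *\<^sub>R F' (fst z, 0) (fst v, 0) - F' (fst z, - snd z) (fst v, - snd v) = G' z v" for v
        using agree[OF z 3, of v] 3 by (simp add: G'_def)
      then have "(G has_derivative G' z) (at z within W \<times> {-e<..0})"
        using dn[of z] z 3 by (simp add: U_def mem_Times_iff)
      then have "(G has_derivative G' z) (at z within W \<times> {0..<e} \<union> W \<times> {-e<..0})"
        by (intro has_derivative_within_Un dp zz(2))
      moreover have "W \<times> {0..<e} \<union> W \<times> {-e<..0} = U" using e by (auto simp: U_def)
      ultimately show ?thesis using at_within_open[OF z U] by simp
    qed
  qed
  have linG: "bounded_linear (G' z)" if "z \<in> U" for z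
    using dG[OF that] by (rule has_derivative_bounded_linear)
  have cG': "continuous_on U (\<lambda>z. G' z v)" for v
  proof -
    have eq: "W \<times> {0..<e} \<union> W \<times> {-e<..0} = U" using e by (auto simp: U_def)
    have "W \<times> {0..<e} = U \<inter> {z. 0 \<le> snd z}" "W \<times> {-e<..0} = U \<inter> {z. snd z \<le> 0}"
      using e by (auto simp: U_def)
    then have cl: "closedin (top_of_set U) (W \<times> {0..<e})" "closedin (top_of_set U) (W \<times> {-e<..0})"
      by (auto intro!: closedin_closed_Int closed_Collect_le continuous_intros)
    have "continuous_on (W \<times> {0..<e} \<union> W \<times> {-e<..0})
        (\<lambda>z. if 0 \<le> snd z then F' z v else 2 *\<^sub>R F' (fst z, 0) (fst v, 0) - F' (fst z, - snd z) (fst v, - snd v))"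
    proof (rule continuous_on_cases_local)
      show "continuous_on (W \<times> {0..<e}) (\<lambda>z. F' z v)" by (rule cF')
      show "continuous_on (W \<times> {-e<..0})
          (\<lambda>z. 2 *\<^sub>R F' (fst z, 0) (fst v, 0) - F' (fst z, - snd z) (fst v, - snd v))"
        using e by (intro continuous_intros continuous_on_compose2[OF cF']) auto
      fix z assume "z \<in> W \<times> {0..<e} \<and> \<not> 0 \<le> snd z \<or> z \<in> W \<times> {-e<..0} \<and> 0 \<le> snd z"
      then have "z \<in> U" "snd z = 0" using e by (auto simp: U_def)
      then show "F' z v = 2 *\<^sub>R F' (fst z, 0) (fst v, 0) - F' (fst z, - snd z) (fst v, - snd v)"
        using agree by simp
    qed (use cl eq in auto)
    then show ?thesis unfolding G'_def eq .
  qed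
  define \<Phi> where "\<Phi> z = (G z, snd z)" for z
  define \<Phi>' where "\<Phi>' z = Blinfun (\<lambda>v. (G' z v, snd v))" for z
  have \<Phi>': "blinfun_apply (\<Phi>' z) = (\<lambda>v. (G' z v, snd v))" if "z \<in> U" for z
    unfolding \<Phi>'_def
    by (intro bounded_linear_Blinfun_apply bounded_linear_Pair linG that bounded_linear_snd)
  have d\<Phi>: "(\<Phi> has_derivative blinfun_apply (\<Phi>' z)) (at z)" if "z \<in> U" for z
    unfolding \<Phi>'[OF that] \<Phi>_def by (intro has_derivative_Pair dG that) (auto intro!: derivative_eq_intros)
  have c\<Phi>: "continuous_on U \<Phi>'"
  proof (rule continuous_on_blinfun_componentwise)
    fix v :: "'y \<times> real"
    have "continuous_on U (\<lambda>z. (G' z v, snd v))" by (intro continuous_intros cG')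
    then show "continuous_on U (\<lambda>z. blinfun_apply (\<Phi>' z) v)"
      by (rule continuous_on_eq) (simp add: \<Phi>')
  qed
  have y0U: "(y0, 0) \<in> U" using y0 e by (simp add: U_def)
  have J_eq: "J v = F' (y0, 0) (v, 0)" for v
  proof -
    have "((\<lambda>y. F (y, 0)) has_derivative (\<lambda>v. F' (y0, 0) (v, 0))) (at y0 within W)"
      by (rule has_derivative_in_compose[where f="\<lambda>y. (y, 0)" and g=F])
        (use y0 e in \<open>auto intro!: derivative_eq_intros has_derivative_subset[OF F'(1)]\<close>)
    then have "((\<lambda>y. F (y, 0)) has_derivative (\<lambda>v. F' (y0, 0) (v, 0))) (at y0)"
      using at_within_open[OF y0(1) W] by simp
    from has_derivative_unique[OF this J(1)] show ?thesis by metis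
  qed
  have "v = 0" if "blinfun_apply (\<Phi>' (y0, 0)) v = 0" for v
  proof -
    have "G' (y0, 0) v = 0" "snd v = 0" using that unfolding \<Phi>'[OF y0U] by (auto simp: zero_prod_def)
    then have "J (fst v) = 0" by (simp add: J_eq G'_def) (metis prod.collapse)
    then show ?thesis using J(2) \<open>snd v = 0\<close> by (simp add: prod_eq_iff)
  qed
  then obtain B where B: "B o\<^sub>L \<Phi>' (y0, 0) = id_blinfun" by (rule blinfun_left_inverse)
  obtain U' V g g' where UV: "open U'" "U' \<subseteq> U" "(y0, 0) \<in> U'" "open V" "\<Phi> (y0, 0) \<in> V" "homeomorphism U' V \<Phi> g"
    and g: "\<And>y. y \<in> V \<Longrightarrow> (g has_derivative (g' y)) (at y)"
    and bij: "\<And>y. y \<in> V \<Longrightarrow> bij (blinfun_apply (\<Phi>' (g y)))"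
    by (rule inverse_function_theorem[OF U d\<Phi> c\<Phi> y0U B]) (assumption | rule that)+
  have \<Phi>0: "\<Phi> (y0, 0) = (0, 0)" by (simp add: \<Phi>_def G_def y0)
  obtain d0 where d0: "0 < d0" "ball (0, 0) d0 \<subseteq> V"
    using openE[OF UV(4,5)] unfolding \<Phi>0 by blast
  define d where "d = min d0 e"
  have d: "0 < d" "d \<le> e" using d0 e by (auto simp: d_def)
  have inV: "(0, s) \<in> V" if "\<bar>s\<bar> < d" for s
    using d0(2) that by (auto simp: d_def dist_Pair_Pair subset_iff)
  define y where "y s = fst (g (0, s))" for s
  have gU: "g (0, s) \<in> U" "\<Phi> (g (0, s)) = (0, s)" if "\<bar>s\<bar> < d" for s
    using UV(2,6) inV[OF that] unfolding homeomorphism_def by blast+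
  have gy: "g (0, s) = (y s, s)" if "\<bar>s\<bar> < d" for s
    using gU(2)[OF that] by (simp add: \<Phi>_def y_def prod_eq_iff)
  have yW: "y s \<in> W" if "\<bar>s\<bar> < d" for s
    using gU(1)[OF that] gy[OF that] by (auto simp: U_def)
  have Fy: "F (y s, s) = 0" if "s \<in> {0..<d}" for s
    using gU(2)[of s] gy[of s] that by (auto simp: \<Phi>_def G_def)
  have y_0: "y 0 = y0"
  proof -
    have "g (\<Phi> (y0, 0)) = (y0, 0)" using UV(3,6) unfolding homeomorphism_def by blast
    then show ?thesis by (simp add: \<Phi>0 y_def)
  qed
  define S where "S = {0..<d}"
  have ys: "(y s, s) \<in> W \<times> {0..<e}" if "s \<in> S" for s using yW[of s] that d by (auto simp: S_def)
  have "\<exists>y'. (y has_vector_derivative y') (at s within S)" if "s \<in> S" for s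
  proof -
    have s: "\<bar>s\<bar> < d" using that by (auto simp: S_def)
    have "((\<lambda>s. g (0, s)) has_derivative (\<lambda>v. g' (0, s) (0, v))) (at s)"
      by (rule has_derivative_compose[where f="\<lambda>s. (0, s)" and g=g])
        (use g[OF inV[OF s]] in \<open>auto intro!: derivative_eq_intros\<close>)
    from has_derivative_fst[OF has_derivative_at_withinI[OF this, of S]]
    have "(y has_derivative (\<lambda>v. fst (g' (0, s) (0, v)))) (at s within S)"
      by (simp add: y_def[abs_def])
    then have "y differentiable (at s within S)" by (rule differentiableI)
    then show ?thesis unfolding vector_derivative_works by (rule exI)
  qed
  then have "\<forall>s\<in>S. \<exists>y'. (y has_vector_derivative y') (at s within S)" by blast
  from bchoice[OF this] obtain y' where y': "\<And>s. s \<in> S \<Longrightarrow> (y has_vector_derivative y' s) (at s within S)" by blast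
  define a where "a i s = F' (y s, s) (i, 0)" for i s
  have rep: "F' (y s, s) (v, 0) = (\<Sum>i\<in>Basis. (v \<bullet> i) *\<^sub>R a i s)" if "s \<in> S" for v s
  proof -
    note l = lin[OF ys[OF that]]
    have "(v, 0) = (\<Sum>i\<in>Basis. (v \<bullet> i) *\<^sub>R (i, 0::real))"
      by (simp add: prod_eq_iff fst_sum snd_sum euclidean_representation)
    then show ?thesis by (simp add: a_def linear_sum[OF l] linear_scale[OF l] del: scaleR_Pair)
  qed
  have inj: "v = 0" if s: "s \<in> S" and v: "(\<Sum>i\<in>Basis. (v \<bullet> i) *\<^sub>R a i s) = 0" for s v
  proof -
    have s': "\<bar>s\<bar> < d" "0 \<le> s" using s by (auto simp: S_def)
    have "blinfun_apply (\<Phi>' (y s, s)) (v, 0) = 0"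
      using \<Phi>'[OF gU(1)[OF s'(1)]] gy[OF s'(1)] rep[OF s, of v] v s'(2) by (simp add: G'_def zero_prod_def)
    moreover have "inj (blinfun_apply (\<Phi>' (y s, s)))"
      using bij[OF inV[OF s'(1)]] gy[OF s'(1)] by (simp add: bij_def)
    ultimately show ?thesis
      by (metis blinfun.zero_right injD prod.inject zero_prod_def)
  qed
  have eqn: "(\<Sum>i\<in>Basis. (y' s \<bullet> i) *\<^sub>R a i s) = - F' (y s, s) (0, 1)" if s: "s \<in> S" for s
  proof -
    note l = lin[OF ys[OF s]]
    have "((\<lambda>s. F (y s, s)) has_derivative (\<lambda>v. F' (y s, s) (v *\<^sub>R y' s, v))) (at s within S)"
      by (rule has_derivative_in_compose[where f="\<lambda>s. (y s, s)" and g=F])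
        (use y'[OF s] ys[OF s] ys in \<open>auto simp: has_vector_derivative_def
            intro!: derivative_eq_intros has_derivative_subset[OF F'(1)]\<close>)
    also have "(\<lambda>v. F' (y s, s) (v *\<^sub>R y' s, v)) = (\<lambda>v. v *\<^sub>R F' (y s, s) (y' s, 1))"
      by (simp add: fun_eq_iff flip: linear_scale[OF l])
    finally have "((\<lambda>s. F (y s, s)) has_vector_derivative F' (y s, s) (y' s, 1)) (at s within S)"
      by (simp add: has_vector_derivative_def)
    then have "((\<lambda>s. 0) has_vector_derivative F' (y s, s) (y' s, 1)) (at s within S)"
      by (rule has_vector_derivative_transform[OF s, rotated]) (use Fy in \<open>auto simp: S_def\<close>)
    moreover have "at s within S \<noteq> bot"
    proof -
      have "0 \<in> S" "d / 2 \<in> S" "0 \<noteq> d / 2" using d(1) by (auto simp: S_def)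
      then have "\<nexists>x. S = {x}" by (metis singletonD)
      then show ?thesis
        using connected_imp_perfect[of S s] s by (auto simp: trivial_limit_within S_def)
    qed
    ultimately have "F' (y s, s) (y' s, 1) = 0"
      by (intro vector_derivative_unique_within[of s S]) auto
    then have "F' (y s, s) (y' s, 0) + F' (y s, s) (0, 1) = 0"
      by (simp flip: linear_add[OF l])
    then show ?thesis using rep[OF s] by (simp add: eq_neg_iff_add_eq_0)
  qed
  have "Ck_on j y S" if "j \<le> Suc k" for j
    using that
  proof (induction j)
    case 0
    show ?case by (simp add: continuous_on_vector_derivative[OF y'])
  next
    case (Suc j)
    have y: "Ck_on j y S" using Suc by simp
    have comp: "Ck_on j (\<lambda>s. F' (y s, s) v) S" for v
      by (rule Ck_on_compose[OF Ck_along_le[OF F'(2)]])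
        (use Suc.prems ys in \<open>auto intro!: Ck_along_Pair y Ck_along_id\<close>)
    have "Ck_on j y' S"
    proof (rule Ck_on_linear_equation[where a=a and b="\<lambda>s. - F' (y s, s) (0, 1)"])
      show "Ck_on j (a i) S" for i unfolding a_def by (rule comp)
    qed (use inj eqn in \<open>auto intro!: comp Ck_along_minus\<close>)
    then show ?case using y' by (rule Ck_on_real_SucI[rotated])
  qed
  then show ?thesis
    using that[OF d, of y] y_0 yW Fy unfolding S_def by fastforce
qed

section \<open>Trajectories, and the kernel at a normal orbit\<close>

text \<open>The union of two trajectories is compact, and on compact sets a continuously differentiable field is
  Lipschitz.\<close>

lemma solves_unique_forward:
  fixes F :: "real \<Rightarrow> 'a::euclidean_space \<Rightarrow> 'a"
  assumes S: "open S" and F: "Ck_on 1 (\<lambda>z. F (fst z) (snd z)) (UNIV \<times> S)"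
    and X: "solves F S {0..b} X" and Y: "solves F S {0..b} Y" and eq: "X 0 = Y 0" and t: "t \<in> {0..b}"
  shows "X t = Y t"
proof -
  obtain F' where F': "\<And>t x. x \<in> S \<Longrightarrow> ((\<lambda>x. F t x) has_derivative F' t x) (at x within S)"
    "\<And>v. continuous_on (UNIV \<times> S) (\<lambda>z. F' (fst z) (snd z) v)"
  proof -
    have "Ck_along spatial (Suc 0) (\<lambda>z. F (fst z) (snd z)) (UNIV \<times> S)"
      using Ck_along_mono[OF F, of spatial] by simp
    then obtain F' where
      "\<And>t w. t \<in> UNIV \<Longrightarrow> w \<in> S \<Longrightarrow> ((\<lambda>w. F (fst (t, w)) (snd (t, w))) has_derivative F' t w) (at w within S)"
      "\<And>v. Ck_along spatial 0 (\<lambda>z. F' (fst z) (snd z) v) (UNIV \<times> S)"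
      by (rule Ck_spatial_SucE) blast
    then show ?thesis using that[of F'] by simp
  qed
  obtain D where D: "\<And>t x. t \<in> UNIV \<Longrightarrow> x \<in> S \<Longrightarrow> blinfun_apply (D (t, x)) = F' t x"
    and cD: "continuous_on (UNIV \<times> S) D"
    using blinfun_derivative[of UNIV S "\<lambda>z. F (fst z) (snd z)" F'] F' by auto
  have "local_lipschitz UNIV S F"
    using F'(1) D cD by (intro c1_implies_local_lipschitz[where f'=D] S)
      (auto simp: at_within_open[OF _ S])
  have cX: "continuous_on {0..b} X" "continuous_on {0..b} Y"
    using X Y by (auto simp: solves_def intro!: continuous_on_vector_derivative)
  define K where "K = X ` {0..b} \<union> Y ` {0..b}"
  have K: "compact K" "K \<subseteq> S"
    using X Y cX unfolding K_def solves_def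
    by (auto intro!: compact_Un compact_continuous_image)
  have ll: "local_lipschitz {0..b} K F"
    by (rule local_lipschitz_subset[OF \<open>local_lipschitz UNIV S F\<close>]) (use K in auto)
  have "continuous_on {0..b} (\<lambda>t. F t x)" if "x \<in> K" for x
    using continuous_on_compose2[OF Ck_along_continuous[OF F], of "{0..b}" "\<lambda>t. (t, x)"] that K(2)
    by (force intro!: continuous_intros)
  then obtain C where C: "\<And>t. t \<in> {0..b} \<Longrightarrow> C-lipschitz_on K (F t)"
    using local_lipschitz_compact_implies_lipschitz[OF ll K(1) compact_Icc] by blast
  have "X t - Y t = 0"
  proof (rule gronwall_zero[of b "\<lambda>t. X t - Y t" "\<lambda>t. F t (X t) - F t (Y t)" C t])
    show "((\<lambda>t. X t - Y t) has_vector_derivative F t (X t) - F t (Y t)) (at t within {0..b})"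
      if "t \<in> {0..b}" for t
      using X Y that by (auto simp: solves_def intro!: has_vector_derivative_diff)
    show "norm (F t (X t) - F t (Y t)) \<le> C * norm (X t - Y t)" if "t \<in> {0..b}" for t
      using lipschitz_onD[OF C[OF that], of "X t" "Y t"] that by (auto simp: K_def dist_norm)
    show "0 \<le> C" using C[OF t] by (rule lipschitz_on_nonneg)
  qed (use eq t in auto)
  then show ?thesis by simp
qed

lemma solves_rescale:
  assumes X: "solves F S I X" and J: "\<And>t. t \<in> J \<Longrightarrow> c * t + d \<in> I"
  shows "solves (\<lambda>t x. c *\<^sub>R F (c * t + d) x) S J (\<lambda>t. X (c * t + d))"
  unfolding solves_def
proof (intro ballI conjI)
  fix t assume t: "t \<in> J"
  show "X (c * t + d) \<in> S" using X J[OF t] by (auto simp: solves_def)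
  have "((X \<circ> (\<lambda>t. c * t + d)) has_vector_derivative c *\<^sub>R F (c * t + d) (X (c * t + d))) (at t within J)"
  proof (rule vector_diff_chain_within)
    show "((\<lambda>t. c * t + d) has_vector_derivative c) (at t within J)"
      by (auto intro!: derivative_eq_intros simp: has_vector_derivative_def)
    show "(X has_vector_derivative F (c * t + d) (X (c * t + d))) (at (c * t + d) within (\<lambda>t. c * t + d) ` J)"
      using X J t by (auto simp: solves_def intro: has_vector_derivative_within_subset)
  qed
  then show "((\<lambda>t. X (c * t + d)) has_vector_derivative c *\<^sub>R F (c * t + d) (X (c * t + d))) (at t within J)"
    by (simp add: o_def)
qed

text \<open>Negative times reduce to positive ones by reversing the field.\<close>

lemma solves_unique:
  fixes F :: "real \<Rightarrow> 'a::euclidean_space \<Rightarrow> 'a"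
  assumes S: "open S" and F: "Ck_on 1 (\<lambda>z. F (fst z) (snd z)) (UNIV \<times> S)"
    and X: "solves F S (closed_segment 0 t) X" and Y: "solves F S (closed_segment 0 t) Y" and eq: "X 0 = Y 0"
  shows "X t = Y t"
proof (cases "0 \<le> t")
  case True
  then have "closed_segment 0 t = {0..t}" by (simp add: closed_segment_eq_real_ivl)
  then show ?thesis using solves_unique_forward[OF S F, of t X Y t] X Y eq True by auto
next
  case False
  then have seg: "closed_segment 0 t = {t..0}" by (simp add: closed_segment_eq_real_ivl)
  define G where "G s x = - F (- s) x" for s x
  have G: "Ck_on 1 (\<lambda>z. G (fst z) (snd z)) (UNIV \<times> S)"
  proof -
    have "Ck_on 1 (\<lambda>z. (\<lambda>z. F (fst z) (snd z)) (- fst z, snd z)) (UNIV \<times> S)"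
    proof (rule Ck_on_compose[OF F])
      show "Ck_on 1 (\<lambda>z. (- fst z, snd z)) (UNIV \<times> S)"
        by (intro Ck_along_Pair Ck_along_minus Ck_along_fst Ck_along_snd Ck_along_id)
    qed auto
    then show ?thesis
      unfolding G_def by (intro Ck_along_minus) simp
  qed
  have "solves G S {0..-t} (\<lambda>s. X (- s))" "solves G S {0..-t} (\<lambda>s. Y (- s))"
    using solves_rescale[OF X, of "{0..-t}" "-1" 0] solves_rescale[OF Y, of "{0..-t}" "-1" 0]
    by (auto simp: seg G_def[abs_def])
  from solves_unique_forward[OF S G this, of "- t"] show ?thesis using eq False by simp
qed

lemma traj_eqI:
  fixes F :: "real \<Rightarrow> 'a::euclidean_space \<Rightarrow> 'a"
  assumes S: "open S" and F: "Ck_on 1 (\<lambda>z. F (fst z) (snd z)) (UNIV \<times> S)"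
    and X: "solves F S (closed_segment 0 t) X" "X 0 = \<xi>"
  shows "traj F S \<xi> t = X t"
  unfolding traj_def
proof (rule the_equality)
  show "\<exists>Xa. solves F S (closed_segment 0 t) Xa \<and> Xa 0 = \<xi> \<and> Xa t = X t" using X by blast
  fix y assume "\<exists>X. solves F S (closed_segment 0 t) X \<and> X 0 = \<xi> \<and> X t = y"
  then obtain X' where X': "solves F S (closed_segment 0 t) X'" "X' 0 = X 0" "X' t = y" using X(2) by auto
  then show "y = X t" using solves_unique[OF S F X'(1) X(1) X'(2)] by simp
qed

text \<open>Here \<open>A\<close> stands for the derivative of the period map and \<open>f\<close> for the vector field. Normality bounds the kernel
  of \<open>(x, y) \<mapsto> A x - x + y f\<close> by two dimensions, so that it is spanned by \<open>(f, 0)\<close> and \<open>(w, P)\<close>, and \<open>\<kappa>\<close>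
  distinguishes these two vectors.\<close>

lemma transversal_kernel:
  fixes A :: "'a::euclidean_space \<Rightarrow> 'a" and \<kappa> :: "'a \<times> real \<Rightarrow> real"
  assumes A: "linear A" and \<kappa>: "linear \<kappa>" and f: "f \<noteq> 0" "A f = f" "\<kappa> (f, 0) = 0"
    and w: "A w + P *\<^sub>R f = w" "\<kappa> (w, P) = 1"
    and normal: "dim {v. A v = v} = 1 \<or> dim {v. A v = v} = 2 \<and> f \<notin> range (\<lambda>v. A v - v)"
    and x: "A x + y *\<^sub>R f = x" "\<kappa> (x, y) = 0"
  shows "\<exists>c. (x, y) = c *\<^sub>R (f, 0)"
proof -
  define V where "V = {v. A v = v}"
  have fV: "f \<in> V" using f by (simp add: V_def)
  have \<kappa>_lin: "\<kappa> (a *\<^sub>R u + b *\<^sub>R v) = a * \<kappa> u + b * \<kappa> v" for a b u v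
    by (simp add: linear_add[OF \<kappa>] linear_scale[OF \<kappa>])
  show ?thesis
    using normal
  proof
    assume 1: "dim {v. A v = v} = 1"
    have span: "\<exists>c. v = c *\<^sub>R f" if v: "v \<in> V" for v
    proof (rule ccontr)
      assume "\<nexists>c. v = c *\<^sub>R f"
      then have n: "v \<notin> span {f}" by (auto simp: span_singleton)
      then have "independent {v, f}" using f by (simp add: independent_insert)
      then have "card {v, f} \<le> dim V"
        using v fV by (intro independent_card_le_dim) auto
      moreover have "v \<noteq> f" using n by (auto intro: span_base)
      ultimately show False using 1 by (simp add: V_def)
    qed
    have P: "P \<noteq> 0"
    proof
      assume "P = 0"
      then obtain c where "w = c *\<^sub>R f" using span[of w] w by (auto simp: V_def)
      then have "(w, P) = c *\<^sub>R (f, 0) + 0 *\<^sub>R (f, 0)" using \<open>P = 0\<close> by simp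
      then show False using w(2) f(3) \<kappa>_lin[of c "(f, 0)" 0 "(f, 0)"] by simp
    qed
    have "A (x - (y / P) *\<^sub>R w) = x - (y / P) *\<^sub>R w"
    proof -
      have eqs: "A x = x - y *\<^sub>R f" "A w = w - P *\<^sub>R f" using x(1) w(1) by (auto simp: algebra_simps)
      show ?thesis
        unfolding linear_diff[OF A] linear_scale[OF A] eqs using P by (simp add: scaleR_diff_right)
    qed
    then obtain c where c: "x - (y / P) *\<^sub>R w = c *\<^sub>R f" using span by (auto simp: V_def)
    have e: "(x, y) = (y / P) *\<^sub>R (w, P) + c *\<^sub>R (f, 0)"
      using c P by (simp add: algebra_simps)
    have "y / P = 0" using x(2) w(2) f(3) \<kappa>_lin[of "y / P" "(w, P)" c "(f, 0)"] e by simp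
    then show ?thesis using e by auto
  next
    assume 2: "dim {v. A v = v} = 2 \<and> f \<notin> range (\<lambda>v. A v - v)"
    have zero: "b = 0" if "A v + b *\<^sub>R f = v" for v b
    proof (rule ccontr)
      assume b: "b \<noteq> 0"
      have "A ((- 1 / b) *\<^sub>R v) - (- 1 / b) *\<^sub>R v = (- 1 / b) *\<^sub>R (A v - v)"
        by (simp only: linear_scale[OF A] scaleR_diff_right)
      also have "A v - v = A v - (A v + b *\<^sub>R f)" using that by simp
      also have "\<dots> = - b *\<^sub>R f" by simp
      also have "(- 1 / b) *\<^sub>R (- b *\<^sub>R f) = f" using b by simp
      finally have "f \<in> range (\<lambda>v. A v - v)"
        by (intro range_eqI[of _ _ "(- 1 / b) *\<^sub>R v"]) (rule sym)
      then show False using 2 by blast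
    qed
    have P: "P = 0" "y = 0" using zero w(1) x(1) by auto
    have wn: "w \<notin> span {f}"
    proof
      assume "w \<in> span {f}"
      then obtain c where "w = c *\<^sub>R f" by (auto simp: span_singleton)
      then have "(w, P) = c *\<^sub>R (f, 0) + 0 *\<^sub>R (f, 0)" using P by simp
      then show False using w(2) f(3) \<kappa>_lin[of c "(f, 0)" 0 "(f, 0)"] by simp
    qed
    then have ind: "independent {w, f}" using f by (simp add: independent_insert)
    have "x \<in> span {w, f}"
    proof (rule ccontr)
      assume n: "x \<notin> span {w, f}"
      then have "independent {x, w, f}" using ind f(1) by (simp add: independent_insert)
      then have "card {x, w, f} \<le> dim V"
        using x(1) w(1) fV P by (intro independent_card_le_dim) (auto simp: V_def)
      moreover have "x \<noteq> w" "x \<noteq> f" "w \<noteq> f" using n wn by (auto intro: span_base)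
      ultimately show False using 2 by (simp add: V_def)
    qed
    then obtain a where "x - a *\<^sub>R w \<in> span {f}" using span_breakdown_eq by blast
    then obtain b where b: "x - a *\<^sub>R w = b *\<^sub>R f" by (auto simp: span_singleton)
    have e: "(x, y) = a *\<^sub>R (w, P) + b *\<^sub>R (f, 0)" using b P by (simp add: algebra_simps)
    have "a = 0" using x(2) w(2) f(3) \<kappa>_lin[of a "(w, P)" b "(f, 0)"] e by simp
    then show ?thesis using e by auto
  qed
qed

section \<open>Periodic orbits, and sign changes of periodic functions\<close>

lemma Ck_on_autonomous:
  assumes "Ck_on k f S" shows "Ck_on k (\<lambda>z. f (snd z)) (UNIV \<times> S)"
  by (rule Ck_on_compose[OF assms, of _ snd]) (auto intro: Ck_along_snd Ck_along_id)

text \<open>The field does not vanish on the orbit: otherwise the solution would be constant, which contradicts the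
  minimality of the positive period.\<close>

lemma periodic_orbit_traj:
  fixes f :: "'a::euclidean_space \<Rightarrow> 'a"
  assumes S: "open S" and f: "Ck_on 1 f S" and Z: "periodic_orbit f S \<tau> Z" and p: "p \<in> Z"
  obtains X where "solves (\<lambda>_. f) S UNIV X" "X 0 = p" "\<And>t. X (t + \<tau>) = X t" "0 < \<tau>" "Z = range X"
    "\<And>s t. traj0 f S (X s) t = X (s + t)" "\<And>t. f (X t) \<noteq> 0"
proof -
  obtain X0 where X0: "solves (\<lambda>_. f) S UNIV X0" "Z = range X0" "0 < \<tau>" "\<And>t. X0 (t + \<tau>) = X0 t"
    "\<And>\<sigma>. 0 < \<sigma> \<Longrightarrow> \<sigma> < \<tau> \<Longrightarrow> \<exists>t. X0 (t + \<sigma>) \<noteq> X0 t"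
    using Z unfolding periodic_orbit_def by blast
  obtain a where a: "p = X0 a" using p X0(2) by auto
  define X where "X t = X0 (t + a)" for t
  have X: "solves (\<lambda>_. f) S UNIV X"
    using solves_rescale[OF X0(1), of UNIV 1 a] by (simp add: X_def[abs_def])
  have tr: "traj0 f S (X s) t = X (s + t)" for s t
  proof (rule traj_eqI[where X="\<lambda>t. X (s + t)", OF S])
    show "Ck_on 1 (\<lambda>z. f (snd z)) (UNIV \<times> S)" by (rule Ck_on_autonomous[OF f])
    show "solves (\<lambda>_. f) S (closed_segment 0 t) (\<lambda>t. X (s + t))"
      using solves_rescale[OF X, of "closed_segment 0 t" 1 s] by (simp add: add.commute)
  qed simp
  have "f (X t) \<noteq> 0" for t
  proof
    assume 0: "f (X t) = 0"
    have "traj0 f S (X t) u = X t" for u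
      by (rule traj_eqI[where X="\<lambda>_. X t", OF S Ck_on_autonomous[OF f]])
        (use X 0 in \<open>auto simp: solves_def\<close>)
    then have "X (t + u) = X t" for u by (simp add: tr)
    then have c: "X0 u = X t" for u using spec[of _ "u - a - t"] unfolding X_def
      by (metis add.commute diff_add_cancel)
    show False using X0(5)[of "\<tau> / 2"] X0(3) c by simp
  qed
  moreover have "X 0 = p" "X (t + \<tau>) = X t" for t
    using X0(4)[of "t + a"] a by (auto simp: X_def add_ac)
  moreover have "Z = range X"
  proof -
    have "X0 u \<in> range X" for u by (rule range_eqI[of _ _ "u - a"]) (simp add: X_def)
    then show ?thesis using X0(2) by (auto simp: X_def)
  qed
  ultimately show ?thesis using that[of X] X X0(3) tr by blast
qed

lemma periodic_nat_shift:
  fixes X :: "real \<Rightarrow> 'a"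
  assumes "\<And>t. X (t + \<sigma>) = X t"
  shows "X (t + real n * \<sigma>) = X t"
proof (induction n)
  case (Suc n)
  have "X (t + real (Suc n) * \<sigma>) = X ((t + real n * \<sigma>) + \<sigma>)" by (simp add: algebra_simps)
  then show ?case using Suc assms by simp
qed simp

text \<open>Take for \<open>b\<close> the infimum of the points where \<open>h\<close> is negative, and for \<open>a\<close> the supremum of the points before \<open>b\<close>
  where \<open>h\<close> is positive. Between them \<open>h\<close> is neither.\<close>

lemma transverse_zero_descending:
  fixes h :: "real \<Rightarrow> real"
  assumes h: "continuous_on {\<alpha>..\<beta>} h" and \<alpha>\<beta>: "\<alpha> \<le> \<beta>" "0 < h \<alpha>" "h \<beta> < 0"
  obtains a b where "\<alpha> < a" "a \<le> b" "b < \<beta>" "\<And>u. u \<in> {a..b} \<Longrightarrow> h u = 0"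
    "\<exists>\<^sub>F u in at_left a. 0 < h u" "\<exists>\<^sub>F u in at_right b. h u < 0"
proof -
  have near: "\<exists>d>0. \<forall>v\<in>{\<alpha>..\<beta>}. \<bar>v - u\<bar> < d \<longrightarrow> \<bar>h v - h u\<bar> < \<bar>h u\<bar>" if "u \<in> {\<alpha>..\<beta>}" "h u \<noteq> 0" for u
    using h that unfolding continuous_on_iff dist_real_def by (meson zero_less_abs_iff)
  define N where "N = {u \<in> {\<alpha>..\<beta>}. h u < 0}"
  define b where "b = Inf N"
  have N: "\<beta> \<in> N" "bdd_below N" using \<alpha>\<beta> by (auto simp: N_def intro: bdd_belowI)
  have bN: "b \<le> u" if "u \<in> N" for u unfolding b_def by (rule cInf_lower[OF that N(2)])
  have b\<beta>: "b \<le> \<beta>" using bN N by blast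
  have b\<alpha>: "\<alpha> \<le> b" unfolding b_def by (rule cInf_greatest) (use N in \<open>auto simp: N_def\<close>)
  have nonneg: "0 \<le> h u" if "\<alpha> \<le> u" "u < b" for u
    using bN[of u] that b\<beta> by (force simp: N_def)
  have approach: "\<exists>u\<in>N. u < b + d" if "0 < d" for d
    using that cInf_lessD[of N "b + d"] N by (auto simp: b_def)
  have hb: "h b = 0"
  proof (rule ccontr)
    assume n: "h b \<noteq> 0"
    obtain d where d: "0 < d" "\<And>v. v \<in> {\<alpha>..\<beta>} \<Longrightarrow> \<bar>v - b\<bar> < d \<Longrightarrow> \<bar>h v - h b\<bar> < \<bar>h b\<bar>"
      using near[of b] n b\<alpha> b\<beta> by auto
    show False
    proof (cases "h b < 0")
      case True
      then have "\<alpha> < b" using \<alpha>\<beta> b\<alpha> by (cases "\<alpha> = b") auto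
      define v where "v = max \<alpha> (b - d / 2)"
      have "v \<in> {\<alpha>..\<beta>}" "\<bar>v - b\<bar> < d" "\<alpha> \<le> v" "v < b"
        using \<open>\<alpha> < b\<close> d(1) b\<beta> by (auto simp: v_def)
      then show False using d(2)[of v] nonneg[of v] True by auto
    next
      case False
      obtain u where "u \<in> N" "u < b + d" using approach d by blast
      then show False using d(2)[of u] bN[of u] False by (auto simp: N_def)
    qed
  qed
  have b: "\<alpha> < b" "b < \<beta>" using hb \<alpha>\<beta> b\<alpha> b\<beta> by (auto simp: less_le)
  have right: "\<exists>\<^sub>F u in at_right b. h u < 0"
    unfolding frequently_def eventually_at_right[OF b(2)]
  proof
    assume "\<exists>c>b. \<forall>y>b. y < c \<longrightarrow> \<not> h y < 0"
    then obtain c where c: "b < c" "\<And>y. b < y \<Longrightarrow> y < c \<Longrightarrow> \<not> h y < 0" by blast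
    obtain u where "u \<in> N" "u < b + (c - b)" using approach[of "c - b"] c by auto
    then show False using c(2)[of u] bN[of u] hb by (cases "u = b") (auto simp: N_def)
  qed
  define P where "P = {u \<in> {\<alpha>..b}. 0 < h u}"
  define a where "a = Sup P"
  have P: "\<alpha> \<in> P" "bdd_above P" using \<alpha>\<beta> b by (auto simp: P_def intro: bdd_aboveI)
  have aP: "u \<le> a" if "u \<in> P" for u unfolding a_def by (rule cSup_upper[OF that P(2)])
  have ab: "a \<le> b" unfolding a_def by (rule cSup_least) (use P in \<open>auto simp: P_def\<close>)
  have a\<alpha>: "\<alpha> \<le> a" using aP P by blast
  have approach': "\<exists>u\<in>P. a - d < u" if "0 < d" for d
    using that less_cSupD[of P "a - d"] P by (auto simp: a_def)
  have nonneg': "0 \<le> h u" if "\<alpha> \<le> u" "u \<le> b" for u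
    using nonneg[of u] hb that by (cases "u = b") auto
  have zero: "h u = 0" if "a < u" "u \<le> b" for u
    using aP[of u] nonneg'[of u] that a\<alpha> by (force simp: P_def)
  have ha: "h a = 0"
  proof (rule ccontr)
    assume n: "h a \<noteq> 0"
    then have pos: "0 < h a" using nonneg'[of a] a\<alpha> ab by auto
    then have "a < b" using hb ab by (cases "a = b") auto
    obtain d where d: "0 < d" "\<And>v. v \<in> {\<alpha>..\<beta>} \<Longrightarrow> \<bar>v - a\<bar> < d \<Longrightarrow> \<bar>h v - h a\<bar> < \<bar>h a\<bar>"
      using near[of a] n a\<alpha> ab b\<beta> by auto
    define v where "v = min b (a + d / 2)"
    have "v \<in> {\<alpha>..\<beta>}" "\<bar>v - a\<bar> < d" "a < v" "v \<le> b"
      using \<open>a < b\<close> d(1) b\<beta> a\<alpha> by (auto simp: v_def)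
    then show False using d(2)[of v] zero[of v] pos by auto
  qed
  then have a: "\<alpha> < a" using a\<alpha> \<alpha>\<beta> by (auto simp: less_le)
  have left: "\<exists>\<^sub>F u in at_left a. 0 < h u"
    unfolding frequently_def eventually_at_left[OF a]
  proof
    assume "\<exists>c<a. \<forall>y>c. y < a \<longrightarrow> \<not> 0 < h y"
    then obtain c where c: "c < a" "\<And>y. c < y \<Longrightarrow> y < a \<Longrightarrow> \<not> 0 < h y" by blast
    obtain u where "u \<in> P" "a - (a - c) < u" using approach'[of "a - c"] c by auto
    then show False using c(2)[of u] aP[of u] ha by (cases "u = a") (auto simp: P_def)
  qed
  show ?thesis
    by (rule that[OF a ab b(2) _ left right]) (use zero ha in \<open>auto simp: le_less\<close>)
qed

text \<open>By periodicity \<open>h\<close> has the same slope at \<open>s0\<close> and \<open>s0 + \<tau>\<close>, so right after \<open>s0\<close> and right before \<open>s0 + \<tau>\<close> its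
  signs differ.\<close>

lemma transverse_zero_after_simple_zero:
  fixes h :: "real \<Rightarrow> real"
  assumes h: "continuous_on UNIV h" and per: "\<And>s. h (s + \<tau>) = h s" and \<tau>: "0 < \<tau>"
    and zero: "simple_zero h s0"
  obtains s1 where "s0 < s1" "s1 < s0 + \<tau>" "topologically_transverse_zero h s1"
proof -
  have desc: "\<exists>a b. s0 < a \<and> a \<le> b \<and> b < s0 + \<tau> \<and> (\<forall>u\<in>{a..b}. k u = 0) \<and>
      (\<exists>\<^sub>F u in at_left a. 0 < k u) \<and> (\<exists>\<^sub>F u in at_right b. k u < 0)"
    if k: "continuous_on UNIV k" "\<And>s. k (s + \<tau>) = k s" "k s0 = 0" "(k has_real_derivative d) (at s0)" "0 < d" for k d
  proof -
    obtain e1 where e1: "0 < e1" "\<And>x. 0 < x \<Longrightarrow> x < e1 \<Longrightarrow> k s0 < k (s0 + x)"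
      using DERIV_pos_inc_right[OF k(4,5)] by blast
    obtain e2 where e2: "0 < e2" "\<And>x. 0 < x \<Longrightarrow> x < e2 \<Longrightarrow> k (s0 - x) < k s0"
      using DERIV_pos_inc_left[OF k(4,5)] by blast
    define e where "e = min (\<tau> / 4) (min (e1 / 2) (e2 / 2))"
    have e: "0 < e" "e < e1" "e < e2" "e \<le> \<tau> / 4" using e1 e2 \<tau> by (auto simp: e_def)
    have p1: "0 < k (s0 + e)" using e1(2)[of e] e k(3) by simp
    have p2: "k (s0 + \<tau> - e) < 0" using e2(2)[of e] e k(2)[of "s0 - e"] k(3) by (simp add: algebra_simps)
    have p3: "s0 + e \<le> s0 + \<tau> - e" using e \<tau> by simp
    show ?thesis
    proof (rule transverse_zero_descending[OF continuous_on_subset[OF k(1) subset_UNIV] p3 p1 p2], goal_cases)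
      case (1 a b)
      then show ?case using e by (intro exI[of _ a] exI[of _ b]) auto
    qed
  qed
  obtain d where d: "h s0 = 0" "(h has_real_derivative d) (at s0)" "d \<noteq> 0"
    using zero by (auto simp: simple_zero_def)
  show ?thesis
  proof (cases "0 < d")
    case True
    from desc[OF h per d(1,2) True] obtain a b where "s0 < a" "a \<le> b" "b < s0 + \<tau>"
      "\<forall>u\<in>{a..b}. h u = 0" "\<exists>\<^sub>F u in at_left a. 0 < h u" "\<exists>\<^sub>F u in at_right b. h u < 0" by blast
    then show ?thesis
      by (intro that[of a]) (auto simp: topologically_transverse_zero_def)
  next
    case False
    have "\<exists>a b. s0 < a \<and> a \<le> b \<and> b < s0 + \<tau> \<and> (\<forall>u\<in>{a..b}. - h u = 0) \<and>
      (\<exists>\<^sub>F u in at_left a. 0 < - h u) \<and> (\<exists>\<^sub>F u in at_right b. - h u < 0)"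
      by (rule desc[of "\<lambda>u. - h u" "- d"])
        (use h per d False in \<open>auto intro: continuous_intros DERIV_minus\<close>)
    then obtain a b where "s0 < a" "a \<le> b" "b < s0 + \<tau>"
      "\<forall>u\<in>{a..b}. h u = 0" "\<exists>\<^sub>F u in at_left a. h u < 0" "\<exists>\<^sub>F u in at_right b. 0 < h u" by auto
    then show ?thesis
      by (intro that[of a]) (auto simp: topologically_transverse_zero_def)
  qed
qed

section \<open>Monodromy\<close>

text \<open>\<open>W\<close> is the fundamental matrix of the variational equation on an interval that may contain several
  periods. Its coefficients are periodic, so a shift by \<open>\<tau>\<close> amounts to composition with the monodromy. The last
  claim holds because \<open>f\<close> along the orbit solves the variational equation.\<close>

lemma monodromy_propagator:
  fixes f :: "'a::euclidean_space \<Rightarrow> 'a"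
  assumes S: "open S" and f: "Ck_on 1 f S" and X: "solves (\<lambda>_. f) S UNIV X"
    and per: "\<And>t. X (t + \<tau>) = X t" and \<tau>: "0 < \<tau>"
    and tr: "\<And>t. traj0 f S (X 0) t = X t" and b: "\<tau> \<le> b"
  obtains W :: "real \<Rightarrow> 'a \<Rightarrow>\<^sub>L 'a" where "W 0 = id_blinfun"
    "\<And>t v. t \<in> {0..b} \<Longrightarrow> ((\<lambda>t. W t v) has_vector_derivative frechet_derivative f (at (X t)) (W t v))
        (at t within {0..b})"
    "\<And>t v. 0 \<le> t \<Longrightarrow> t + real m * \<tau> \<le> b \<Longrightarrow>
        W (t + real m * \<tau>) v = W t ((blinfun_apply (monodromy f S \<tau> (X 0)) ^^ m) v)"
    "\<And>t v. t \<in> {0..b} \<Longrightarrow> W t v = 0 \<Longrightarrow> v = 0"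
    "\<And>t. t \<in> {0..b} \<Longrightarrow> W t (f (X 0)) = f (X t)"
proof -
  have XS: "X t \<in> S" for t using X by (simp add: solves_def)
  have cX: "continuous_on UNIV X"
    using X by (auto simp: solves_def intro!: continuous_on_vector_derivative)
  obtain f' where f': "\<And>x. x \<in> S \<Longrightarrow> (f has_derivative f' x) (at x)" "\<And>v. continuous_on S (\<lambda>x. f' x v)"
    using f unfolding One_nat_def by (auto elim!: Ck_along_SucE simp: at_within_open[OF _ S])
  have fd: "frechet_derivative f (at x) = f' x" if "x \<in> S" for x
    using frechet_derivative_at[OF f'(1)[OF that]] by simp
  define B where "B t = Blinfun (frechet_derivative f (at (X t)))" for t
  have B: "blinfun_apply (B t) = frechet_derivative f (at (X t))" for t
    using has_derivative_bounded_linear[OF f'(1)[OF XS]] by (simp add: B_def fd XS bounded_linear_Blinfun_apply)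
  have cB: "continuous_on A B" for A
  proof (rule continuous_on_blinfun_componentwise)
    fix v
    show "continuous_on A (\<lambda>t. blinfun_apply (B t) v)"
      unfolding B fd[OF XS]
      by (rule continuous_on_compose2[OF f'(2) continuous_on_subset[OF cX]]) (use XS in auto)
  qed
  have Bper: "B (t + \<tau>) = B t" for t by (simp add: B_def per)
  have "bounded (B ` {0..b})"
    by (rule compact_imp_bounded[OF compact_continuous_image[OF cB compact_Icc]])
  then obtain K where K: "\<And>t. t \<in> {0..b} \<Longrightarrow> norm (B t) \<le> K"
    unfolding bounded_iff by blast
  have b0: "0 \<le> b" using b \<tau> by simp
  obtain W where W: "W 0 = (id_blinfun :: 'a \<Rightarrow>\<^sub>L 'a)"
    "\<And>t. t \<in> {0..b} \<Longrightarrow> (W has_vector_derivative (B t o\<^sub>L W t)) (at t within {0..b})"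
  proof (rule picard_global[of b "\<lambda>t Y. B t o\<^sub>L Y" K "id_blinfun :: 'a \<Rightarrow>\<^sub>L 'a"])
    show "continuous_on ({0..b} \<times> UNIV) (\<lambda>(t, Y). B t o\<^sub>L Y)"
      unfolding split_beta
      by (intro continuous_intros continuous_on_compose2[OF cB[of UNIV]]) auto
    show "norm ((B t o\<^sub>L Y) - (B t o\<^sub>L Z)) \<le> K * norm (Y - Z)" if "t \<in> {0..b}" for t and Y Z :: "'a \<Rightarrow>\<^sub>L 'a"
      using norm_blinfun_compose[of "B t" "Y - Z"] mult_right_mono[OF K[OF that], of "norm (Y - Z)"]
      by (simp add: bounded_bilinear.diff_right[OF bounded_bilinear_blinfun_compose])
  qed (use b0 in auto)
  have Wv: "((\<lambda>t. W t v) has_vector_derivative B t (W t v)) (at t within {0..b})" if "t \<in> {0..b}" for t v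
    using bounded_linear.has_vector_derivative[OF blinfun.bounded_linear_left W(2)[OF that], of v] by simp
  have mon: "monodromy f S \<tau> (X 0) = W \<tau>"
    unfolding monodromy_def tr
  proof (rule the_equality)
    show "\<exists>Y. Y 0 = id_blinfun \<and> (\<forall>t\<in>{0..\<tau>}. (Y has_vector_derivative
        Blinfun (frechet_derivative f (at (X t))) o\<^sub>L Y t) (at t within {0..\<tau>})) \<and> W \<tau> = Y \<tau>"
    proof (intro exI[of _ W] conjI ballI W(1) refl)
      fix t assume t: "t \<in> {0..\<tau>}"
      show "(W has_vector_derivative Blinfun (frechet_derivative f (at (X t))) o\<^sub>L W t) (at t within {0..\<tau>})"
        unfolding B_def[symmetric]
        by (rule has_vector_derivative_within_subset[OF W(2)]) (use t b in auto)
    qed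
    fix P assume "\<exists>Y. Y 0 = id_blinfun \<and> (\<forall>t\<in>{0..\<tau>}. (Y has_vector_derivative
        Blinfun (frechet_derivative f (at (X t))) o\<^sub>L Y t) (at t within {0..\<tau>})) \<and> P = Y \<tau>"
    then obtain Y where Y: "Y 0 = id_blinfun" "P = Y \<tau>"
      "\<And>t. t \<in> {0..\<tau>} \<Longrightarrow> (Y has_vector_derivative (B t o\<^sub>L Y t)) (at t within {0..\<tau>})"
      by (auto simp: B_def)
    have "P v = W \<tau> v" for v
      unfolding Y(2)
    proof (rule linear_ode_unique[OF cB, of \<tau> "\<lambda>t. Y t v" "\<lambda>_. 0" "\<lambda>t. W t v"])
      show "((\<lambda>t. Y t v) has_vector_derivative B t (Y t v) + 0) (at t within {0..\<tau>})" if "t \<in> {0..\<tau>}" for t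
        using bounded_linear.has_vector_derivative[OF blinfun.bounded_linear_left Y(3)[OF that], of v] by simp
      show "((\<lambda>t. W t v) has_vector_derivative B t (W t v) + 0) (at t within {0..\<tau>})" if "t \<in> {0..\<tau>}" for t
        using that b has_vector_derivative_within_subset[OF Wv[of t v], of "{0..\<tau>}"] by auto
    qed (use Y(1) W(1) \<tau> in auto)
    then show "P = W \<tau>" by (rule blinfun_eqI)
  qed
  have shift: "W (t + \<tau>) v = W t (W \<tau> v)" if t: "0 \<le> t" "t + \<tau> \<le> b" for t v
  proof (rule linear_ode_unique[OF cB, of t "\<lambda>s. W (s + \<tau>) v" "\<lambda>_. 0" "\<lambda>s. W s (W \<tau> v)"])
    fix s assume s: "s \<in> {0..t}"
    have "((\<lambda>t. W t v) \<circ> (\<lambda>s. s + \<tau>) has_vector_derivative 1 *\<^sub>R B (s + \<tau>) (W (s + \<tau>) v)) (at s within {0..t})"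
      by (rule vector_diff_chain_within)
        (use s t \<tau> in \<open>auto intro!: derivative_eq_intros has_vector_derivative_within_subset[OF Wv]\<close>)
    then show "((\<lambda>s. W (s + \<tau>) v) has_vector_derivative B s (W (s + \<tau>) v) + 0) (at s within {0..t})"
      by (simp add: o_def Bper)
    show "((\<lambda>s. W s (W \<tau> v)) has_vector_derivative B s (W s (W \<tau> v)) + 0) (at s within {0..t})"
      using s t \<tau> has_vector_derivative_within_subset[OF Wv[of s "W \<tau> v"], of "{0..t}"] by auto
  qed (use W(1) t in auto)
  have shiftm: "W (t + real n * \<tau>) v = W t ((blinfun_apply (W \<tau>) ^^ n) v)"
    if "0 \<le> t" "t + real n * \<tau> \<le> b" for t v n
    using that
  proof (induction n arbitrary: v)
    case (Suc n)
    have "W (t + real (Suc n) * \<tau>) v = W ((t + real n * \<tau>) + \<tau>) v"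
      by (simp add: algebra_simps)
    also have "\<dots> = W (t + real n * \<tau>) (W \<tau> v)"
      using Suc.prems \<tau> by (intro shift) (auto simp: algebra_simps)
    also have "\<dots> = W t ((blinfun_apply (W \<tau>) ^^ n) (W \<tau> v))"
      using Suc.prems \<tau> by (intro Suc.IH) (auto simp: algebra_simps)
    finally show ?case by (simp add: funpow_swap1)
  qed simp
  have inj: "v = 0" if t: "t \<in> {0..b}" and 0: "W t v = 0" for t v
  proof -
    have "W (t - t) v = 0"
    proof (rule gronwall_zero[of t "\<lambda>s. W (t - s) v" "\<lambda>s. - B (t - s) (W (t - s) v)" "\<bar>K\<bar>" t])
      fix s assume s: "s \<in> {0..t}"
      have "((\<lambda>t. W t v) \<circ> (\<lambda>s. t - s) has_vector_derivative (-1) *\<^sub>R B (t - s) (W (t - s) v)) (at s within {0..t})"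
        by (rule vector_diff_chain_within)
          (use s t in \<open>auto intro!: derivative_eq_intros has_vector_derivative_within_subset[OF Wv]\<close>)
      then show "((\<lambda>s. W (t - s) v) has_vector_derivative - B (t - s) (W (t - s) v)) (at s within {0..t})"
        by (simp add: o_def)
      have "norm (B (t - s)) \<le> \<bar>K\<bar>" using K[of "t - s"] s t by auto
      then show "norm (- B (t - s) (W (t - s) v)) \<le> \<bar>K\<bar> * norm (W (t - s) v)"
        using norm_blinfun[of "B (t - s)" "W (t - s) v"]
          mult_right_mono[of "norm (B (t - s))" "\<bar>K\<bar>" "norm (W (t - s) v)"] by simp
    qed (use t 0 in auto)
    then show ?thesis by (simp add: W(1))
  qed
  have Wf: "W t (f (X 0)) = f (X t)" if t: "t \<in> {0..b}" for t
  proof (rule linear_ode_unique[OF cB, of b "\<lambda>t. W t (f (X 0))" "\<lambda>_. 0" "\<lambda>t. f (X t)" t])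
    show "((\<lambda>t. W t (f (X 0))) has_vector_derivative B t (W t (f (X 0))) + 0) (at t within {0..b})"
      if "t \<in> {0..b}" for t using Wv[OF that] by simp
    show "((\<lambda>t. f (X t)) has_vector_derivative B t (f (X t)) + 0) (at t within {0..b})"
      if "t \<in> {0..b}" for t
    proof -
      have "(X has_vector_derivative f (X t)) (at t within {0..b})"
        using X by (auto simp: solves_def intro: has_vector_derivative_at_within)
      then have d: "(X has_derivative (\<lambda>h. h *\<^sub>R f (X t))) (at t within {0..b})"
        by (simp add: has_vector_derivative_def)
      have "((\<lambda>t. f (X t)) has_derivative (\<lambda>h. f' (X t) (h *\<^sub>R f (X t)))) (at t within {0..b})"
        by (rule has_derivative_compose[OF d f'(1)[OF XS]])
      then show ?thesis
        by (simp add: has_vector_derivative_def B fd XS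
            linear_scale[OF has_derivative_linear[OF f'(1)[OF XS]]])
    qed
  qed (use W(1) t in auto)
  show ?thesis
    by (rule that[of W]) (use W(1) Wv B shiftm mon inj Wf in auto)
qed

text \<open>This makes normality independent of the base point on the orbit.\<close>

lemma fixed_space_conjugate:
  fixes A B V :: "'a::euclidean_space \<Rightarrow> 'a"
  assumes V: "linear V" "\<And>v. V v = 0 \<Longrightarrow> v = 0" and AB: "\<And>v. A (V v) = V (B v)"
    and normal: "dim {v. B v = v} = 1 \<or> dim {v. B v = v} = 2 \<and> x \<notin> range (\<lambda>v. B v - v)"
  shows "dim {v. A v = v} = 1 \<or> dim {v. A v = v} = 2 \<and> V x \<notin> range (\<lambda>v. A v - v)"
proof -
  have inj: "inj V" using linear_injective_0[OF V(1)] V(2) by blast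
  have surj: "surj V" by (rule linear_injective_imp_surjective[OF V(1) inj]) (rule refl)
  have "{v. A v = v} = V ` {v. B v = v}"
  proof (intro equalityI subsetI)
    fix y assume y: "y \<in> {v. A v = v}"
    obtain v where v: "y = V v" using surj by (metis surjD)
    then have "V (B v) = V v" using y AB by simp
    then show "y \<in> V ` {v. B v = v}" using v inj by (auto dest: injD)
  qed (auto simp: AB)
  then have "dim {v. A v = v} = dim {v. B v = v}"
    using dim_image_eq[OF V(1)] inj by (metis inj_on_subset subset_UNIV)
  moreover have "x \<in> range (\<lambda>v. B v - v)" if V': "V x \<in> range (\<lambda>v. A v - v)"
  proof -
    obtain y where y: "V x = A y - y" using V' by auto
    obtain v where v: "y = V v" using surj by (metis surjD)
    have "V x = V (B v - v)" using y by (simp add: v AB linear_diff[OF V(1)])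
    then show ?thesis using inj by (auto dest: injD)
  qed
  ultimately show ?thesis using normal by auto
qed

section \<open>Conservative systems with forcing\<close>

text \<open>The properties of a mechanical system on which the perturbation argument rests. Smoothness is required of
  the power \<open>grad H \<bullet> g\<close> of the forcing, because this is the integrand of the work.\<close>

locale conservative_system =
  fixes f :: "'a::euclidean_space \<Rightarrow> 'a" and g :: "'a \<Rightarrow> real \<Rightarrow> real \<Rightarrow> real \<Rightarrow> 'a"
    and S :: "'a set" and H :: "'a \<Rightarrow> real" and k :: nat
  assumes open_S: "open S"
    and f_Ck: "Ck_on (Suc k) f S"
    and g_Ck: "Ck_on (Suc k) (\<lambda>(x, t, T, \<epsilon>). g x t T \<epsilon>) (S \<times> UNIV \<times> {0<..} \<times> {0..})"
    and grad_H: "\<And>x. x \<in> S \<Longrightarrow> GDERIV H x :> grad H x"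
    and grad_continuous: "continuous_on S (grad H)"
    and conserved: "\<And>x. x \<in> S \<Longrightarrow> grad H x \<bullet> f x = 0"
    and regular: "\<And>x. x \<in> S \<Longrightarrow> f x \<noteq> 0 \<Longrightarrow> grad H x \<noteq> 0"
    and power_Ck: "Ck_on (Suc k) (\<lambda>(x, t, T, \<epsilon>). grad H x \<bullet> g x t T \<epsilon>) (S \<times> UNIV \<times> {0<..} \<times> {0..})"
    and periodic: "\<And>x t T \<epsilon>. x \<in> S \<Longrightarrow> 0 < T \<Longrightarrow> 0 \<le> \<epsilon> \<Longrightarrow> g x (t + T) T \<epsilon> = g x t T \<epsilon>"
begin

lemma f_C1: "Ck_on 1 f S"
  using Ck_along_le[OF f_Ck, of 1] by simp

lemma perturbed_field_C1:
  assumes "0 < T" "0 \<le> \<epsilon>"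
  shows "Ck_on 1 (\<lambda>z. perturbed_field f g T \<epsilon> (fst z) (snd z)) (UNIV \<times> S)"
proof -
  have h: "Ck_on 1 (\<lambda>z. (snd z, fst z, T, \<epsilon>)) (UNIV \<times> S)"
    by (intro Ck_along_Pair Ck_along_fst Ck_along_snd Ck_along_id Ck_along_const)
  have "Ck_on 1 (\<lambda>z. (\<lambda>(x, t, T, \<epsilon>). g x t T \<epsilon>) (snd z, fst z, T, \<epsilon>)) (UNIV \<times> S)"
    by (rule Ck_on_compose[OF Ck_along_le[OF g_Ck] h]) (use assms in auto)
  then have g1: "Ck_on 1 (\<lambda>z. g (snd z) (fst z) T \<epsilon>) (UNIV \<times> S)" by simp
  show ?thesis
    unfolding perturbed_field_def
    by (intro Ck_along_add Ck_along_scaleR Ck_along_const g1 Ck_on_autonomous[OF f_C1])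
qed

lemma perturbed_field_0: "perturbed_field f g T 0 = (\<lambda>_. f)"
  by (simp add: perturbed_field_def fun_eq_iff)

text \<open>\<open>X (u, (\<xi>, P), \<epsilon>)\<close> is the state at time \<open>u P\<close> of the trajectory from \<open>\<xi>\<close> under forcing of period \<open>P / l\<close>. Rescaled
  time turns \<open>P\<close> into an ordinary parameter; \<open>e \<le> P0\<close> ensures that all periods in the ball are positive.\<close>

definition flow_chart :: "real \<Rightarrow> 'a \<Rightarrow> real \<Rightarrow> real \<Rightarrow> (real \<times> ('a \<times> real) \<times> real \<Rightarrow> 'a) \<Rightarrow> bool" where
  "flow_chart l \<xi>0 P0 e X \<longleftrightarrow> 0 < e \<and> e \<le> P0 \<and>
     Ck_along spatial (Suc k) X ({0..1} \<times> (ball (\<xi>0, P0) e \<times> {0..<e})) \<and>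
     (\<forall>\<xi> P \<epsilon>. (\<xi>, P) \<in> ball (\<xi>0, P0) e \<longrightarrow> \<epsilon> \<in> {0..<e} \<longrightarrow>
        X (0, (\<xi>, P), \<epsilon>) = \<xi> \<and>
        solves (\<lambda>u x. P *\<^sub>R perturbed_field f g (P / l) \<epsilon> (u * P) x) S {0..1} (\<lambda>u. X (u, (\<xi>, P), \<epsilon>)))"

lemma flow_chart_pos:
  assumes "flow_chart l \<xi>0 P0 e X" "(\<xi>, P) \<in> ball (\<xi>0, P0) e"
  shows "0 < P"
proof -
  have "\<bar>P - P0\<bar> < e"
    using assms(2) dist_snd_le[of "(\<xi>0, P0)" "(\<xi>, P)"] by (simp add: dist_real_def)
  then show ?thesis using assms(1) by (auto simp: flow_chart_def)
qed

lemma flow_chart_shrink: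
  assumes "flow_chart l \<xi>0 P0 e X" "0 < e'" "e' \<le> e"
  shows "flow_chart l \<xi>0 P0 e' X"
proof -
  have sub: "ball (\<xi>0, P0) e' \<subseteq> ball (\<xi>0, P0) e" using assms(3) by auto
  have "Ck_along spatial (Suc k) X ({0..1} \<times> (ball (\<xi>0, P0) e' \<times> {0..<e'}))"
    by (rule Ck_along_subset[of _ _ _ "{0..1} \<times> (ball (\<xi>0, P0) e \<times> {0..<e})"])
      (use assms sub in \<open>auto simp: flow_chart_def simp del: Ck_along.simps\<close>)
  then show ?thesis
    using assms sub unfolding flow_chart_def by (meson atLeastLessThan_iff order.strict_trans2 order_trans subsetD)
qed

lemma flow_chart_exists:
  assumes l: "0 < l" and P0: "0 < P0" and x: "solves (\<lambda>_. f) S {0..P0} x"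
  obtains e X where "flow_chart l (x 0) P0 e X"
proof -
  define \<Lambda> where "\<Lambda> = (UNIV \<times> {0<..}) \<times> {0..} \<inter> (UNIV :: (('a \<times> real) \<times> real) set)"
  define F where "F = (\<lambda>(u::real, x::'a, (\<xi>::'a, P), \<epsilon>). P *\<^sub>R (f x + \<epsilon> *\<^sub>R g x (u * P) (P / l) \<epsilon>))"
  have cvx: "convex \<Lambda>" unfolding \<Lambda>_def
    by (intro convex_Int convex_Times convex_UNIV convex_real_interval)
  have F: "Ck_on (Suc k) F ({0..1} \<times> S \<times> \<Lambda>)"
  proof -
    have c: "Ck_on (Suc k) (\<lambda>z. (fst (snd z), fst z * snd (fst (snd (snd z))), snd (fst (snd (snd z))) / l, snd (snd (snd z))))
        ({0..1} \<times> S \<times> \<Lambda>)"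
      unfolding divide_inverse
      by (intro Ck_along_Pair Ck_along_fst Ck_along_snd Ck_along_id Ck_along_mult Ck_along_const)
    have "Ck_on (Suc k) (\<lambda>z. (\<lambda>(x, t, T, \<epsilon>). g x t T \<epsilon>)
        (fst (snd z), fst z * snd (fst (snd (snd z))), snd (fst (snd (snd z))) / l, snd (snd (snd z))))
        ({0..1} \<times> S \<times> \<Lambda>)"
      by (rule Ck_on_compose[OF g_Ck c]) (use l in \<open>auto simp: \<Lambda>_def\<close>)
    then have g1: "Ck_on (Suc k) (\<lambda>z. g (fst (snd z)) (fst z * snd (fst (snd (snd z))))
        (snd (fst (snd (snd z))) / l) (snd (snd (snd z)))) ({0..1} \<times> S \<times> \<Lambda>)"
      by (simp del: Ck_along.simps)
    have f1: "Ck_on (Suc k) (\<lambda>z. f (fst (snd z))) ({0..1} \<times> S \<times> \<Lambda>)"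
      by (rule Ck_on_compose[OF f_Ck, of _ "\<lambda>z. fst (snd z)"])
        (auto simp del: Ck_along.simps intro!: Ck_along_fst Ck_along_snd Ck_along_id)
    show ?thesis
      unfolding F_def split_beta
      by (intro Ck_along_scaleR Ck_along_add g1 f1 Ck_along_fst Ck_along_snd Ck_along_id)
  qed
  then have Fs: "Ck_along spatial (Suc k) F ({0..1} \<times> S \<times> \<Lambda>)"
    by (rule Ck_along_mono) simp
  define l0 where "l0 = ((x 0, P0), 0::real)"
  have l0: "l0 \<in> \<Lambda>" using P0 by (simp add: l0_def \<Lambda>_def)
  have xs: "solves (\<lambda>_ x. P0 *\<^sub>R f x) S {0..1} (\<lambda>u. x (P0 * u + 0))"
    by (rule solves_rescale[OF x]) (use P0 in \<open>auto simp: mult_left_le\<close>)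
  obtain \<rho> X where \<rho>: "0 < \<rho>"
    and X: "\<And>t l. t \<in> {0..1} \<Longrightarrow> l \<in> \<Lambda> \<inter> ball l0 \<rho> \<Longrightarrow>
      ((\<lambda>t. X (t, l)) has_vector_derivative F (t, X (t, l), l)) (at t within {0..1})"
    "\<And>t l. t \<in> {0..1} \<Longrightarrow> l \<in> \<Lambda> \<inter> ball l0 \<rho> \<Longrightarrow> X (t, l) \<in> S"
    "\<And>l. l \<in> \<Lambda> \<inter> ball l0 \<rho> \<Longrightarrow> X (0, l) = fst (fst l)"
    "continuous_on ({0..1} \<times> (\<Lambda> \<inter> ball l0 \<rho>)) X"
  proof (rule ode_local_flow[OF open_S Ck_along_le[OF Fs], of "\<lambda>u. x (P0 * u)" l0 "\<lambda>l. fst (fst l)"])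
    show "continuous_on \<Lambda> (\<lambda>l. fst (fst l))" by (intro continuous_intros)
  qed (use xs l0 in \<open>auto simp: solves_def F_def l0_def\<close>)
  have XC: "Ck_along spatial (Suc k) X ({0..1} \<times> (\<Lambda> \<inter> ball l0 \<rho>))"
  proof (rule Ck_solution_ode[OF open_S _ X(1,2,4)])
    show "convex (\<Lambda> \<inter> ball l0 \<rho>)" by (intro convex_Int cvx convex_ball)
    show "Ck_along spatial (Suc k) F ({0..1} \<times> S \<times> (\<Lambda> \<inter> ball l0 \<rho>))"
      by (rule Ck_along_subset[OF Fs]) auto
    have "Ck_on (Suc k) (\<lambda>l. fst (fst l)) (\<Lambda> \<inter> ball l0 \<rho>)"
      by (intro Ck_along_fst Ck_along_id)
    then show "Ck_on (Suc k) (\<lambda>l. X (0, l)) (\<Lambda> \<inter> ball l0 \<rho>)"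
      by (rule Ck_along_cong[THEN iffD2, rotated]) (rule X(3))
  qed
  define e where "e = min P0 (\<rho> / 2)"
  have e: "0 < e" "e \<le> P0" "2 * e \<le> \<rho>" using P0 \<rho> by (auto simp: e_def)
  have sub: "(z, \<epsilon>) \<in> \<Lambda> \<inter> ball l0 \<rho>" if z: "z \<in> ball (x 0, P0) e" and \<epsilon>: "\<epsilon> \<in> {0..<e}" for z \<epsilon>
  proof -
    have "\<bar>snd z - P0\<bar> < e"
      using z dist_snd_le[of "(x 0, P0)" z] by (simp add: dist_real_def)
    moreover have "dist l0 (z, \<epsilon>) < e + e"
      using z \<epsilon> sqrt_sum_squares_le_sum[of "dist (x 0, P0) z" "dist 0 \<epsilon>"]
      by (auto simp: l0_def dist_Pair_Pair)
    ultimately show ?thesis using e \<epsilon> by (cases z) (auto simp: \<Lambda>_def)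
  qed
  have "flow_chart l (x 0) P0 e X"
    unfolding flow_chart_def
  proof (intro conjI allI impI)
    show "Ck_along spatial (Suc k) X ({0..1} \<times> ball (x 0, P0) e \<times> {0..<e})"
      by (rule Ck_along_subset[OF XC]) (use sub in auto)
    fix \<xi> P \<epsilon> assume "(\<xi>, P) \<in> ball (x 0, P0) e" "\<epsilon> \<in> {0..<e}"
    note s = sub[OF this]
    show "X (0, (\<xi>, P), \<epsilon>) = \<xi>" using X(3)[OF s] by simp
    show "solves (\<lambda>u x. P *\<^sub>R perturbed_field f g (P / l) \<epsilon> (u * P) x) S {0..1} (\<lambda>u. X (u, (\<xi>, P), \<epsilon>))"
      using X(1)[OF _ s] X(2)[OF _ s] by (auto simp: solves_def F_def perturbed_field_def)
  qed (use e in auto)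
  then show ?thesis by (rule that)
qed

lemma flow_chart_traj:
  assumes ch: "flow_chart l \<xi>0 P0 e X" and l: "0 < l"
    and dom: "(\<xi>, P) \<in> ball (\<xi>0, P0) e" "\<epsilon> \<in> {0..<e}" and u: "u \<in> {0..1}"
  shows "traj_exists (perturbed_field f g (P / l) \<epsilon>) S \<xi> (u * P)"
    "traj (perturbed_field f g (P / l) \<epsilon>) S \<xi> (u * P) = X (u, (\<xi>, P), \<epsilon>)"
proof -
  have P: "0 < P" by (rule flow_chart_pos[OF ch dom(1)])
  have X: "X (0, (\<xi>, P), \<epsilon>) = \<xi>"
    "solves (\<lambda>u x. P *\<^sub>R perturbed_field f g (P / l) \<epsilon> (u * P) x) S {0..1} (\<lambda>u. X (u, (\<xi>, P), \<epsilon>))"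
    using ch dom unfolding flow_chart_def by blast+
  have seg: "closed_segment 0 (u * P) = {0..u * P}"
    using u P by (simp add: closed_segment_eq_real_ivl)
  have up: "u * P \<le> P" using u P by (simp add: mult_left_le_one_le)
  have s: "solves (perturbed_field f g (P / l) \<epsilon>) S (closed_segment 0 (u * P)) (\<lambda>t. X (t / P, (\<xi>, P), \<epsilon>))"
    unfolding seg
    using solves_rescale[OF X(2), of "{0..u * P}" "1 / P" 0] P up
    by (auto simp: perturbed_field_def[abs_def] divide_simps)
  show "traj_exists (perturbed_field f g (P / l) \<epsilon>) S \<xi> (u * P)"
    unfolding traj_exists_def by (intro exI conjI, rule s) (simp add: X(1))
  show "traj (perturbed_field f g (P / l) \<epsilon>) S \<xi> (u * P) = X (u, (\<xi>, P), \<epsilon>)"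
    using traj_eqI[OF open_S perturbed_field_C1 s, of \<xi>] X(1) P l dom(2) by simp
qed

text \<open>For \<open>\<epsilon> > 0\<close> this is the energy supplied by the forcing during the time \<open>P\<close>, divided by \<open>\<epsilon> P\<close>. The integral makes
  sense at \<open>\<epsilon> = 0\<close> as well.\<close>

definition work :: "real \<Rightarrow> (real \<times> ('a \<times> real) \<times> real \<Rightarrow> 'a) \<Rightarrow> ('a \<times> real) \<times> real \<Rightarrow> real" where
  "work l X z = integral {0..1} (\<lambda>u. grad H (X (u, z)) \<bullet>
     g (X (u, z)) (u * snd (fst z)) (snd (fst z) / l) (snd z))"

lemma power_Ck_chart:
  assumes ch: "flow_chart l \<xi>0 P0 e X" and l: "0 < l"
  shows "Ck_along spatial (Suc k) (\<lambda>z. grad H (X z) \<bullet> g (X z) (fst z * snd (fst (snd z)))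
      (snd (fst (snd z)) / l) (snd (snd z))) ({0..1} \<times> (ball (\<xi>0, P0) e \<times> {0..<e}))"
proof -
  define D where "D = {0..1::real} \<times> (ball (\<xi>0, P0) e \<times> {0..<e})"
  have X: "Ck_along spatial (Suc k) X D"
    using ch unfolding flow_chart_def D_def by blast
  have XS: "X z \<in> S" "0 < snd (fst (snd z))" "0 \<le> snd (snd z)" if z: "z \<in> D" for z
  proof -
    obtain u \<xi> P \<epsilon> where e: "z = (u, (\<xi>, P), \<epsilon>)" by (metis prod.collapse)
    then have d: "(\<xi>, P) \<in> ball (\<xi>0, P0) e" "\<epsilon> \<in> {0..<e}" "u \<in> {0..1}" using z by (auto simp: D_def)
    then have "solves (\<lambda>u x. P *\<^sub>R perturbed_field f g (P / l) \<epsilon> (u * P) x) S {0..1} (\<lambda>u. X (u, (\<xi>, P), \<epsilon>))"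
      using ch unfolding flow_chart_def by blast
    then show "X z \<in> S" using d e by (auto simp: solves_def)
    show "0 < snd (fst (snd z))" "0 \<le> snd (snd z)" using flow_chart_pos[OF ch d(1)] d e by auto
  qed
  have c: "Ck_along spatial (Suc k) (\<lambda>z. (X z, fst z * snd (fst (snd z)), snd (fst (snd z)) / l, snd (snd z))) D"
    unfolding divide_inverse
    by (intro Ck_along_Pair Ck_along_fst Ck_along_snd Ck_along_id Ck_along_mult Ck_along_const X)
  have "Ck_along spatial (Suc k) (\<lambda>z. (\<lambda>(x, t, T, \<epsilon>). grad H x \<bullet> g x t T \<epsilon>)
      (X z, fst z * snd (fst (snd z)), snd (fst (snd z)) / l, snd (snd z))) D"
    by (rule Ck_on_compose[OF power_Ck c]) (use XS l in auto)
  then show ?thesis by (simp add: D_def del: Ck_along.simps)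
qed

lemma work_Ck:
  assumes ch: "flow_chart l \<xi>0 P0 e X" and l: "0 < l"
  shows "Ck_on (Suc k) (work l X) (ball (\<xi>0, P0) e \<times> {0..<e})"
proof -
  have "convex (ball (\<xi>0, P0) e \<times> {0..<e})"
    by (intro convex_Times convex_ball convex_real_interval)
  from Ck_on_integral[OF power_Ck_chart[OF ch l] this] show ?thesis
    by (simp add: work_def[abs_def] del: Ck_along.simps)
qed

text \<open>Only the forcing does work, since the unperturbed field is tangent to the level sets of \<open>H\<close>.\<close>

lemma energy_balance:
  assumes ch: "flow_chart l \<xi>0 P0 e X" and l: "0 < l"
    and dom: "(\<xi>, P) \<in> ball (\<xi>0, P0) e" "\<epsilon> \<in> {0..<e}"
  shows "H (X (1, (\<xi>, P), \<epsilon>)) - H \<xi> = \<epsilon> * P * work l X ((\<xi>, P), \<epsilon>)"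
proof -
  have X: "X (0, (\<xi>, P), \<epsilon>) = \<xi>"
    "solves (\<lambda>u x. P *\<^sub>R perturbed_field f g (P / l) \<epsilon> (u * P) x) S {0..1} (\<lambda>u. X (u, (\<xi>, P), \<epsilon>))"
    using ch dom unfolding flow_chart_def by blast+
  define x where "x u = X (u, (\<xi>, P), \<epsilon>)" for u
  have "((\<lambda>u. H (x u)) has_vector_derivative
      \<epsilon> * P * (grad H (x u) \<bullet> g (x u) (u * P) (P / l) \<epsilon>)) (at u within {0..1})" if u: "u \<in> {0..1}" for u
  proof -
    have xS: "x u \<in> S" using X(2) u by (auto simp: solves_def x_def)
    have d: "(x has_derivative (\<lambda>h. h *\<^sub>R (P *\<^sub>R perturbed_field f g (P / l) \<epsilon> (u * P) (x u)))) (at u within {0..1})"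
      using X(2) u unfolding x_def by (auto simp: solves_def has_vector_derivative_def)
    have "((\<lambda>u. H (x u)) has_derivative
        (\<lambda>h. (h *\<^sub>R (P *\<^sub>R perturbed_field f g (P / l) \<epsilon> (u * P) (x u))) \<bullet> grad H (x u))) (at u within {0..1})"
      by (rule has_derivative_compose[OF d]) (use grad_H[OF xS] in \<open>simp add: gderiv_def\<close>)
    moreover have "(h *\<^sub>R (P *\<^sub>R perturbed_field f g (P / l) \<epsilon> (u * P) (x u))) \<bullet> grad H (x u)
        = h * (\<epsilon> * P * (grad H (x u) \<bullet> g (x u) (u * P) (P / l) \<epsilon>))" for h
      using conserved[OF xS] by (simp add: perturbed_field_def inner_add_right inner_commute[of _ "grad H (x u)"])
    ultimately show ?thesis by (simp only: has_vector_derivative_def real_scaleR_def)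
  qed
  from fundamental_theorem_of_calculus[OF zero_le_one this]
  have "((\<lambda>u. \<epsilon> * P * (grad H (x u) \<bullet> g (x u) (u * P) (P / l) \<epsilon>)) has_integral H (x 1) - H (x 0)) {0..1}"
    by simp
  then have "H (x 1) - H (x 0) = integral {0..1} (\<lambda>u. \<epsilon> * P * (grad H (x u) \<bullet> g (x u) (u * P) (P / l) \<epsilon>))"
    by (rule integral_unique[symmetric])
  then show ?thesis
    using X(1) by (simp add: work_def x_def)
qed

end

section \<open>The Melnikov function as work along the orbit\<close>

locale forced_orbit = conservative_system f g S H k
  for f :: "'a::euclidean_space \<Rightarrow> 'a" and g S H k +
  fixes X\<^sub>0 :: "real \<Rightarrow> 'a" and \<tau> :: real and l m :: nat
  assumes orbit: "solves (\<lambda>_. f) S UNIV X\<^sub>0"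
    and orbit_periodic: "\<And>t. X\<^sub>0 (t + \<tau>) = X\<^sub>0 t" and \<tau>_pos: "0 < \<tau>"
    and orbit_traj: "\<And>s t. traj0 f S (X\<^sub>0 s) t = X\<^sub>0 (s + t)"
    and orbit_nonzero: "\<And>t. f (X\<^sub>0 t) \<noteq> 0"
    and lm: "0 < l" "0 < m"
begin

definition "P\<^sub>0 = real m * \<tau>"

abbreviation "M \<equiv> melnikov f g H S l m \<tau> (X\<^sub>0 0)"

lemma P0_pos: "0 < P\<^sub>0"
  using \<tau>_pos lm by (simp add: P\<^sub>0_def)

lemma orbit_in: "X\<^sub>0 t \<in> S"
  using orbit by (simp add: solves_def)

lemma orbit_derivative: "(X\<^sub>0 has_vector_derivative f (X\<^sub>0 t)) (at t within A)"
  using orbit by (auto simp: solves_def intro: has_vector_derivative_at_within)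

lemma orbit_continuous: "continuous_on A X\<^sub>0"
  by (rule continuous_on_vector_derivative[OF orbit_derivative])

lemma orbit_P0: "X\<^sub>0 (t + P\<^sub>0) = X\<^sub>0 t"
  unfolding P\<^sub>0_def by (rule periodic_nat_shift) (rule orbit_periodic)

definition "power_along s t = grad H (X\<^sub>0 (t + s)) \<bullet> g (X\<^sub>0 (t + s)) t (P\<^sub>0 / real l) 0"

lemma melnikov_eq: "M s = integral {0..P\<^sub>0} (power_along s)"
  by (simp add: melnikov_def power_along_def[abs_def] orbit_traj P\<^sub>0_def mult.commute)

lemma power_along_continuous:
  "continuous_on A (\<lambda>z. power_along (fst z) (snd z))"
proof -
  have "continuous_on A (\<lambda>z. (\<lambda>(x, t, T, \<epsilon>). grad H x \<bullet> g x t T \<epsilon>)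
      (X\<^sub>0 (snd z + fst z), snd z, P\<^sub>0 / real l, 0))"
    by (rule continuous_on_compose2[OF Ck_along_continuous[OF power_Ck]])
      (use orbit_in P0_pos lm in \<open>auto intro!: continuous_intros continuous_on_compose2[OF orbit_continuous[of UNIV]]\<close>)
  then show ?thesis by (simp add: power_along_def)
qed

lemma melnikov_continuous: "continuous_on UNIV M"
proof -
  have "continuous_on (UNIV \<times> cbox 0 P\<^sub>0) (\<lambda>(s, t). power_along s t)"
    using power_along_continuous by (simp add: split_beta)
  from integral_continuous_on_param[OF this] show ?thesis
    by (simp add: melnikov_eq[abs_def])
qed

lemma melnikov_periodic: "M (s + \<tau>) = M s"
  using orbit_periodic[of "t + s" for t]
  by (simp add: melnikov_eq power_along_def[abs_def] add.assoc)

lemma chart_base: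
  assumes P: "0 < P"
  obtains e X where "flow_chart (real l) (X\<^sub>0 s) P e X"
proof -
  have sol: "solves (\<lambda>_. f) S {0..P} (\<lambda>t. X\<^sub>0 (s + t))"
    using solves_rescale[OF orbit, of "{0..P}" 1 s] by (simp add: add.commute)
  show ?thesis
    by (rule flow_chart_exists[of "real l", OF _ P sol]) (use lm that in auto)
qed

lemma chart_traj0:
  assumes ch: "flow_chart (real l) \<xi>0 P' e X" and dom: "(\<xi>, P) \<in> ball (\<xi>0, P') e" and u: "u \<in> {0..1}"
  shows "X (u, (\<xi>, P), 0) = traj0 f S \<xi> (u * P)"
proof -
  have "0 < e" using ch by (simp add: flow_chart_def)
  then have "traj (perturbed_field f g (P / real l) 0) S \<xi> (u * P) = X (u, (\<xi>, P), 0)"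
    by (intro flow_chart_traj(2)[OF ch _ dom _ u]) (use lm in auto)
  then show ?thesis by (simp add: perturbed_field_0)
qed

lemma chart_orbit:
  assumes ch: "flow_chart (real l) \<xi>0 P' e X" and dom: "(X\<^sub>0 s, P) \<in> ball (\<xi>0, P') e" and u: "u \<in> {0..1}"
  shows "X (u, (X\<^sub>0 s, P), 0) = X\<^sub>0 (s + u * P)"
  using chart_traj0[OF ch dom u] by (simp add: orbit_traj)

lemma work_orbit:
  assumes ch: "flow_chart (real l) \<xi>0 P\<^sub>0 e X" and dom: "(X\<^sub>0 s, P\<^sub>0) \<in> ball (\<xi>0, P\<^sub>0) e"
  shows "work (real l) X ((X\<^sub>0 s, P\<^sub>0), 0) = M s / P\<^sub>0"
proof -
  have c: "continuous_on {0..P\<^sub>0} (power_along s)"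
    using continuous_on_compose2[OF power_along_continuous[of UNIV], of "{0..P\<^sub>0}" "\<lambda>t. (s, t)"]
    by (simp add: continuous_intros)
  have "(power_along s has_integral M s) (cbox 0 P\<^sub>0)"
    using integrable_integral[OF integrable_continuous_interval[OF c]] by (simp add: melnikov_eq)
  from has_integral_affinity'[OF this P0_pos, of 0]
  have "((\<lambda>u. power_along s (P\<^sub>0 * u)) has_integral M s / P\<^sub>0) {0..1}"
    using P0_pos by (simp add: divide_inverse mult.commute)
  then have "integral {0..1} (\<lambda>u. power_along s (P\<^sub>0 * u)) = M s / P\<^sub>0"
    by (rule integral_unique)
  moreover have "work (real l) X ((X\<^sub>0 s, P\<^sub>0), 0) = integral {0..1} (\<lambda>u. power_along s (P\<^sub>0 * u))"
    unfolding work_def by (rule integral_cong)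
      (simp add: chart_orbit[OF ch dom] power_along_def add.commute mult.commute)
  ultimately show ?thesis by simp
qed

text \<open>On a closed trajectory with \<open>\<epsilon> > 0\<close> the work vanishes by the energy balance. Continuity of the work carries
  this over to the limit \<open>\<epsilon> \<rightarrow> 0\<close>, where the work is a value of the Melnikov function.\<close>

theorem not_persistent:
  assumes c: "0 < c" "\<And>s. c \<le> \<bar>M s\<bar>"
  shows "\<not> smoothly_persists r f g S L l m \<tau> (X\<^sub>0 0)"
proof
  assume "smoothly_persists r f g S L l m \<tau> (X\<^sub>0 0)"
  then obtain \<epsilon>0 \<xi> T s where \<epsilon>0: "0 < \<epsilon>0"
    and \<xi>: "(\<lambda>\<epsilon>. norm (\<xi> \<epsilon> - X\<^sub>0 s)) \<in> O[at_right 0](\<lambda>\<epsilon>. \<epsilon>)"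
    and T: "(\<lambda>\<epsilon>. T \<epsilon> - P\<^sub>0 / real l) \<in> O[at_right 0](\<lambda>\<epsilon>. \<epsilon>)"
    and per: "\<And>\<epsilon>. \<epsilon> \<in> {0..<\<epsilon>0} \<Longrightarrow> traj (perturbed_field f g (T \<epsilon>) \<epsilon>) S (\<xi> \<epsilon>) (real l * T \<epsilon>) = \<xi> \<epsilon>"
    unfolding smoothly_persists_def by (auto simp: orbit_traj P\<^sub>0_def mult.commute)
  have O: "(h \<longlongrightarrow> 0) (at_right 0)" if h: "h \<in> O[at_right 0](\<lambda>\<epsilon>. \<epsilon>)" for h :: "real \<Rightarrow> real"
  proof -
    obtain C where "\<forall>\<^sub>F \<epsilon> in at_right 0. norm (h \<epsilon>) \<le> C * norm \<epsilon>"
      by (rule landau_o.bigE[OF h])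
    moreover have "((\<lambda>\<epsilon>::real. C * norm \<epsilon>) \<longlongrightarrow> C * norm (0::real)) (at_right 0)"
      by (rule tendsto_mult_left[OF tendsto_norm[OF tendsto_ident_at]])
    ultimately show ?thesis
      by (intro Lim_null_comparison[of h "\<lambda>\<epsilon>. C * norm \<epsilon>"]) (simp_all only: norm_zero mult_zero_right)
  qed
  have \<xi>lim: "(\<xi> \<longlongrightarrow> X\<^sub>0 s) (at_right 0)"
    using O[OF \<xi>] by (simp add: tendsto_norm_zero_iff LIM_zero_iff)
  have Tlim: "((\<lambda>\<epsilon>. real l * T \<epsilon>) \<longlongrightarrow> P\<^sub>0) (at_right 0)"
  proof -
    have "(T \<longlongrightarrow> P\<^sub>0 / real l) (at_right 0)"
      using O[OF T] by (simp add: LIM_zero_iff)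
    from tendsto_mult_left[OF this, of "real l"] show ?thesis using lm by simp
  qed
  obtain e X where ch: "flow_chart (real l) (X\<^sub>0 s) P\<^sub>0 e X"
    by (rule chart_base[OF P0_pos])
  have e: "0 < e" using ch by (simp add: flow_chart_def)
  define D where "D = ball (X\<^sub>0 s, P\<^sub>0) e \<times> {0..<e}"
  define z where "z \<epsilon> = ((\<xi> \<epsilon>, real l * T \<epsilon>), \<epsilon>)" for \<epsilon>
  have zlim: "(z \<longlongrightarrow> ((X\<^sub>0 s, P\<^sub>0), 0)) (at_right 0)"
    unfolding z_def by (intro tendsto_Pair \<xi>lim Tlim tendsto_ident_at)
  have "\<forall>\<^sub>F \<epsilon> in at_right 0. (\<xi> \<epsilon>, real l * T \<epsilon>) \<in> ball (X\<^sub>0 s, P\<^sub>0) e"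
    by (rule topological_tendstoD[OF tendsto_Pair[OF \<xi>lim Tlim]]) (use e in auto)
  moreover have "\<forall>\<^sub>F \<epsilon> in at_right 0. \<epsilon> \<in> {0<..<min e \<epsilon>0}"
    using e \<epsilon>0 by (intro eventually_at_right_real) auto
  ultimately have ev: "\<forall>\<^sub>F \<epsilon> in at_right 0. z \<epsilon> \<in> D \<and> work (real l) X (z \<epsilon>) = 0"
  proof eventually_elim
    case (elim \<epsilon>)
    have P: "0 < real l * T \<epsilon>" by (rule flow_chart_pos[OF ch elim(1)])
    have "X (1, z \<epsilon>) = \<xi> \<epsilon>"
      using flow_chart_traj(2)[OF ch _ elim(1), of \<epsilon> 1] per[of \<epsilon>] elim(2) lm by (simp add: z_def)
    moreover have "H (X (1, z \<epsilon>)) - H (\<xi> \<epsilon>) = \<epsilon> * (real l * T \<epsilon>) * work (real l) X (z \<epsilon>)"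
      unfolding z_def by (rule energy_balance[OF ch _ elim(1)]) (use elim lm in auto)
    ultimately show ?case using elim P by (auto simp: D_def z_def)
  qed
  have base: "((X\<^sub>0 s, P\<^sub>0), 0) \<in> D" using e by (simp add: D_def)
  have "(work (real l) X \<longlongrightarrow> work (real l) X ((X\<^sub>0 s, P\<^sub>0), 0)) (at ((X\<^sub>0 s, P\<^sub>0), 0) within D)"
    using Ck_along_continuous[OF work_Ck[OF ch]] base lm by (auto simp: continuous_on_def D_def)
  moreover have "filterlim z (at ((X\<^sub>0 s, P\<^sub>0), 0) within D) (at_right 0)"
    unfolding filterlim_at
  proof (intro conjI zlim)
    show "\<forall>\<^sub>F \<epsilon> in at_right 0. z \<epsilon> \<in> D \<and> z \<epsilon> \<noteq> ((X\<^sub>0 s, P\<^sub>0), 0)"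
      using ev eventually_at_right_less[of 0] by eventually_elim (auto simp: z_def)
  qed
  ultimately have "((\<lambda>\<epsilon>. work (real l) X (z \<epsilon>)) \<longlongrightarrow> work (real l) X ((X\<^sub>0 s, P\<^sub>0), 0)) (at_right 0)"
    by (rule filterlim_compose)
  moreover have "((\<lambda>\<epsilon>. work (real l) X (z \<epsilon>)) \<longlongrightarrow> 0) (at_right 0)"
    by (rule tendsto_eventually) (use ev in eventually_elim, auto)
  ultimately have "work (real l) X ((X\<^sub>0 s, P\<^sub>0), 0) = 0"
    by (rule tendsto_unique[rotated]) simp
  moreover have "work (real l) X ((X\<^sub>0 s, P\<^sub>0), 0) = M s / P\<^sub>0"
    by (rule work_orbit[OF ch]) (use e in simp)
  ultimately show False using c(1) c(2)[of s] P0_pos by simp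
qed

end

section \<open>Persistence from a simple zero\<close>

lemma Ck_spatial_section:
  fixes F :: "real \<times> 'a::euclidean_space \<Rightarrow> 'b::real_normed_vector"
  assumes "Ck_along spatial k F (I \<times> E)" "t \<in> I"
  shows "Ck_on k (\<lambda>w. F (t, w)) E"
proof (rule Ck_along_compose[where W'=spatial and h="\<lambda>w. (t, w)", OF subspace_spatial spatial_representation _ _ assms(1)])
  show "Ck_on k (\<lambda>w. (t, w)) E" by (intro Ck_along_Pair Ck_along_const Ck_along_id)
qed (use assms(2) in \<open>auto simp: spatial_def\<close>)

lemma Ck_on_slice_derivative:
  fixes G :: "'a::euclidean_space \<times> real \<Rightarrow> 'b::real_normed_vector"
  assumes G: "Ck_on (Suc k) G (W \<times> {0..<e})" and W: "open W" "y \<in> W" "0 < e"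
  obtains G' where "((\<lambda>y. G (y, 0)) has_derivative G') (at y)"
proof -
  obtain G' where G': "\<And>x. x \<in> W \<times> {0..<e} \<Longrightarrow> (G has_derivative G' x) (at x within W \<times> {0..<e})"
    using G by (auto elim!: Ck_along_SucE)
  have "((\<lambda>y. G (y, 0)) has_derivative (\<lambda>v. G' (y, 0) (v, 0))) (at y within W)"
    by (rule has_derivative_in_compose[where f="\<lambda>y. (y, 0)" and g=G])
      (use W in \<open>auto intro!: derivative_eq_intros has_derivative_subset[OF G']\<close>)
  then show ?thesis using that at_within_open[OF W(2,1)] by simp
qed

text \<open>A derivative in one direction can be read off from a single curve along which the function is known.\<close>

lemma curve_derivative_eq:
  assumes G: "(G has_derivative G') (at (\<gamma> c))" and \<gamma>: "(\<gamma> has_vector_derivative \<gamma>') (at c)"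
    and h: "(h has_vector_derivative h') (at c)" and eq: "\<forall>\<^sub>F x in nhds c. G (\<gamma> x) = h x"
  shows "G' \<gamma>' = h'"
proof -
  have "((\<lambda>x. G (\<gamma> x)) has_derivative (\<lambda>v. G' (v *\<^sub>R \<gamma>'))) (at c)"
    by (rule has_derivative_compose[where f=\<gamma> and g=G, OF _ G]) (use \<gamma> in \<open>simp add: has_vector_derivative_def\<close>)
  then have "((\<lambda>x. G (\<gamma> x)) has_vector_derivative G' \<gamma>') (at c)"
    by (simp add: has_vector_derivative_def linear_scale[OF has_derivative_linear[OF G]])
  then have "(h has_vector_derivative G' \<gamma>') (at c)"
    unfolding has_vector_derivative_def
    by (rule has_derivative_transform_eventually)
      (use eq eventually_nhds_x_imp_x[OF eq] in \<open>auto simp: eventually_at_filter elim: eventually_mono\<close>)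
  then show ?thesis
    using h by (rule vector_derivative_unique_at)
qed

lemma isCont_eventually_in:
  assumes "isCont \<gamma> c" "open W" "\<gamma> c \<in> W"
  shows "\<forall>\<^sub>F x in nhds c. \<gamma> x \<in> W"
proof -
  have "(\<gamma> \<longlongrightarrow> \<gamma> c) (nhds c)"
    using assms(1) unfolding isCont_def tendsto_at_iff_tendsto_nhds .
  from topological_tendstoD[OF this assms(2,3)] show ?thesis .
qed

lemma C1_increment_bigo:
  fixes h :: "real \<Rightarrow> 'b::real_normed_vector"
  assumes h: "Ck_on (Suc k) h {0..<d}" and d: "0 < d"
  shows "(\<lambda>\<epsilon>. norm (h \<epsilon> - h 0)) \<in> O[at_right 0](\<lambda>\<epsilon>. \<epsilon>)"
proof -
  obtain h' where "(h has_vector_derivative h') (at 0 within {0..<d})"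
    using h d by (elim Ck_on_real_SucE) auto
  then have D: "\<forall>e>0. \<exists>\<delta>>0. \<forall>y\<in>{0..<d}. norm (y - 0) < \<delta> \<longrightarrow> norm (h y - h 0 - (y - 0) *\<^sub>R h') \<le> e * norm (y - 0)"
    by (simp add: has_vector_derivative_def has_derivative_within_alt)
  obtain \<delta> where \<delta>: "0 < \<delta>" "\<And>y. y \<in> {0..<d} \<Longrightarrow> \<bar>y\<bar> < \<delta> \<Longrightarrow> norm (h y - h 0 - y *\<^sub>R h') \<le> \<bar>y\<bar>"
    using D[rule_format, OF zero_less_one] by auto
  have "norm (h \<epsilon> - h 0) \<le> (1 + norm h') * \<epsilon>" if "\<epsilon> \<in> {0<..<min d \<delta>}" for \<epsilon>
    using \<delta>(2)[of \<epsilon>] that norm_triangle_sub[of "h \<epsilon> - h 0" "\<epsilon> *\<^sub>R h'"] by (simp add: algebra_simps)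
  then have "\<forall>\<^sub>F \<epsilon> in at_right 0. norm (norm (h \<epsilon> - h 0)) \<le> (1 + norm h') * norm \<epsilon>"
    using eventually_at_right_real[of 0 "min d \<delta>"] d \<delta>(1) by (auto elim!: eventually_mono)
  then show ?thesis by (rule bigoI)
qed

context forced_orbit
begin

text \<open>The derivative of the period map at \<open>X\<^sub>0 s0\<close> is conjugate to the \<open>m\<close>-th power of the monodromy at \<open>X\<^sub>0 0\<close> by the
  fundamental matrix at time \<open>s0\<close>.\<close>

lemma flow_derivative_normal:
  assumes s0: "0 \<le> s0" and ch: "flow_chart (real l) (X\<^sub>0 s0) P\<^sub>0 e X"
    and A: "((\<lambda>\<xi>. X (1, (\<xi>, P\<^sub>0), 0)) has_derivative A) (at (X\<^sub>0 s0))"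
    and normal: "m_normal f S m \<tau> (X\<^sub>0 0)"
  shows "dim {v. A v = v} = 1 \<or> dim {v. A v = v} = 2 \<and> f (X\<^sub>0 s0) \<notin> range (\<lambda>v. A v - v)"
proof -
  define Mon where "Mon = blinfun_apply (monodromy f S \<tau> (X\<^sub>0 0)) ^^ m"
  have Mon: "dim {v. Mon v = v} = 1 \<or> dim {v. Mon v = v} = 2 \<and> f (X\<^sub>0 0) \<notin> range (\<lambda>v. Mon v - v)"
    using normal by (simp add: m_normal_def geometric_multiplicity_def Mon_def Let_def)
  obtain f' where f': "\<And>x. x \<in> S \<Longrightarrow> (f has_derivative f' x) (at x)" "\<And>v. continuous_on S (\<lambda>x. f' x v)"
    using f_C1 unfolding One_nat_def by (auto elim!: Ck_along_SucE simp: at_within_open[OF _ open_S])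
  have fd: "frechet_derivative f (at x) = f' x" if "x \<in> S" for x
    using frechet_derivative_at[OF f'(1)[OF that]] by simp
  define b where "b = s0 + P\<^sub>0"
  have "\<tau> \<le> P\<^sub>0" unfolding P\<^sub>0_def using \<tau>_pos lm by simp
  then have b: "\<tau> \<le> b" "0 \<le> b" "s0 \<in> {0..b}" using s0 P0_pos \<tau>_pos by (auto simp: b_def)
  obtain W :: "real \<Rightarrow> 'a \<Rightarrow>\<^sub>L 'a" where W: "W 0 = id_blinfun"
    "\<And>t v. t \<in> {0..b} \<Longrightarrow> ((\<lambda>t. W t v) has_vector_derivative f' (X\<^sub>0 t) (W t v)) (at t within {0..b})"
    "\<And>v. W (s0 + P\<^sub>0) v = W s0 (Mon v)"
    "\<And>t v. t \<in> {0..b} \<Longrightarrow> W t v = 0 \<Longrightarrow> v = 0"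
    "\<And>t. t \<in> {0..b} \<Longrightarrow> W t (f (X\<^sub>0 0)) = f (X\<^sub>0 t)"
  proof (rule monodromy_propagator[where m=m, OF open_S f_C1 orbit orbit_periodic \<tau>_pos _ b(1)], goal_cases)
    case 1 show ?case using orbit_traj[of 0] by simp
  next
    case (2 W)
    show ?case
      by (rule 2(1)[of W])
        (use 2(2,3,5,6) 2(4)[of s0] s0 in \<open>auto simp: fd orbit_in Mon_def P\<^sub>0_def b_def\<close>)
  qed
  define B where "B = ball (X\<^sub>0 s0) e"
  define Xs where "Xs z = X (fst z, (snd z, P\<^sub>0), 0)" for z
  have e: "0 < e" using ch by (simp add: flow_chart_def)
  have dom: "(\<xi>, P\<^sub>0) \<in> ball (X\<^sub>0 s0, P\<^sub>0) e" if "\<xi> \<in> B" for \<xi>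
    using that by (simp add: B_def dist_Pair_Pair)
  have base: "X\<^sub>0 s0 \<in> B" using e by (simp add: B_def)
  obtain Y where Y: "\<And>v l. l \<in> B \<Longrightarrow> Y v (0, l) = v"
    "\<And>v t l. t \<in> {0..1} \<Longrightarrow> l \<in> B \<Longrightarrow>
      ((\<lambda>t. Y v (t, l)) has_vector_derivative P\<^sub>0 *\<^sub>R f' (Xs (t, l)) (Y v (t, l))) (at t within {0..1})"
    "\<And>t l. t \<in> {0..1} \<Longrightarrow> l \<in> B \<Longrightarrow>
      ((\<lambda>l. Xs (t, l)) has_derivative (\<lambda>v. Y v (t, l))) (at l within B)"
  proof (rule ode_variational_equation[where F="\<lambda>z. P\<^sub>0 *\<^sub>R f (fst (snd z))" and \<Lambda>=B and X=Xs and R=S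
        and F'="\<lambda>u w v. P\<^sub>0 *\<^sub>R f' (fst w) (fst v)" and \<iota>'="\<lambda>_ v. v"], goal_cases)
    case (3 t w)
    have "((\<lambda>w. f (fst w)) has_derivative (\<lambda>v. f' (fst w) (fst v))) (at w within S \<times> B)"
      by (rule has_derivative_compose[where f=fst and g=f])
        (use 3 f'(1) in \<open>auto intro!: derivative_eq_intros\<close>)
    then show ?case by (auto intro: has_derivative_scaleR_right)
  next
    case (4 v)
    show ?case
      by (intro continuous_intros continuous_on_compose2[OF f'(2)]) auto
  next
    case (5 t \<xi>)
    have "solves (\<lambda>u x. P\<^sub>0 *\<^sub>R perturbed_field f g (P\<^sub>0 / l) 0 (u * P\<^sub>0) x) S {0..1} (\<lambda>u. X (u, (\<xi>, P\<^sub>0), 0))"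
      using ch dom[OF 5(3)] e unfolding flow_chart_def by auto
    then show ?case using 5(2) by (auto simp: solves_def perturbed_field_def Xs_def)
  next
    case (6 t \<xi>)
    have "solves (\<lambda>u x. P\<^sub>0 *\<^sub>R perturbed_field f g (P\<^sub>0 / l) 0 (u * P\<^sub>0) x) S {0..1} (\<lambda>u. X (u, (\<xi>, P\<^sub>0), 0))"
      using ch dom[OF 6(3)] e unfolding flow_chart_def by auto
    then show ?case using 6(2) by (auto simp: solves_def Xs_def)
  next
    case 7
    have "continuous_on ({0..1} \<times> (ball (X\<^sub>0 s0, P\<^sub>0) e \<times> {0..<e})) X"
      using ch unfolding flow_chart_def by (blast intro: Ck_along_continuous)
    then show ?case
      unfolding Xs_def by (rule continuous_on_compose2) (use dom e in \<open>auto intro!: continuous_intros\<close>)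
  next
    case (8 \<xi>)
    have "Xs (0, x) = x" if "x \<in> B" for x
      using ch dom[OF that] e unfolding flow_chart_def Xs_def by auto
    then show ?case
      using 8 by (intro has_derivative_transform_eq[OF has_derivative_ident]) auto
  next
    case (9 Y)
    then show ?case by (intro 9(1)[of Y]) auto
  qed (auto simp: B_def open_S)
  have Xs: "Xs (u, X\<^sub>0 s0) = X\<^sub>0 (s0 + u * P\<^sub>0)" if "u \<in> {0..1}" for u
    unfolding Xs_def using chart_orbit[OF ch dom[OF base] that] by simp
  have AY: "A v = Y v (1, X\<^sub>0 s0)" for v
  proof -
    have "((\<lambda>l. Xs (1, l)) has_derivative (\<lambda>v. Y v (1, X\<^sub>0 s0))) (at (X\<^sub>0 s0))"
      using Y(3)[of 1, OF _ base] at_within_open[OF base] by (simp add: B_def)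
    then have "((\<lambda>l. X (1, (l, P\<^sub>0), 0)) has_derivative (\<lambda>v. Y v (1, X\<^sub>0 s0))) (at (X\<^sub>0 s0))"
      by (simp add: Xs_def)
    from has_derivative_unique[OF this A] show ?thesis by metis
  qed
  have AW: "A (W s0 v) = W s0 (Mon v)" for v
  proof -
    define C where "C u = P\<^sub>0 *\<^sub>R Blinfun (f' (X\<^sub>0 (s0 + u * P\<^sub>0)))" for u
    have C: "blinfun_apply (C u) v = P\<^sub>0 *\<^sub>R f' (X\<^sub>0 (s0 + u * P\<^sub>0)) v" for u v
      using has_derivative_bounded_linear[OF f'(1)[OF orbit_in]]
      by (simp add: C_def blinfun.scaleR_left bounded_linear_Blinfun_apply)
    have cC: "continuous_on {0..1} C"
      by (rule continuous_on_blinfun_componentwise) (auto simp: C orbit_in intro!: continuous_intros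
          continuous_on_compose2[OF f'(2)] continuous_on_compose2[OF orbit_continuous[of UNIV]])
    have "Y (W s0 v) (1, X\<^sub>0 s0) = W (s0 + 1 * P\<^sub>0) v"
    proof (rule linear_ode_unique[OF cC, of "\<lambda>u. Y (W s0 v) (u, X\<^sub>0 s0)" "\<lambda>_. 0" "\<lambda>u. W (s0 + u * P\<^sub>0) v"])
      fix u :: real assume u: "u \<in> {0..1}"
      show "((\<lambda>u. Y (W s0 v) (u, X\<^sub>0 s0)) has_vector_derivative C u (Y (W s0 v) (u, X\<^sub>0 s0)) + 0) (at u within {0..1})"
        using Y(2)[OF u base, of "W s0 v"] by (simp add: C Xs[OF u])
      have im: "(\<lambda>u. s0 + u * P\<^sub>0) ` {0..1} \<subseteq> {0..b}"
        using s0 P0_pos by (auto simp: b_def mult_left_le_one_le)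
      have "((\<lambda>t. W t v) \<circ> (\<lambda>u. s0 + u * P\<^sub>0) has_vector_derivative
          P\<^sub>0 *\<^sub>R f' (X\<^sub>0 (s0 + u * P\<^sub>0)) (W (s0 + u * P\<^sub>0) v)) (at u within {0..1})"
      proof (rule vector_diff_chain_within)
        show "((\<lambda>u. s0 + u * P\<^sub>0) has_vector_derivative P\<^sub>0) (at u within {0..1})"
          by (auto intro!: derivative_eq_intros simp: has_vector_derivative_def)
        show "((\<lambda>t. W t v) has_vector_derivative f' (X\<^sub>0 (s0 + u * P\<^sub>0)) (W (s0 + u * P\<^sub>0) v))
            (at (s0 + u * P\<^sub>0) within (\<lambda>u. s0 + u * P\<^sub>0) ` {0..1})"
          by (rule has_vector_derivative_within_subset[OF W(2) im]) (use im u in blast)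
      qed
      then show "((\<lambda>u. W (s0 + u * P\<^sub>0) v) has_vector_derivative C u (W (s0 + u * P\<^sub>0) v) + 0) (at u within {0..1})"
        by (simp add: o_def C)
    qed (use Y(1)[OF base] in auto)
    then show ?thesis using W(3) by (simp add: AY)
  qed
  have lW: "linear (blinfun_apply (W s0))"
    by (rule bounded_linear.linear[OF blinfun.bounded_linear_right])
  show ?thesis
    using fixed_space_conjugate[OF lW W(4)[OF b(3)] AW Mon] W(5)[OF b(3)] by simp
qed

text \<open>The family of periodic orbits enters through a curve \<open>(xc, Pc)\<close> of initial points and periods which passes
  through \<open>X\<^sub>0 s0\<close>, the point selected by the zero of the Melnikov function.\<close>

theorem persistent:
  fixes L :: "'a \<Rightarrow> real \<Rightarrow> real"
  assumes D: "open D" "\<And>t. (X\<^sub>0 t, P\<^sub>0) \<in> D" and L: "Ck_on (Suc k) (\<lambda>(\<xi>, P). L \<xi> P) D"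
    and L0: "\<And>t. L (X\<^sub>0 t) P\<^sub>0 = c0"
    and xc: "(xc has_vector_derivative x') (at c0)" "xc c0 = X\<^sub>0 s0"
    and Pc: "(Pc has_vector_derivative P') (at c0)" "Pc c0 = P\<^sub>0"
    and family: "\<forall>\<^sub>F c in nhds c0. traj0 f S (xc c) (Pc c) = xc c \<and> L (xc c) (Pc c) = c"
    and s0: "0 \<le> s0" and zero: "simple_zero M s0" and normal: "m_normal f S m \<tau> (X\<^sub>0 0)"
  shows "smoothly_persists (Suc (Suc k)) f g S L l m \<tau> (X\<^sub>0 0)"
proof -
  obtain d where d: "M s0 = 0" "(M has_real_derivative d) (at s0)" "d \<noteq> 0"
    using zero by (auto simp: simple_zero_def)
  have l: "0 < real l" using lm by simp
  define \<xi>0 where "\<xi>0 = X\<^sub>0 s0"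
  define n where "n = grad H \<xi>0"
  have \<xi>0S: "\<xi>0 \<in> S" by (simp add: \<xi>0_def orbit_in)
  have n: "n \<noteq> 0" unfolding n_def using regular[OF \<xi>0S] orbit_nonzero by (simp add: \<xi>0_def)
  then have nn: "0 < n \<bullet> n" by simp
  obtain e0 X where ch0: "flow_chart (real l) \<xi>0 P\<^sub>0 e0 X"
    unfolding \<xi>0_def by (rule chart_base[OF P0_pos])
  have e0: "0 < e0" using ch0 by (simp add: flow_chart_def)
  \<comment> \<open>On a small ball the energy is strictly monotone in the direction \<open>n\<close>.\<close>
  obtain \<rho> where \<rho>: "0 < \<rho>" "ball \<xi>0 \<rho> \<subseteq> S" "\<And>x. x \<in> ball \<xi>0 \<rho> \<Longrightarrow> 0 < grad H x \<bullet> n"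
  proof -
    have "open {x \<in> S. 0 < grad H x \<bullet> n}"
    proof -
      have "continuous_on S (\<lambda>x. grad H x \<bullet> n)" by (intro continuous_intros grad_continuous)
      from continuous_open_preimage[OF this open_S, of "{0<..}"] show ?thesis
        by (simp add: vimage_def Int_def)
    qed
    moreover have "\<xi>0 \<in> {x \<in> S. 0 < grad H x \<bullet> n}" using \<xi>0S nn by (simp add: n_def)
    ultimately obtain r where "0 < r" "ball \<xi>0 r \<subseteq> {x \<in> S. 0 < grad H x \<bullet> n}"
      by (rule openE)
    then show ?thesis using that[of r] by blast
  qed
  define Dm0 where "Dm0 = ball (\<xi>0, P\<^sub>0) e0 \<times> {0..<e0}"
  define \<Phi> where "\<Phi> z = X (1, z)" for z
  have \<Phi>C0: "Ck_on (Suc k) \<Phi> Dm0"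
    unfolding \<Phi>_def[abs_def] Dm0_def
    by (rule Ck_spatial_section[of _ _ "{0..1}"]) (use ch0 in \<open>simp_all only: flow_chart_def, simp\<close>)
  have base0: "((\<xi>0, P\<^sub>0), 0) \<in> Dm0" using e0 by (simp add: Dm0_def)
  have \<Phi>base: "\<Phi> ((\<xi>0, P\<^sub>0), 0) = \<xi>0"
    using chart_orbit[OF ch0, of s0 P\<^sub>0 1] e0 by (simp add: \<Phi>_def \<xi>0_def orbit_P0)
  obtain e1 where e1: "0 < e1" "\<And>z. z \<in> Dm0 \<Longrightarrow> dist z ((\<xi>0, P\<^sub>0), 0) < e1 \<Longrightarrow> \<Phi> z \<in> ball \<xi>0 \<rho>"
  proof -
    have "continuous_on Dm0 \<Phi>" by (rule Ck_along_continuous[OF \<Phi>C0])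
    then have "\<exists>e>0. \<forall>z\<in>Dm0. dist z ((\<xi>0, P\<^sub>0), 0) < e \<longrightarrow> dist (\<Phi> z) (\<Phi> ((\<xi>0, P\<^sub>0), 0)) < \<rho>"
      using base0 \<rho>(1) unfolding continuous_on_iff by blast
    then show ?thesis using that unfolding \<Phi>base by (auto simp: dist_commute)
  qed
  obtain e2 where e2: "0 < e2" "ball (\<xi>0, P\<^sub>0) e2 \<subseteq> D"
    using openE[OF D(1) D(2)[of s0]] unfolding \<xi>0_def by blast
  define e where "e = Min {e0, e1 / 2, e2, \<rho>}"
  have e: "0 < e" "e \<le> e0" "2 * e \<le> e1" "e \<le> e2" "e \<le> \<rho>"
    using e0 e1 e2 \<rho> by (auto simp: e_def)
  have ch: "flow_chart (real l) \<xi>0 P\<^sub>0 e X" by (rule flow_chart_shrink[OF ch0 e(1,2)])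
  define W where "W = ball (\<xi>0, P\<^sub>0) e"
  have W: "open W" "(\<xi>0, P\<^sub>0) \<in> W" using e by (auto simp: W_def)
  have WD: "W \<subseteq> D" using e2(2) e(4) unfolding W_def by (meson subset_ball subset_trans)
  have \<Phi>ball: "\<Phi> z \<in> ball \<xi>0 \<rho>" if z: "z \<in> W \<times> {0..<e}" for z
  proof (rule e1(2))
    show "z \<in> Dm0" using z e(2) by (auto simp: W_def Dm0_def)
    have "dist (fst z) (\<xi>0, P\<^sub>0) < e" "dist (snd z) 0 < e" using z by (auto simp: W_def dist_commute)
    then show "dist z ((\<xi>0, P\<^sub>0), 0) < e1"
      using sqrt_sum_squares_le_sum[of "dist (fst z) (\<xi>0, P\<^sub>0)" "dist (snd z) 0"] e(3)
      by (auto simp: dist_prod_def)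
  qed
  have \<Phi>C: "Ck_on (Suc k) \<Phi> (W \<times> {0..<e})"
    by (rule Ck_along_subset[OF \<Phi>C0]) (use e(2) in \<open>auto simp: W_def Dm0_def\<close>)
  define w where "w = work (real l) X"
  have wC: "Ck_on (Suc k) w (W \<times> {0..<e})"
    unfolding w_def W_def by (rule work_Ck[OF ch l])
  define Lf where "Lf y = L (fst y) (snd y)" for y
  have LfD: "Ck_on (Suc k) Lf W"
    using Ck_along_subset[OF L WD] unfolding Lf_def[abs_def] case_prod_beta' .
  have LfC: "Ck_on (Suc k) (\<lambda>z. Lf (fst z)) (W \<times> {0..<e})"
    by (rule Ck_on_compose[OF LfD Ck_along_fst[OF Ck_along_id]]) auto
  \<comment> \<open>The work replaces the component of the displacement along \<open>n\<close>.\<close>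
  define F where "F z = (\<Phi> z - fst (fst z) - (((\<Phi> z - fst (fst z)) \<bullet> n) / (n \<bullet> n)) *\<^sub>R n + w z *\<^sub>R n,
      Lf (fst z) - c0)" for z
  have FC: "Ck_on (Suc k) F (W \<times> {0..<e})"
    unfolding F_def[abs_def] divide_inverse
    by (intro Ck_along_Pair Ck_along_add Ck_along_diff Ck_along_scaleR Ck_along_mult Ck_along_inner
        Ck_along_fst Ck_along_id Ck_along_const \<Phi>C wC LfC)
  have wbase: "w ((X\<^sub>0 s, P\<^sub>0), 0) = M s / P\<^sub>0" if "(X\<^sub>0 s, P\<^sub>0) \<in> W" for s
    unfolding w_def by (rule work_orbit[OF ch]) (use that in \<open>simp add: W_def\<close>)
  have F0: "F ((\<xi>0, P\<^sub>0), 0) = 0"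
    using wbase[of s0] W(2) d(1) L0[of s0] by (simp add: F_def \<Phi>base Lf_def zero_prod_def \<xi>0_def[symmetric])
  obtain \<Psi> where \<Psi>: "((\<lambda>y. \<Phi> (y, 0)) has_derivative \<Psi>) (at (\<xi>0, P\<^sub>0))"
    by (rule Ck_on_slice_derivative[OF \<Phi>C W e(1)])
  obtain w' where w': "((\<lambda>y. w (y, 0)) has_derivative w') (at (\<xi>0, P\<^sub>0))"
    by (rule Ck_on_slice_derivative[OF wC W e(1)])
  obtain Lf' where Lf': "(Lf has_derivative Lf') (at (\<xi>0, P\<^sub>0))"
    by (rule Ck_on_slice_derivative[OF LfC W e(1)]) simp
  define J where "J v = (\<Psi> v - fst v - (((\<Psi> v - fst v) \<bullet> n) / (n \<bullet> n)) *\<^sub>R n + w' v *\<^sub>R n, Lf' v)" for v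
  have J: "((\<lambda>y. F (y, 0)) has_derivative J) (at (\<xi>0, P\<^sub>0))"
  proof -
    have "((\<lambda>y. (\<Phi> (y, 0) - fst y - (((\<Phi> (y, 0) - fst y) \<bullet> n) * inverse (n \<bullet> n)) *\<^sub>R n + w (y, 0) *\<^sub>R n, Lf y - c0))
        has_derivative (\<lambda>v. (\<Psi> v - fst v - (((\<Psi> v - fst v) \<bullet> n) * inverse (n \<bullet> n)) *\<^sub>R n + w' v *\<^sub>R n, Lf' v - 0)))
        (at (\<xi>0, P\<^sub>0))"
      by (intro has_derivative_Pair has_derivative_add has_derivative_diff has_derivative_scaleR_left
          has_derivative_mult_left has_derivative_inner_left \<Psi> w' Lf' has_derivative_fst has_derivative_ident
          has_derivative_const)
    then show ?thesis by (simp add: F_def J_def[abs_def] divide_inverse)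
  qed
  have lin: "linear \<Psi>" "linear w'" "linear Lf'"
    using \<Psi> w' Lf' has_derivative_linear by blast+
  \<comment> \<open>The action of the derivatives on \<open>v0\<close>, on the period direction and on the tangent of the family
    is read off from curves on which \<open>\<Phi>\<close>, \<open>w\<close> and \<open>Lf\<close> are known.\<close>
  have nearW: "\<forall>\<^sub>F s in nhds s0. (X\<^sub>0 s, P\<^sub>0) \<in> W"
  proof -
    have "isCont (\<lambda>s. (X\<^sub>0 s, P\<^sub>0)) s0"
      using orbit_continuous[of UNIV] by (intro continuous_intros) (simp add: continuous_on_eq_continuous_at)
    from isCont_eventually_in[OF this W(1)] W(2) show ?thesis by (simp add: \<xi>0_def)
  qed
  define v0 where "v0 = (f \<xi>0, 0::real)"
  have cv: "((\<lambda>s. (X\<^sub>0 s, P\<^sub>0)) has_vector_derivative v0) (at s0)"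
    unfolding v0_def \<xi>0_def by (intro has_vector_derivative_Pair orbit_derivative has_vector_derivative_const)
  have \<Psi>v0: "\<Psi> v0 = f \<xi>0"
  proof (rule curve_derivative_eq[where \<gamma>="\<lambda>s. (X\<^sub>0 s, P\<^sub>0)" and c=s0 and h="X\<^sub>0" and G="\<lambda>y. \<Phi> (y, 0)"])
    show "\<forall>\<^sub>F s in nhds s0. \<Phi> ((X\<^sub>0 s, P\<^sub>0), 0) = X\<^sub>0 s"
      using nearW by eventually_elim (simp add: \<Phi>_def chart_orbit[OF ch] W_def orbit_P0)
  qed (use \<Psi> cv orbit_derivative[of s0] in \<open>auto simp: \<xi>0_def\<close>)
  have w'v0: "w' v0 = d / P\<^sub>0"
  proof (rule curve_derivative_eq[where \<gamma>="\<lambda>s. (X\<^sub>0 s, P\<^sub>0)" and c=s0 and h="\<lambda>s. M s / P\<^sub>0" and G="\<lambda>y. w (y, 0)"])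
    show "\<forall>\<^sub>F s in nhds s0. w ((X\<^sub>0 s, P\<^sub>0), 0) = M s / P\<^sub>0"
      using nearW by eventually_elim (rule wbase)
    show "((\<lambda>s. M s / P\<^sub>0) has_vector_derivative d / P\<^sub>0) (at s0)"
      using d(2) by (intro has_vector_derivative_divide)
        (simp add: has_real_derivative_iff_has_vector_derivative)
  qed (use w' cv in \<open>auto simp: \<xi>0_def\<close>)
  have Lf'v0: "Lf' v0 = 0"
  proof (rule curve_derivative_eq[where \<gamma>="\<lambda>s. (X\<^sub>0 s, P\<^sub>0)" and c=s0 and h="\<lambda>_. c0" and G=Lf])
    show "\<forall>\<^sub>F s in nhds s0. Lf (X\<^sub>0 s, P\<^sub>0) = c0" by (simp add: Lf_def L0)
  qed (use Lf' cv in \<open>auto simp: \<xi>0_def\<close>)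
  have ct: "((\<lambda>P. (\<xi>0, P)) has_vector_derivative (0, 1)) (at P\<^sub>0)"
    by (intro has_vector_derivative_Pair has_vector_derivative_const has_vector_derivative_id)
  have \<Psi>t: "\<Psi> (0, 1) = f \<xi>0"
  proof (rule curve_derivative_eq[where \<gamma>="\<lambda>P. (\<xi>0, P)" and c="P\<^sub>0" and h="\<lambda>P. X\<^sub>0 (s0 + P)" and G="\<lambda>y. \<Phi> (y, 0)"])
    have "isCont (\<lambda>P. (\<xi>0, P)) P\<^sub>0" by (intro continuous_intros)
    from isCont_eventually_in[OF this W] show "\<forall>\<^sub>F P in nhds P\<^sub>0. \<Phi> ((\<xi>0, P), 0) = X\<^sub>0 (s0 + P)"
      by eventually_elim (use chart_orbit[OF ch, of s0 _ 1] in \<open>simp add: \<Phi>_def W_def \<xi>0_def\<close>)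
    have "(X\<^sub>0 \<circ> (\<lambda>P. s0 + P) has_vector_derivative 1 *\<^sub>R f (X\<^sub>0 (s0 + P\<^sub>0))) (at P\<^sub>0)"
      by (rule vector_diff_chain_at[OF _ orbit_derivative]) (auto intro!: derivative_eq_intros)
    then show "((\<lambda>P. X\<^sub>0 (s0 + P)) has_vector_derivative f \<xi>0) (at P\<^sub>0)"
      by (simp add: o_def orbit_P0 \<xi>0_def)
  qed (use \<Psi> ct in auto)
  have cf: "((\<lambda>c. (xc c, Pc c)) has_vector_derivative (x', P')) (at c0)"
    by (intro has_vector_derivative_Pair xc Pc)
  have cf0: "(xc c0, Pc c0) = (\<xi>0, P\<^sub>0)" using xc Pc by (simp add: \<xi>0_def)
  have nearF: "\<forall>\<^sub>F c in nhds c0. (xc c, Pc c) \<in> W"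
  proof -
    have "isCont (\<lambda>c. (xc c, Pc c)) c0"
      using has_vector_derivative_continuous[OF cf] .
    from isCont_eventually_in[OF this W(1)] W(2) show ?thesis unfolding cf0 by blast
  qed
  have \<Psi>f: "\<Psi> (x', P') = x'"
  proof (rule curve_derivative_eq[where \<gamma>="\<lambda>c. (xc c, Pc c)" and c=c0 and h=xc and G="\<lambda>y. \<Phi> (y, 0)"])
    show "\<forall>\<^sub>F c in nhds c0. \<Phi> ((xc c, Pc c), 0) = xc c"
      using nearF family by eventually_elim (use chart_traj0[OF ch, of _ _ 1] in \<open>simp add: \<Phi>_def W_def\<close>)
  qed (use \<Psi> cf xc(1) in \<open>auto simp: cf0\<close>)
  have Lf'f: "Lf' (x', P') = 1"
  proof (rule curve_derivative_eq[where \<gamma>="\<lambda>c. (xc c, Pc c)" and c=c0 and h="\<lambda>c. c" and G=Lf])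
    show "\<forall>\<^sub>F c in nhds c0. Lf (xc c, Pc c) = c"
      using family by eventually_elim (simp add: Lf_def)
  qed (use Lf' cf in \<open>auto simp: cf0\<close>)
  define A where "A v = \<Psi> (v, 0)" for v
  have A: "((\<lambda>\<xi>. X (1, (\<xi>, P\<^sub>0), 0)) has_derivative A) (at (X\<^sub>0 s0))"
  proof -
    have "((\<lambda>\<xi>. \<Phi> ((\<xi>, P\<^sub>0), 0)) has_derivative (\<lambda>v. \<Psi> (v, 0))) (at \<xi>0)"
      by (rule has_derivative_compose[where f="\<lambda>\<xi>. (\<xi>, P\<^sub>0)" and g="\<lambda>y. \<Phi> (y, 0)"])
        (use \<Psi> in \<open>auto intro!: derivative_eq_intros\<close>)
    then show ?thesis by (simp add: \<Phi>_def A_def[abs_def] \<xi>0_def)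
  qed
  have \<Psi>A: "\<Psi> (x, y) = A x + y *\<^sub>R f \<xi>0" for x y
  proof -
    have "(x, y) = (x, 0) + y *\<^sub>R (0, 1)" by simp
    then show ?thesis
      unfolding A_def \<Psi>t[symmetric] by (metis linear_add[OF lin(1)] linear_scale[OF lin(1)])
  qed
  have linA: "linear A" using A by (rule has_derivative_linear)
  \<comment> \<open>Differentiating the conservation law \<open>H (\<Phi> (y, 0)) = H (fst y)\<close>.\<close>
  have conserve: "(\<Psi> v - fst v) \<bullet> n = 0" for v
  proof -
    have HG: "(H has_derivative (\<lambda>h. h \<bullet> n)) (at \<xi>0)"
      using grad_H[OF \<xi>0S] by (simp add: gderiv_def n_def)
    have "((\<lambda>y. H (\<Phi> (y, 0))) has_derivative (\<lambda>v. \<Psi> v \<bullet> n)) (at (\<xi>0, P\<^sub>0))"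
      by (rule has_derivative_compose[where g=H, OF \<Psi>]) (simp add: \<Phi>base HG)
    moreover have "((\<lambda>y. H (\<Phi> (y, 0))) has_derivative (\<lambda>v. fst v \<bullet> n)) (at (\<xi>0, P\<^sub>0))"
    proof (rule has_derivative_transform_within_open[OF _ W])
      show "((\<lambda>y. H (fst y)) has_derivative (\<lambda>v. fst v \<bullet> n)) (at (\<xi>0, P\<^sub>0))"
        by (rule has_derivative_compose[where g=H and f=fst]) (auto intro!: derivative_eq_intros simp: HG)
      show "H (fst y) = H (\<Phi> (y, 0))" if "y \<in> W" for y
        using energy_balance[OF ch l, of "fst y" "snd y" 0] that e(1) by (simp add: W_def \<Phi>_def)
    qed
    ultimately have "(\<lambda>v. \<Psi> v \<bullet> n) = (\<lambda>v. fst v \<bullet> n)" by (rule has_derivative_unique)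
    then have "\<Psi> v \<bullet> n = fst v \<bullet> n" by metis
    then show ?thesis by (simp add: inner_diff_left)
  qed
  have Jinj: "v = 0" if "J v = 0" for v
  proof -
    have J1: "\<Psi> v - fst v + w' v *\<^sub>R n = 0" "Lf' v = 0"
      using that by (auto simp: J_def conserve zero_prod_def)
    have "(\<Psi> v - fst v + w' v *\<^sub>R n) \<bullet> n = 0" using J1(1) by simp
    then have w0: "w' v = 0" using conserve[of v] n by (simp add: inner_add_left)
    then have \<Psi>v: "\<Psi> v = fst v" using J1(1) by simp
    have "\<exists>c. (fst v, snd v) = c *\<^sub>R (f \<xi>0, 0)"
    proof (rule transversal_kernel[OF linA lin(3)])
      show "f \<xi>0 \<noteq> 0" by (simp add: \<xi>0_def orbit_nonzero)
      show "A (f \<xi>0) = f \<xi>0" using \<Psi>v0 by (simp add: v0_def A_def)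
      show "Lf' (f \<xi>0, 0) = 0" using Lf'v0 by (simp add: v0_def)
      show "A x' + P' *\<^sub>R f \<xi>0 = x'" using \<Psi>f by (simp add: \<Psi>A)
      show "A (fst v) + snd v *\<^sub>R f \<xi>0 = fst v" using \<Psi>v \<Psi>A[of "fst v" "snd v"] by simp
      show "dim {v. A v = v} = 1 \<or> dim {v. A v = v} = 2 \<and> f \<xi>0 \<notin> range (\<lambda>v. A v - v)"
        using flow_derivative_normal[OF s0 _ A normal] ch unfolding \<xi>0_def by blast
    qed (use Lf'f J1(2) in auto)
    then obtain c where c: "v = c *\<^sub>R v0" by (auto simp: v0_def)
    then have "c * (d / P\<^sub>0) = 0" using w0 w'v0 by (simp add: linear_scale[OF lin(2)])
    then have "c = 0" using d(3) P0_pos by simp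
    then show ?thesis using c by simp
  qed
  obtain dd y where dd: "0 < dd" "dd \<le> e" and yC: "Ck_on (Suc k) y {0..<dd}" and y0: "y 0 = (\<xi>0, P\<^sub>0)"
    and y: "\<And>\<epsilon>. \<epsilon> \<in> {0..<dd} \<Longrightarrow> y \<epsilon> \<in> W \<and> F (y \<epsilon>, \<epsilon>) = 0"
    using implicit_curve[OF FC W(1) e(1) W(2) F0 J Jinj] by blast
  have sol: "\<Phi> (y \<epsilon>, \<epsilon>) = fst (y \<epsilon>) \<and> Lf (y \<epsilon>) = c0" if \<epsilon>: "\<epsilon> \<in> {0..<dd}" for \<epsilon>
  proof -
    define \<xi> where "\<xi> = fst (y \<epsilon>)"
    define dl where "dl = \<Phi> (y \<epsilon>, \<epsilon>) - \<xi>"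
    define \<kappa> where "\<kappa> = (dl \<bullet> n) / (n \<bullet> n)"
    have F1: "dl - \<kappa> *\<^sub>R n + w (y \<epsilon>, \<epsilon>) *\<^sub>R n = 0" and L1: "Lf (y \<epsilon>) = c0"
      using y[OF \<epsilon>] by (auto simp: F_def dl_def \<kappa>_def \<xi>_def zero_prod_def)
    have "(dl - \<kappa> *\<^sub>R n + w (y \<epsilon>, \<epsilon>) *\<^sub>R n) \<bullet> n = 0" using F1 by simp
    then have w0: "w (y \<epsilon>, \<epsilon>) = 0"
      using n by (simp add: \<kappa>_def inner_add_left inner_diff_left)
    then have dl\<kappa>: "\<Phi> (y \<epsilon>, \<epsilon>) = \<xi> + \<kappa> *\<^sub>R n" using F1 by (simp add: dl_def algebra_simps)
    have yW: "(fst (y \<epsilon>), snd (y \<epsilon>)) \<in> ball (\<xi>0, P\<^sub>0) e" using y[OF \<epsilon>] by (simp add: W_def)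
    have "H (\<Phi> (y \<epsilon>, \<epsilon>)) - H \<xi> = 0"
      using energy_balance[OF ch l yW, of \<epsilon>] \<epsilon> dd w0 by (simp add: \<Phi>_def w_def \<xi>_def)
    then have Heq: "H (\<xi> + \<kappa> *\<^sub>R n) = H \<xi>" by (simp add: dl\<kappa>)
    have b1: "\<xi> \<in> ball \<xi>0 \<rho>"
      using yW dist_fst_le[of "(\<xi>0, P\<^sub>0)" "y \<epsilon>"] e(5) by (simp add: \<xi>_def)
    have b2: "\<xi> + \<kappa> *\<^sub>R n \<in> ball \<xi>0 \<rho>"
      using \<Phi>ball[of "(y \<epsilon>, \<epsilon>)"] y[OF \<epsilon>] \<epsilon> dd by (simp add: dl\<kappa>)
    have seg: "\<xi> + t *\<^sub>R (\<kappa> *\<^sub>R n) \<in> ball \<xi>0 \<rho>" if "0 \<le> t" "t \<le> 1" for t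
      using convexD_alt[OF convex_ball b1 b2, of t] that by (simp add: algebra_simps)
    have "\<exists>t\<in>{0<..<1}. H (\<xi> + 1 *\<^sub>R (\<kappa> *\<^sub>R n)) - H (\<xi> + 0 *\<^sub>R (\<kappa> *\<^sub>R n))
        = (1 - 0) * (\<kappa> * (grad H (\<xi> + t *\<^sub>R (\<kappa> *\<^sub>R n)) \<bullet> n))"
    proof (rule mvt_simple[where f="\<lambda>t. H (\<xi> + t *\<^sub>R (\<kappa> *\<^sub>R n))"
          and f'="\<lambda>t h. h * (\<kappa> * (grad H (\<xi> + t *\<^sub>R (\<kappa> *\<^sub>R n)) \<bullet> n))"])
      fix t :: real assume t: "0 \<le> t" "t \<le> 1"
      have "((\<lambda>t. H (\<xi> + t *\<^sub>R (\<kappa> *\<^sub>R n))) has_derivative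
          (\<lambda>h. (h *\<^sub>R (\<kappa> *\<^sub>R n)) \<bullet> grad H (\<xi> + t *\<^sub>R (\<kappa> *\<^sub>R n)))) (at t within {0..1})"
        by (rule has_derivative_compose[where g=H and f="\<lambda>t. \<xi> + t *\<^sub>R (\<kappa> *\<^sub>R n)"])
          (use grad_H[of "\<xi> + t *\<^sub>R (\<kappa> *\<^sub>R n)"] seg[OF t] \<rho>(2) in
            \<open>auto intro!: derivative_eq_intros simp: gderiv_def\<close>)
      then show "((\<lambda>t. H (\<xi> + t *\<^sub>R (\<kappa> *\<^sub>R n))) has_derivative
          (\<lambda>h. h * (\<kappa> * (grad H (\<xi> + t *\<^sub>R (\<kappa> *\<^sub>R n)) \<bullet> n)))) (at t within {0..1})"
        by (simp add: inner_commute mult.assoc)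
    qed simp
    then obtain t where t: "0 < t" "t < 1" "\<kappa> * (grad H (\<xi> + t *\<^sub>R (\<kappa> *\<^sub>R n)) \<bullet> n) = 0"
      using Heq by auto
    have "0 < grad H (\<xi> + t *\<^sub>R (\<kappa> *\<^sub>R n)) \<bullet> n" by (rule \<rho>(3)[OF seg]) (use t in auto)
    then have "\<kappa> = 0" using t(3) by simp
    then show ?thesis using dl\<kappa> L1 by (simp add: \<xi>_def)
  qed
  show ?thesis
    unfolding smoothly_persists_def
  proof (rule exI[of _ dd], rule conjI[OF dd(1)], rule exI[of _ "\<lambda>\<epsilon>. fst (y \<epsilon>)"],
      rule exI[of _ "\<lambda>\<epsilon>. snd (y \<epsilon>) / real l"], rule exI[of _ s0], intro conjI ballI)
    have c1: "Ck_on (Suc k) (\<lambda>\<epsilon>. fst (y \<epsilon>)) {0..<dd}" by (rule Ck_along_fst[OF yC])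
    have c2: "Ck_on (Suc k) (\<lambda>\<epsilon>. snd (y \<epsilon>) / real l) {0..<dd}"
      unfolding divide_inverse by (intro Ck_along_mult Ck_along_snd yC Ck_along_const)
    show "Ck_on (Suc (Suc k) - 1) (\<lambda>\<epsilon>. fst (y \<epsilon>)) {0..<dd}"
      "Ck_on (Suc (Suc k) - 1) (\<lambda>\<epsilon>. snd (y \<epsilon>) / real l) {0..<dd}" using c1 c2 by simp_all
    show "(\<lambda>\<epsilon>. norm (fst (y \<epsilon>) - traj0 f S (X\<^sub>0 0) s0)) \<in> O[at_right 0](\<lambda>\<epsilon>. \<epsilon>)"
      using C1_increment_bigo[OF c1 dd(1)] by (simp add: y0 orbit_traj \<xi>0_def)
    show "(\<lambda>\<epsilon>. snd (y \<epsilon>) / real l - \<tau> * real m / real l) \<in> O[at_right 0](\<lambda>\<epsilon>. \<epsilon>)"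
      using C1_increment_bigo[OF c2 dd(1)] by (simp add: y0 P\<^sub>0_def mult.commute)
    fix \<epsilon> assume \<epsilon>: "\<epsilon> \<in> {0..<dd}"
    have yW: "(fst (y \<epsilon>), snd (y \<epsilon>)) \<in> ball (\<xi>0, P\<^sub>0) e" using y[OF \<epsilon>] by (simp add: W_def)
    have \<epsilon>': "\<epsilon> \<in> {0..<e}" using \<epsilon> dd by simp
    show "0 < snd (y \<epsilon>) / real l" using flow_chart_pos[OF ch yW] l by simp
    have lT: "real l * (snd (y \<epsilon>) / real l) = snd (y \<epsilon>)" using l by simp
    show "traj_exists (perturbed_field f g (snd (y \<epsilon>) / real l) \<epsilon>) S (fst (y \<epsilon>)) (real l * (snd (y \<epsilon>) / real l))"
      using flow_chart_traj(1)[OF ch l yW \<epsilon>', of 1] unfolding lT by simp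
    show "traj (perturbed_field f g (snd (y \<epsilon>) / real l) \<epsilon>) S (fst (y \<epsilon>)) (real l * (snd (y \<epsilon>) / real l)) = fst (y \<epsilon>)"
      using flow_chart_traj(2)[OF ch l yW \<epsilon>', of 1] sol[OF \<epsilon>] unfolding lT by (simp add: \<Phi>_def)
    show "L (fst (y \<epsilon>)) (real l * (snd (y \<epsilon>) / real l)) = L (X\<^sub>0 0) (real m * \<tau>)"
      using sol[OF \<epsilon>] L0[of 0] unfolding lT by (simp add: Lf_def P\<^sub>0_def)
  qed
qed

text \<open>The given parametrisation passes through some point \<open>X\<^sub>0 a\<close> of the orbit; the flow over the time \<open>ts\<close> moves it
  to \<open>X\<^sub>0 s0\<close>, where \<open>persistent\<close> requires it.\<close>

theorem persistent_family:
  assumes L: "family_parametrisation (Suc (Suc k)) f S m \<tau> (X\<^sub>0 0) L"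
    and normal: "m_normal f S m \<tau> (X\<^sub>0 0)" and zero: "simple_zero M s"
  shows "smoothly_persists (Suc (Suc k)) f g S L l m \<tau> (X\<^sub>0 0)"
proof -
  obtain D where D: "open D" "\<And>t. (X\<^sub>0 t, P\<^sub>0) \<in> D" "Ck_on (Suc (Suc k)) (\<lambda>(\<xi>, P). L \<xi> P) D"
    using L unfolding family_parametrisation_def by (auto simp: orbit_traj P\<^sub>0_def simp del: Ck_along.simps)
  define c0 where "c0 = L (X\<^sub>0 0) P\<^sub>0"
  obtain \<delta> \<theta> per where \<delta>: "0 < \<delta>"
    and \<theta>: "Ck_on 1 \<theta> {c0 - \<delta> <..< c0 + \<delta>}" "\<theta> c0 \<in> range (traj0 f S (X\<^sub>0 0))"
    and per: "Ck_on 1 per {c0 - \<delta> <..< c0 + \<delta>}" "per c0 = \<tau>"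
    and orb: "\<And>c. c \<in> {c0 - \<delta> <..< c0 + \<delta>} \<Longrightarrow> (\<exists>Z. periodic_orbit f S (per c) Z \<and> \<theta> c \<in> Z) \<and>
        (\<forall>t. L (traj0 f S (\<theta> c) t) (real m * per c) = c)"
    using L unfolding family_parametrisation_def Let_def c0_def P\<^sub>0_def by blast
  define J where "J = {c0 - \<delta> <..< c0 + \<delta>}"
  have J: "open J" "c0 \<in> J" using \<delta> by (auto simp: J_def)
  have nearJ: "\<forall>\<^sub>F c in nhds c0. c \<in> J" using J by (rule eventually_nhds_in_open)
  obtain \<theta>' where \<theta>': "(\<theta> has_vector_derivative \<theta>') (at c0)"
    using \<theta>(1) J at_within_open[OF J(2,1)] unfolding One_nat_def J_def[symmetric]
    by (metis Ck_on_real_SucE)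
  obtain per' where per': "(per has_vector_derivative per') (at c0)"
    using per(1) J at_within_open[OF J(2,1)] unfolding One_nat_def J_def[symmetric]
    by (metis Ck_on_real_SucE)
  obtain a where a: "\<theta> c0 = X\<^sub>0 a" using \<theta>(2) orbit_traj[of 0] by auto
  \<comment> \<open>Moving the base point by whole periods makes the phase nonnegative and the transport time positive.\<close>
  obtain n :: nat where n: "0 \<le> s + real n * \<tau>" "0 < s + real n * \<tau> - a"
  proof -
    obtain n :: nat where "max (- s) (a - s) < real n * \<tau>"
      using reals_Archimedean3[OF \<tau>_pos] by blast
    then show ?thesis by (intro that[of n]) auto
  qed
  define s0 where "s0 = s + real n * \<tau>"
  define ts where "ts = s0 - a"
  have ts: "0 < ts" "a + ts = s0" using n by (auto simp: ts_def s0_def)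
  have zero0: "simple_zero M s0"
  proof -
    have M: "M (x + real n * \<tau>) = M x" for x by (rule periodic_nat_shift) (rule melnikov_periodic)
    obtain d where "M s = 0" "(M has_real_derivative d) (at s)" "d \<noteq> 0"
      using zero by (auto simp: simple_zero_def)
    moreover from this have "(M has_real_derivative d) (at s0)"
      unfolding s0_def DERIV_shift M by simp
    ultimately show ?thesis using M[of s] by (auto simp: simple_zero_def s0_def)
  qed
  define xc where "xc c = traj0 f S (\<theta> c) ts" for c
  define Pc where "Pc c = real m * per c" for c
  obtain e X where ch: "flow_chart (real l) (X\<^sub>0 a) ts e X" by (rule chart_base[OF ts(1)])
  have e: "0 < e" using ch by (simp add: flow_chart_def)
  have XC: "Ck_on (Suc k) (\<lambda>z. X (1, z)) (ball (X\<^sub>0 a, ts) e \<times> {0..<e})"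
    by (rule Ck_spatial_section[of _ _ "{0..1}"]) (use ch in \<open>simp_all only: flow_chart_def, simp\<close>)
  obtain \<Psi> where \<Psi>: "((\<lambda>y. X (1, y, 0)) has_derivative \<Psi>) (at (X\<^sub>0 a, ts))"
    by (rule Ck_on_slice_derivative[OF XC]) (use e in auto)
  have cf: "((\<lambda>c. (\<theta> c, ts)) has_vector_derivative (\<theta>', 0)) (at c0)"
    by (intro has_vector_derivative_Pair \<theta>' has_vector_derivative_const)
  have near: "\<forall>\<^sub>F c in nhds c0. (\<theta> c, ts) \<in> ball (X\<^sub>0 a, ts) e"
    using isCont_eventually_in[OF has_vector_derivative_continuous[OF cf], of "ball (X\<^sub>0 a, ts) e"] e a by simp
  have ev: "\<forall>\<^sub>F c in nhds c0. X (1, (\<theta> c, ts), 0) = xc c"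
    using near by eventually_elim (use chart_traj0[OF ch, of _ _ 1] in \<open>simp add: xc_def\<close>)
  have xc': "(xc has_vector_derivative \<Psi> (\<theta>', 0)) (at c0)"
  proof -
    have "((\<lambda>c. X (1, (\<theta> c, ts), 0)) has_derivative (\<lambda>h. \<Psi> (h *\<^sub>R (\<theta>', 0)))) (at c0)"
      by (rule has_derivative_compose[where f="\<lambda>c. (\<theta> c, ts)" and g="\<lambda>y. X (1, y, 0)"])
        (use cf \<Psi> a in \<open>auto simp: has_vector_derivative_def\<close>)
    then have "((\<lambda>c. X (1, (\<theta> c, ts), 0)) has_vector_derivative \<Psi> (\<theta>', 0)) (at c0)"
      by (simp add: has_vector_derivative_def linear_scale[OF has_derivative_linear[OF \<Psi>]] del: scaleR_Pair)
    then show ?thesis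
      unfolding has_vector_derivative_def
      by (rule has_derivative_transform_eventually)
        (use ev eventually_nhds_x_imp_x[OF ev] in \<open>auto simp: eventually_at_filter elim: eventually_mono\<close>)
  qed
  show ?thesis
  proof (rule persistent[OF D(1,2) Ck_along_Suc_D[OF D(3)], of c0 xc _ s0 Pc _])
    show "L (X\<^sub>0 t) P\<^sub>0 = c0" for t
    proof -
      have "L (traj0 f S (\<theta> c0) (t - a)) (real m * per c0) = c0" using orb[of c0] \<delta> by simp
      then show ?thesis by (simp add: a orbit_traj per P\<^sub>0_def)
    qed
    show "(xc has_vector_derivative \<Psi> (\<theta>', 0)) (at c0)" by (rule xc')
    show "xc c0 = X\<^sub>0 s0" by (simp add: xc_def a orbit_traj ts)
    show "(Pc has_vector_derivative real m * per') (at c0)"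
      unfolding Pc_def by (intro has_vector_derivative_mult_right per')
    show "Pc c0 = P\<^sub>0" by (simp add: Pc_def P\<^sub>0_def per)
    show "\<forall>\<^sub>F c in nhds c0. traj0 f S (xc c) (Pc c) = xc c \<and> L (xc c) (Pc c) = c"
      using nearJ
    proof eventually_elim
      case (elim c)
      then obtain Z where Z: "periodic_orbit f S (per c) Z" "\<theta> c \<in> Z"
        using orb[of c] by (auto simp: J_def)
      obtain Xc where Xc: "Xc 0 = \<theta> c" "\<And>t. Xc (t + per c) = Xc t" "\<And>s t. traj0 f S (Xc s) t = Xc (s + t)"
        using periodic_orbit_traj[OF open_S f_C1 Z] by metis
      have x: "xc c = Xc ts" using Xc(3)[of 0 ts] by (simp add: xc_def Xc(1))
      have "traj0 f S (xc c) (Pc c) = xc c"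
        unfolding x Xc(3) Pc_def by (rule periodic_nat_shift) (rule Xc(2))
      moreover have "L (xc c) (Pc c) = c"
        using orb[of c] elim by (simp add: J_def xc_def Pc_def)
      ultimately show ?case ..
    qed
  qed (use n zero0 normal in \<open>auto simp: s0_def\<close>)
qed

end

section \<open>Mechanical systems\<close>

lemma grad_has_derivative:
  fixes h :: "'a::euclidean_space \<Rightarrow> real"
  assumes "(h has_derivative D) (at x)"
  shows "GDERIV h x :> grad h x" "grad h x \<bullet> w = D w"
proof -
  have lin: "linear D" using assms by (rule has_derivative_linear)
  define v where "v = (\<Sum>i\<in>Basis. D i *\<^sub>R i)"
  have v: "w \<bullet> v = D w" for w
  proof -
    have "w \<bullet> v = (\<Sum>i\<in>Basis. (w \<bullet> i) * D i)"
      by (simp add: v_def inner_sum_right mult.commute)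
    also have "\<dots> = D (\<Sum>i\<in>Basis. (w \<bullet> i) *\<^sub>R i)"
      by (simp add: linear_sum[OF lin] linear_scale[OF lin])
    finally show ?thesis by (simp add: euclidean_representation)
  qed
  have G: "GDERIV h x :> v" using assms v by (simp add: gderiv_def)
  moreover have "v' = v" if "GDERIV h x :> v'" for v'
  proof -
    have "(\<lambda>w. w \<bullet> v') = (\<lambda>w. w \<bullet> v)"
      using that G unfolding gderiv_def by (rule has_derivative_unique)
    then have "w \<bullet> (v' - v) = 0" for w
      by (simp add: inner_diff_right) metis
    then show ?thesis using inner_eq_zero_iff[of "v' - v"] by simp
  qed
  ultimately have g: "grad h x = v" unfolding grad_def by (rule the_equality)
  show "GDERIV h x :> grad h x" using G g by simp
  show "grad h x \<bullet> w = D w" using v[of w] g by (simp add: inner_commute)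
qed

lemma bounded_bilinear_matrix_vector:
  "bounded_bilinear (\<lambda>A v. (A :: real^'n^'m) *v v)"
  unfolding bilinear_conv_bounded_bilinear[symmetric] bilinear_def
  by (auto intro!: linearI simp: matrix_vector_mult_add_rdistrib matrix_vector_right_distrib
      matrix_vector_mult_scaleR scaleR_matrix_vector_assoc)

lemmas Ck_along_matrix_vector = Ck_along_bilinear[OF bounded_bilinear_matrix_vector]

lemma inner_Basis_matrix:
  fixes B :: "real^'n^'m"
  assumes "B \<in> Basis"
  obtains i j where "\<And>A :: real^'n^'m. A \<bullet> B = axis i 1 \<bullet> (A *v axis j 1)"
proof -
  obtain i j where "B = axis i (axis j 1)" using assms by (auto simp: Basis_vec_def)
  then have "A \<bullet> B = axis i 1 \<bullet> (A *v axis j 1)" for A :: "real^'n^'m"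
    by (simp add: inner_axis inner_axis' matrix_vector_mult_basis column_def)
  then show ?thesis by (rule that)
qed

locale mechanical =
  fixes U :: "(real^'n) set" and Mass :: "real^'n \<Rightarrow> real^'n^'n" and V :: "real^'n \<Rightarrow> real"
    and Q :: "real^'n \<Rightarrow> real^'n \<Rightarrow> real \<Rightarrow> real \<Rightarrow> real \<Rightarrow> real^'n" and k :: nat
  assumes system: "mechanical_system (Suc (Suc k)) U Mass V Q"
begin

abbreviation "f \<equiv> mech_f Mass V"
abbreviation "g \<equiv> mech_g Mass Q"

lemma open_U: "open U"
  using system by (simp add: mechanical_system_def)

lemma Mass_sym: "q \<in> U \<Longrightarrow> transpose (Mass q) = Mass q"
  and Mass_pos: "q \<in> U \<Longrightarrow> v \<noteq> 0 \<Longrightarrow> 0 < v \<bullet> (Mass q *v v)"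
  using system by (auto simp: mechanical_system_def)

lemma Mass_inner: "q \<in> U \<Longrightarrow> v \<bullet> (Mass q *v w) = (Mass q *v v) \<bullet> w"
  using Mass_sym[of q] by (metis dot_lmul_matrix transpose_matrix_vector)

lemma Mass_inv: "q \<in> U \<Longrightarrow> Mass q *v (matrix_inv (Mass q) *v w) = w"
proof -
  assume q: "q \<in> U"
  have "inj ((*v) (Mass q))"
  proof (rule injI)
    fix v w assume "Mass q *v v = Mass q *v w"
    then have "(v - w) \<bullet> (Mass q *v (v - w)) = 0" by (simp add: matrix_vector_mult_diff_distrib)
    then show "v = w" using Mass_pos[OF q, of "v - w"] by force
  qed
  then have "invertible (Mass q)"
    by (simp add: invertible_left_inverse matrix_left_invertible_injective)
  then have "Mass q ** matrix_inv (Mass q) = mat 1"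
    unfolding invertible_def matrix_inv_def by (rule someI2_ex) simp
  then show ?thesis by (simp add: matrix_vector_mul_assoc)
qed

definition DM where "DM q = frechet_derivative Mass (at q)"
definition DV where "DV q = frechet_derivative V (at q)"

lemma DM: "q \<in> U \<Longrightarrow> (Mass has_derivative DM q) (at q)"
  and DV: "q \<in> U \<Longrightarrow> (V has_derivative DV q) (at q)"
proof -
  have d: "Mass differentiable at q \<and> V differentiable at q" if q: "q \<in> U"
    using system q at_within_open[OF q open_U] unfolding mechanical_system_def differentiable_on_def by metis
  show "(Mass has_derivative DM q) (at q)" if "q \<in> U"
    using d[OF that] by (simp add: DM_def frechet_derivative_works)
  show "(V has_derivative DV q) (at q)" if "q \<in> U"
    using d[OF that] by (simp add: DV_def frechet_derivative_works)
qed

lemma DM_lin: "q \<in> U \<Longrightarrow> linear (DM q)"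
  using DM has_derivative_linear by blast

lemma DM_sym: "q \<in> U \<Longrightarrow> v \<bullet> (DM q a *v w) = w \<bullet> (DM q a *v v)"
proof -
  assume q: "q \<in> U"
  have T: "((\<lambda>q. v \<bullet> (Mass q *v w)) has_derivative (\<lambda>a. v \<bullet> (DM q a *v w))) (at q)" for v w
    by (intro has_derivative_inner_right
        bounded_linear.has_derivative[OF bounded_bilinear.bounded_linear_left[OF bounded_bilinear_matrix_vector]] DM q)
  have "((\<lambda>q. v \<bullet> (Mass q *v w)) has_derivative (\<lambda>a. w \<bullet> (DM q a *v v))) (at q)"
    by (rule has_derivative_transform_within_open[OF T open_U q]) (metis Mass_inner inner_commute)
  from has_derivative_unique[OF this T] show ?thesis by metis
qed

lemma grad_V: "q \<in> U \<Longrightarrow> grad V q \<bullet> w = DV q w"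
  by (rule grad_has_derivative(2)[OF DV])

lemma grad_kinetic: "q \<in> U \<Longrightarrow> grad (\<lambda>q'. kinetic_energy Mass q' v) q \<bullet> w = (1 / 2) * (v \<bullet> (DM q w *v v))"
proof (rule grad_has_derivative(2))
  assume q: "q \<in> U"
  show "((\<lambda>q'. kinetic_energy Mass q' v) has_derivative (\<lambda>w. (1 / 2) * (v \<bullet> (DM q w *v v)))) (at q)"
    unfolding kinetic_energy_def
    by (intro has_derivative_mult_right has_derivative_inner_right
        bounded_linear.has_derivative[OF bounded_bilinear.bounded_linear_left[OF bounded_bilinear_matrix_vector]] DM q)
qed

lemma inertial: "q \<in> U \<Longrightarrow> w \<bullet> inertial_force Mass q v = w \<bullet> (DM q v *v v) - (1 / 2) * (v \<bullet> (DM q w *v v))"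
  using grad_kinetic[of q v w] by (simp add: inertial_force_def DM_def inner_diff_right inner_commute)

text \<open>The equations of motion tested with \<open>w\<close>, in which the inverse of the mass matrix has disappeared.\<close>

lemma force: "q \<in> U \<Longrightarrow> (Mass q *v w) \<bullet> snd (f (q, v))
    = - DV q w - w \<bullet> (DM q v *v v) + (1 / 2) * (v \<bullet> (DM q w *v v))"
proof -
  assume q: "q \<in> U"
  have "(Mass q *v w) \<bullet> snd (f (q, v)) = w \<bullet> (Mass q *v snd (f (q, v)))"
    by (simp add: Mass_inner[OF q])
  also have "\<dots> = - (w \<bullet> (grad V q + inertial_force Mass q v))"
    by (simp add: mech_f_def Mass_inv[OF q] bounded_bilinear.minus_right[OF bounded_bilinear_matrix_vector]
        inner_diff_right inner_add_right)
  finally show ?thesis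
    using grad_V[OF q, of w] by (simp add: inner_add_right inertial[OF q] inner_commute)
qed

text \<open>In this second difference the potential cancels and the quadratic velocity terms are polarised: \<open>acc q a u\<close>
  is \<open>- 2 \<Gamma>(a, u)\<close>, where \<open>\<Gamma>\<close> are the Christoffel symbols of the metric \<open>Mass\<close>.\<close>

definition acc where "acc q a u = snd (f (q, a + u)) - snd (f (q, a)) - snd (f (q, u)) + snd (f (q, 0))"

text \<open>The compatibility of a metric with its Christoffel symbols,
  \<open>D\<^sub>a \<langle>w, u\<rangle> = \<langle>w, \<Gamma>(a, u)\<rangle> + \<langle>u, \<Gamma>(a, w)\<rangle>\<close>. It expresses the derivative of the mass matrix by the mass matrix and the
  vector field.\<close>

lemma DM_formula:
  assumes q: "q \<in> U"
  shows "w \<bullet> (DM q a *v u) = - (1 / 2) * ((Mass q *v w) \<bullet> acc q a u + (Mass q *v u) \<bullet> acc q a w)"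
proof -
  have mv: "DM q (a + b) = DM q a + DM q b" "DM q 0 = 0" for a b
    using linear_add[OF DM_lin[OF q]] linear_0[OF DM_lin[OF q]] by auto
  have half: "(Mass q *v w) \<bullet> acc q a u = - (w \<bullet> (DM q a *v u)) - w \<bullet> (DM q u *v a) + u \<bullet> (DM q w *v a)" for w u
    using DM_sym[OF q, of a w u]
    by (simp add: acc_def inner_add_right inner_diff_right force[OF q] mv matrix_vector_mult_add_rdistrib
        matrix_vector_right_distrib inner_add_left field_simps)
  show ?thesis
    using DM_sym[OF q, of w a u] by (simp add: half field_simps)
qed

lemma f_Ck: "Ck_on (Suc (Suc k)) f (U \<times> UNIV)"
  using system by (simp add: mechanical_system_def del: Ck_along.simps)

lemma acc_Ck: "Ck_on (Suc (Suc k)) (\<lambda>q. acc q a u) U"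
proof -
  have "Ck_on (Suc (Suc k)) (\<lambda>q. f (q, v)) U" for v
    by (rule Ck_on_compose[OF f_Ck]) (auto simp del: Ck_along.simps intro!: Ck_along_Pair Ck_along_id Ck_along_const)
  then show ?thesis
    unfolding acc_def by (intro Ck_along_add Ck_along_diff Ck_along_snd)
qed

text \<open>By \<open>DM_formula\<close> the derivative of \<open>Mass\<close> is as smooth as \<open>Mass\<close> itself, up to the order of \<open>f\<close>; hence \<open>Mass\<close> gains
  one order at a time.\<close>

lemma Mass_Ck: "j \<le> Suc (Suc (Suc k)) \<Longrightarrow> Ck_on j Mass U"
  and DM_Ck: "j \<le> Suc (Suc k) \<Longrightarrow> Ck_on j Mass U \<Longrightarrow> Ck_on j (\<lambda>q. DM q a) U"
proof -
  show DM_Ck: "Ck_on j (\<lambda>q. DM q a) U" if j: "j \<le> Suc (Suc k)" and M: "Ck_on j Mass U" for j a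
  proof -
    have "Ck_on j (\<lambda>q. DM q a \<bullet> B) U" if B: "B \<in> Basis" for B
    proof -
      obtain i i' where ii: "\<And>A :: real^'n^'n. A \<bullet> B = axis i 1 \<bullet> (A *v axis i' 1)"
        using inner_Basis_matrix[OF B] by blast
      have "Ck_on j (\<lambda>q. - (1 / 2) * ((Mass q *v axis i 1) \<bullet> acc q a (axis i' 1)
          + (Mass q *v axis i' 1) \<bullet> acc q a (axis i 1))) U"
        by (intro Ck_along_mult Ck_along_add Ck_along_inner Ck_along_matrix_vector Ck_along_const M
            Ck_along_le[OF acc_Ck j])
      then show ?thesis
        by (rule Ck_along_cong[THEN iffD2, rotated]) (simp only: ii DM_formula)
    qed
    then have "Ck_on j (\<lambda>q. \<Sum>B\<in>Basis. (DM q a \<bullet> B) *\<^sub>R B) U"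
      by (intro Ck_along_sum Ck_along_scaleR Ck_along_const)
    then show ?thesis by (simp only: euclidean_representation)
  qed
  show "j \<le> Suc (Suc (Suc k)) \<Longrightarrow> Ck_on j Mass U"
  proof (induction j)
    case 0
    show ?case using DM has_derivative_continuous_on[of U Mass DM]
      by (auto intro: has_derivative_at_withinI)
  next
    case (Suc j)
    then have M: "Ck_on j Mass U" by simp
    show ?case
    proof (rule Ck_along_SucI[where f'=DM])
      show "(Mass has_derivative DM q) (at q within {y \<in> U. y - q \<in> UNIV})" if "q \<in> U" for q
        by (rule has_derivative_at_withinI[OF DM[OF that]])
    qed (use DM_Ck[OF _ M] Suc.prems Ck_along_continuous[OF M] in auto)
  qed
qed

lemma energy_derivative:
  assumes q: "fst x \<in> U"
  shows "(energy Mass V has_derivative (\<lambda>w. (1 / 2) * (snd x \<bullet> (DM (fst x) (fst w) *v snd x))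
      + (Mass (fst x) *v snd x) \<bullet> snd w + DV (fst x) (fst w))) (at x)"
proof -
  have dM: "((\<lambda>x. Mass (fst x)) has_derivative (\<lambda>w. DM (fst x) (fst w))) (at x)"
    by (rule has_derivative_compose[where f=fst and g=Mass, OF _ DM[OF q]]) (auto intro!: derivative_eq_intros)
  have dV: "((\<lambda>x. V (fst x)) has_derivative (\<lambda>w. DV (fst x) (fst w))) (at x)"
    by (rule has_derivative_compose[where f=fst and g=V, OF _ DV[OF q]]) (auto intro!: derivative_eq_intros)
  have ds: "(snd has_derivative snd) (at x)" by (auto intro!: derivative_eq_intros)
  have comm: "w \<bullet> (Mass (fst x) *v snd x) = (Mass (fst x) *v snd x) \<bullet> w" for w
    by (rule inner_commute)
  have "((\<lambda>x. (1 / 2) * (snd x \<bullet> (Mass (fst x) *v snd x)) + V (fst x)) has_derivative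
      (\<lambda>w. (1 / 2) * (snd x \<bullet> (Mass (fst x) *v snd w + DM (fst x) (fst w) *v snd x)
        + snd w \<bullet> (Mass (fst x) *v snd x)) + DV (fst x) (fst w))) (at x)"
    by (intro has_derivative_add has_derivative_mult_right has_derivative_inner ds dV
        bounded_bilinear.FDERIV[OF bounded_bilinear_matrix_vector dM ds])
  then show ?thesis
    unfolding energy_def[abs_def] kinetic_energy_def
    by (rule has_derivative_eq_rhs)
      (simp add: fun_eq_iff inner_add_right Mass_inner[OF q, of "snd x" "snd w" for w] comm field_simps)
qed

lemmas energy_grad = grad_has_derivative[OF energy_derivative]

lemma DV_force: "q \<in> U \<Longrightarrow> DV q a = - ((Mass q *v a) \<bullet> snd (f (q, 0)))"
  using linear_0[OF DM_lin] by (simp add: force)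

lemma power_eq:
  assumes "fst x \<in> U"
  shows "grad (energy Mass V) x \<bullet> g x t T \<epsilon> = (Mass (fst x) *v snd x) \<bullet> snd (g x t T \<epsilon>)"
  using linear_0[OF DM_lin[OF assms]] linear_0[OF has_derivative_linear[OF DV[OF assms]]]
  by (simp add: energy_grad(2)[OF assms] mech_g_def split_beta)

lemma conservative: "conservative_system f g (U \<times> UNIV) (energy Mass V) k"
proof
  show "open (U \<times> (UNIV :: (real^'n) set))" by (intro open_Times open_U open_UNIV)
  show "Ck_on (Suc k) f (U \<times> UNIV)" by (rule Ck_along_Suc_D[OF f_Ck])
  define dom :: "(((real^'n) \<times> (real^'n)) \<times> real \<times> real \<times> real) set"
    where "dom = (U \<times> UNIV) \<times> UNIV \<times> {0<..} \<times> {0..}"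
  have gC: "Ck_on (Suc k) (\<lambda>(x, t, T, \<epsilon>). g x t T \<epsilon>) dom"
    using system by (simp add: mechanical_system_def dom_def Let_def del: Ck_along.simps)
  then show "Ck_on (Suc k) (\<lambda>(x, t, T, \<epsilon>). g x t T \<epsilon>) ((U \<times> UNIV) \<times> UNIV \<times> {0<..} \<times> {0..})"
    by (simp only: dom_def)
  show "GDERIV (energy Mass V) x :> grad (energy Mass V) x" if "x \<in> U \<times> UNIV" for x
    using energy_grad(1)[of x] that by auto
  have DMc: "continuous_on U (\<lambda>q. DM q a)" for a
    by (rule Ck_along_continuous[OF DM_Ck[of 0]]) (use Mass_Ck[of 0] in auto)
  have Mc: "continuous_on U Mass" by (rule Ck_along_continuous[OF Mass_Ck[of 0]]) simp
  have fc: "continuous_on (U \<times> UNIV) f" by (rule Ck_along_continuous[OF f_Ck])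
  have gc: "continuous_on (U \<times> UNIV) (\<lambda>x. grad (energy Mass V) x \<bullet> w)" for w
  proof -
    have "continuous_on (U \<times> UNIV) (\<lambda>x. (1 / 2) * (snd x \<bullet> (DM (fst x) (fst w) *v snd x))
      + (Mass (fst x) *v snd x) \<bullet> snd w + - ((Mass (fst x) *v fst w) \<bullet> snd (f (fst x, 0))))"
      by (intro continuous_intros bounded_bilinear.continuous_on[OF bounded_bilinear_matrix_vector]
          continuous_on_compose2[OF DMc] continuous_on_compose2[OF Mc] continuous_on_compose2[OF fc]) auto
    then show ?thesis
      by (rule continuous_on_eq) (auto simp: energy_grad(2) DV_force)
  qed
  have "continuous_on (U \<times> UNIV) (\<lambda>x. \<Sum>i\<in>Basis. (grad (energy Mass V) x \<bullet> i) *\<^sub>R i)"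
    by (intro continuous_on_sum continuous_on_scaleR continuous_on_const gc)
  then show "continuous_on (U \<times> UNIV) (grad (energy Mass V))"
    by (simp add: euclidean_representation)
  fix x assume x: "x \<in> U \<times> (UNIV :: (real^'n) set)"
  then have q: "fst x \<in> U" by auto
  have fx: "fst (f x) = snd x" by (simp add: mech_f_def split_beta)
  show "grad (energy Mass V) x \<bullet> f x = 0"
    using force[OF q, of "snd x" "snd x"] by (simp add: energy_grad(2)[OF q] fx)
  show "grad (energy Mass V) x \<noteq> 0" if nz: "f x \<noteq> 0"
  proof
    assume "grad (energy Mass V) x = 0"
    then have z: "(1 / 2) * (snd x \<bullet> (DM (fst x) (fst w) *v snd x))
      + (Mass (fst x) *v snd x) \<bullet> snd w + DV (fst x) (fst w) = 0" for w
      using energy_grad(2)[OF q, of w] by simp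
    have "(Mass (fst x) *v snd x) \<bullet> snd x = 0"
      using z[of "(0, snd x)"] linear_0[OF DM_lin[OF q]] linear_0[OF has_derivative_linear[OF DV[OF q]]] by simp
    then have v: "snd x = 0"
      using Mass_pos[OF q, of "snd x"] by (force simp: inner_commute)
    have x0: "(fst x, 0) = x" using v by (simp add: prod_eq_iff)
    have "(Mass (fst x) *v w) \<bullet> snd (f x) = 0" for w
      using z[of "(w, 0)"] force[OF q, of w 0] v linear_0[OF DM_lin[OF q]] by (simp add: x0)
    from this[of "matrix_inv (Mass (fst x)) *v snd (f x)"] have "snd (f x) = 0"
      by (simp add: Mass_inv[OF q])
    then show False using nz fx v by (simp add: prod_eq_iff)
  qed
next
  define dom :: "(((real^'n) \<times> (real^'n)) \<times> real \<times> real \<times> real) set"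
    where "dom = (U \<times> UNIV) \<times> UNIV \<times> {0<..} \<times> {0..}"
  have gC: "Ck_on (Suc k) (\<lambda>z. g (fst z) (fst (snd z)) (fst (snd (snd z))) (snd (snd (snd z)))) dom"
    using system by (simp add: mechanical_system_def dom_def Let_def case_prod_beta' del: Ck_along.simps)
  have "Ck_on (Suc k) (\<lambda>z. Mass (fst (fst z))) dom"
    by (rule Ck_on_compose[OF Mass_Ck, of _ _ "\<lambda>z. fst (fst z)"])
      (auto simp: dom_def simp del: Ck_along.simps intro!: Ck_along_fst Ck_along_id)
  then have "Ck_on (Suc k) (\<lambda>z. (Mass (fst (fst z)) *v snd (fst z)) \<bullet>
      snd (g (fst z) (fst (snd z)) (fst (snd (snd z))) (snd (snd (snd z))))) dom"
    by (intro Ck_along_inner Ck_along_matrix_vector Ck_along_snd Ck_along_fst Ck_along_id gC)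
  then have "Ck_on (Suc k) (\<lambda>(x, t, T, \<epsilon>). grad (energy Mass V) x \<bullet> g x t T \<epsilon>) dom"
    by (rule Ck_along_cong[THEN iffD2, rotated]) (auto simp: dom_def power_eq)
  then show "Ck_on (Suc k) (\<lambda>(x, t, T, \<epsilon>). grad (energy Mass V) x \<bullet> g x t T \<epsilon>)
      ((U \<times> UNIV) \<times> UNIV \<times> {0<..} \<times> {0..})"
    by (simp only: dom_def)
next
  fix x t T \<epsilon> assume "x \<in> U \<times> (UNIV :: (real^'n) set)" "(0::real) < T" "(0::real) \<le> \<epsilon>"
  then show "g x (t + T) T \<epsilon> = g x t T \<epsilon>"
    using system by (auto simp: mechanical_system_def mech_g_def)
qed

end

theorem theorem3p1:
  fixes U :: "(real^'n) set"
    and Mass :: "real^'n \<Rightarrow> real^'n^'n"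
    and V :: "real^'n \<Rightarrow> real"
    and Q :: "real^'n \<Rightarrow> real^'n \<Rightarrow> real \<Rightarrow> real \<Rightarrow> real \<Rightarrow> real^'n"
    and L :: "(real^'n) \<times> (real^'n) \<Rightarrow> real \<Rightarrow> real"
    and Z :: "((real^'n) \<times> (real^'n)) set"
    and p :: "(real^'n) \<times> (real^'n)"
    and \<tau> :: real
    and r l m :: nat
  assumes "S = U \<times> UNIV" and "f = mech_f Mass V" and "g = mech_g Mass Q"
    and "M = melnikov f g (energy Mass V) S l m \<tau> p"
    and "2 \<le> r"
    and "mechanical_system r U Mass V Q"
    and "periodic_orbit f S \<tau> Z" and "p \<in> Z"
    and "0 < l" and "0 < m" and "coprime l m"
    and "m_normal f S m \<tau> p"
    and "family_parametrisation r f S m \<tau> p L"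
  shows "(\<forall>s0. simple_zero M s0 \<longrightarrow>
            smoothly_persists r f g S L l m \<tau> p \<and>
            (\<exists>s1. s0 < s1 \<and> s1 < s0 + real m * \<tau> \<and> topologically_transverse_zero M s1)) \<and>
         ((\<exists>c>0. \<forall>s. c \<le> \<bar>M s\<bar>) \<longrightarrow> \<not> smoothly_persists r f g S L l m \<tau> p)"
proof -
  obtain k where r: "r = Suc (Suc k)"
    using \<open>2 \<le> r\<close> by (metis Suc_le_D numeral_2_eq_2 Suc_le_mono)
  interpret mechanical U Mass V Q k
    using assms(6) unfolding r by unfold_locales
  interpret conservative_system f g S "energy Mass V" k
    unfolding assms(1-3) by (rule conservative)
  obtain X where X: "solves (\<lambda>_. f) S UNIV X" "X 0 = p" "\<And>t. X (t + \<tau>) = X t" "0 < \<tau>"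
    "\<And>s t. traj0 f S (X s) t = X (s + t)" "\<And>t. f (X t) \<noteq> 0"
    using periodic_orbit_traj[OF open_S f_C1 assms(7,8)] by metis
  interpret forced_orbit f g S "energy Mass V" k X \<tau> l m
    by unfold_locales (use X assms(9,10) in auto)
  have M: "M = melnikov f g (energy Mass V) S l m \<tau> (X 0)" using assms(4) X(2) by simp
  show ?thesis
  proof (intro conjI allI impI)
    fix s0 assume z: "simple_zero M s0"
    show "smoothly_persists r f g S L l m \<tau> p"
      using persistent_family[of L s0] assms(12,13) z unfolding M r X(2) by simp
    obtain s1 where s1: "s0 < s1" "s1 < s0 + \<tau>" "topologically_transverse_zero M s1"
      using transverse_zero_after_simple_zero[OF melnikov_continuous melnikov_periodic X(4)] z unfolding M by blast
    have "\<tau> \<le> real m * \<tau>" using X(4) assms(10) by simp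
    then have "s1 < s0 + real m * \<tau>" using s1(2) by linarith
    then show "\<exists>s1. s0 < s1 \<and> s1 < s0 + real m * \<tau> \<and> topologically_transverse_zero M s1"
      using s1 by blast
  next
    assume "\<exists>c>0. \<forall>s. c \<le> \<bar>M s\<bar>"
    then show "\<not> smoothly_persists r f g S L l m \<tau> p"
      using not_persistent unfolding M X(2)[symmetric] by blast
  qed
qed

end
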